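(* Let $P$ be a noncommutative Poisson conformal algebra and $V$ a module over $P$. Then $\mathrm d_{\mathrm{FGV}}\circ\mathrm d_{\mathrm{FGV}}=0$, i.e. $\big(\bigoplus_{k\ge0}C^k_{\mathrm{FGV}}(P,V),\mathrm d_{\mathrm{FGV}}\big)$ is a cochain complex.
   Context: All vector spaces are over $\mathbb{C}$. In expressions such as $b_{-\lambda-\partial}u$ the variable is replaced by $-\lambda-\partial$ with $\partial$ moved to the left, acting on the coefficients. Algebras and modules. A conformal algebra is a $\mathbb{C}[\partial]$-module $A$ with a bilinear map $A\times A\to A[\lambda]$, $(a,b)\mapsto a_\lambda b$, with $(\partial a)_\lambda b=-\lambda a_\lambda b$, $a_\lambda(\partial b)=(\partial+\lambda)(a_\lambda b)$. A noncommutative Poisson conformal algebra $(P,\circ_\lambda,[\cdot_\lambda\cdot])$ is a $\mathbb{C}[\partial]$-module such that both operations are conformal algebra structures, $a\circ_\lambda(b\circ_\mu c)=(a\circ_\lambda b)\circ_{\lambda+\mu}c$, $[a_\lambda b]=-[b_{-\lambda-\partial}a]$, $[a_\lambda[b_\mu c]]=[[a_\lambda b]_{\lambda+\mu}c]+[b_\mu[a_\lambda c]]$, and $[a_\lambda(b\circ_\mu c)]=[a_\lambda b]\circ_{\lambda+\mu}c+b\circ_\mu[a_\lambda c]$. A module over $P$ is a $\mathbb{C}[\partial]$-module $V$ with bilinear maps $(a,v)\mapsto a\circ_\lambda v$, $(v,a)\mapsto v\circ_\lambda a$, $(a,v)\mapsto a_\lambda v$ into $V[\lambda]$, each satisfying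 the conformal rule (applying $\partial$ to the left argument multiplies by $-\lambda$, to the right argument multiplies by $\partial+\lambda$), and $(a\circ_\lambda b)\circ_{\lambda+\mu}v=a\circ_\lambda(b\circ_\mu v)$, $(v\circ_\lambda b)\circ_{\lambda+\mu}a=v\circ_\lambda(b\circ_\mu a)$, $(a\circ_\lambda v)\circ_{\lambda+\mu}b=a\circ_\lambda(v\circ_\mu b)$, $[a_\lambda b]_{\lambda+\mu}v=a_\lambda(b_\mu v)-b_\mu(a_\lambda v)$, $[a_\lambda b]\circ_{\lambda+\mu}v=a_\lambda(b\circ_\mu v)-b\circ_\mu(a_\lambda v)$, $v\circ_\mu[a_\lambda b]=a_\lambda(v\circ_\mu b)-(a_\lambda v)\circ_{\lambda+\mu}b$, $(a\circ_\lambda b)_{-\mu-\partial}v=a\circ_\lambda(b_{-\mu-\partial}v)+(a_{-\mu-\partial}v)\circ_{\lambda+\mu}b$ (each $\partial$ acting on the value of the bracketed expression in which it occurs). Cochains. For $k\ge1$ a $k$-$\lambda$-bracket on $P$ with coefficients in $V$ is a linear map $\gamma:P^{\otimes k}\to\mathbb{C}[\lambda_1,\dots,\lambda_{k-1}]\otimes V$, $a_1\otimes\cdots\otimes a_k\mapsto\{a_{1\,\lambda_1}\cdots a_{k-1\,\lambda_{k-1}}a_k\}_\gamma$, such that replacing $a_i$ by $\partial a_i$ multiplies by $-\lambda_i$ for $i\le k-1$, and replacing $a_k$ by $\partial a_k$ multiplies by $\lambda_1+\cdots+\lambda_{k-1}+\partial$. Set $C^{0,0}(P,V)=V/\partial V$.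 For $m\ge1$, $C^{m,0}(P,V)$ is the space of $m$-$\lambda$-brackets that are skew-symmetric: $\{x_{1\,\lambda_1}\cdots x_{m-1\,\lambda_{m-1}}x_m\}_\gamma=\mathrm{sign}(\sigma)\{x_{\sigma(1)\,\lambda_{\sigma(1)}}\cdots x_{\sigma(m-1)\,\lambda_{\sigma(m-1)}}x_{\sigma(m)}\}_\gamma|_{\lambda_m\mapsto\lambda_m^\dagger}$ for all permutations $\sigma$, where $\lambda_m^\dagger=-\sum_{j=1}^{m-1}\lambda_j-\partial$ with $\partial$ moved to the left. For $m\ge0$, $n\ge1$, $C^{m,n}(P,V)$ is the space of $(m+n)$-$\lambda$-brackets, written $\{x_{1\,\lambda_1}\cdots x_{m\,\lambda_m}a_{1\,\mu_1}\cdots a_{n-1\,\mu_{n-1}}a_n\}_\gamma$, that are multiplied by $\mathrm{sign}(\sigma)$ under simultaneous permutation $\sigma$ of $x_1,\dots,x_m$ and $\lambda_1,\dots,\lambda_m$. For $m\ge1$ the natural inclusion $\iota_m:C^{m,0}(P,V)\hookrightarrow C^{m-1,1}(P,V)$ regards $\{x_{1\,\lambda_1}\cdots x_{m-1\,\lambda_{m-1}}x_m\}_\gamma$ as a bracket with $m-1$ arguments $x_1,\dots,x_{m-1}$ and $a_1=x_m$. The operator $\mathrm d^{m,n}_{\mathrm{CE}}:C^{m,n}(P,V)\to C^{m+1,n}(P,V)$. For $m=n=0$: $\{a\}_{\mathrm d_{\mathrm{CE}}(v+\partial V)}=a_{-\partial}v$. For $n=0$, $k=m\ge1$ (hats denote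 omission, $\lambda_{k+1}^\dagger=-\sum_{j=1}^k\lambda_j-\partial$ with $\partial$ moved to the left): $$\{a_{1\,\lambda_1}\cdots a_{k\,\lambda_k}a_{k+1}\}_{\mathrm d_{\mathrm{CE}}\gamma}=\sum_{i=1}^k(-1)^{i+1}a_{i\,\lambda_i}\{a_{1\,\lambda_1}\cdots\widehat{a_{i\,\lambda_i}}\cdots a_{k\,\lambda_k}a_{k+1}\}_\gamma+\sum_{1\le i<j\le k}(-1)^{k+i+j+1}\{a_{1\,\lambda_1}\cdots\widehat{a_{i\,\lambda_i}}\cdots\widehat{a_{j\,\lambda_j}}\cdots a_{k\,\lambda_k}\,a_{k+1\,\lambda_{k+1}^\dagger}[a_{i\,\lambda_i}a_j]\}_\gamma$$ $$+(-1)^ka_{k+1\,\lambda_{k+1}^\dagger}\{a_{1\,\lambda_1}\cdots a_{k-1\,\lambda_{k-1}}a_k\}_\gamma+\sum_{i=1}^k(-1)^i\{a_{1\,\lambda_1}\cdots\widehat{a_{i\,\lambda_i}}\cdots a_{k\,\lambda_k}[a_{i\,\lambda_i}a_{k+1}]\}_\gamma.$$ For $n\ge1$: $$\{x_{1\,\lambda_1}\cdots x_{m+1\,\lambda_{m+1}}a_{1\,\mu_1}\cdots a_{n-1\,\mu_{n-1}}a_n\}_{\mathrm d^{m,n}_{\mathrm{CE}}\gamma}=\sum_{i=1}^{m+1}(-1)^{i+1}\Big(x_{i\,\lambda_i}\{x_{1\,\lambda_1}\cdots\widehat{x_{i\,\lambda_i}}\cdots x_{m+1\,\lambda_{m+1}}a_{1\,\mu_1}\cdots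 a_n\}_\gamma-\sum_{j=1}^n\{x_{1\,\lambda_1}\cdots\widehat{x_{i\,\lambda_i}}\cdots x_{m+1\,\lambda_{m+1}}a_{1\,\mu_1}\cdots([x_{i\,\lambda_i}a_j])_{\lambda_i+\mu_j}\cdots a_n\}_\gamma\Big)$$ $$+\sum_{1\le i<j\le m+1}(-1)^{i+j}\{([x_{i\,\lambda_i}x_j])_{\lambda_i+\lambda_j}x_{1\,\lambda_1}\cdots\widehat{x_{i\,\lambda_i}}\cdots\widehat{x_{j\,\lambda_j}}\cdots x_{m+1\,\lambda_{m+1}}a_{1\,\mu_1}\cdots a_n\}_\gamma$$ (for $j=n$ in the inner sum there is no subscript on the last slot). The operator $\mathrm d^{m,n}_{\mathrm H}:C^{m,n}(P,V)\to C^{m,n+1}(P,V)$, $n\ge1$: $$\{x_{1\,\lambda_1}\cdots x_{m\,\lambda_m}a_{1\,\mu_1}\cdots a_{n\,\mu_n}a_{n+1}\}_{\mathrm d^{m,n}_{\mathrm H}\gamma}=a_1\circ_{\mu_1}\{x_{1\,\lambda_1}\cdots x_{m\,\lambda_m}a_{2\,\mu_2}\cdots a_{n\,\mu_n}a_{n+1}\}_\gamma$$ $$+\sum_{i=1}^n(-1)^i\{x_{1\,\lambda_1}\cdots x_{m\,\lambda_m}a_{1\,\mu_1}\cdots(a_i\circ_{\mu_i}a_{i+1})_{\mu_i+\mu_{i+1}}\cdots a_{n+1}\}_\gamma+(-1)^{n+1}\{x_{1\,\lambda_1}\cdots x_{m\,\lambda_m}a_{1\,\mu_1}\cdots a_{n-1\,\mu_{n-1}}a_n\}_\gamma\circ_{\sum_{i=1}^m\lambda_i+\sum_{j=1}^n\mu_j}a_{n+1}$$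 (for $i=n$ the product stands in the last slot, without subscript). The complex. $C^k_{\mathrm{FGV}}(P,V)=\bigoplus_{m+n=k,\ n\ne1}C^{m,n}(P,V)$. The operator $\mathrm d_{\mathrm{FGV}}:C^k_{\mathrm{FGV}}(P,V)\to C^{k+1}_{\mathrm{FGV}}(P,V)$ is the linear map whose restriction to $C^{m,n}(P,V)$ is: $\mathrm d^{m,n}_{\mathrm{CE}}+(-1)^m\mathrm d^{m,n}_{\mathrm H}$ if $n\ge2$; $\mathrm d^{m,0}_{\mathrm{CE}}+(-1)^{m-1}\mathrm d^{m-1,1}_{\mathrm H}\circ\iota_m$ if $n=0$, $m\ge1$; and $\mathrm d_{\mathrm{CE}}$ if $m=n=0$. *)

theory Defs
  imports
    Complex_Main
    "HOL-Library.Poly_Mapping"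
    "HOL-Computational_Algebra.Polynomial"
    "HOL-Combinatorics.Permutations"
begin

text \<open>
  A \<open>\<complex>[\<partial>]\<close>-module is an abelian group with a scalar multiplication by \<^typ>\<open>complex poly\<close>
  satisfying the library locale \<^locale>\<open>module\<close>; \<open>\<partial>\<close> acts as the polynomial \<^term>\<open>[:0, 1:]\<close>
  and \<open>c \<in> \<complex>\<close> as the constant \<^term>\<open>[:c:]\<close>.

  Polynomials in one indeterminate with coefficients in a module, as \<open>a\<^sub>\<lambda> b \<in> A[\<lambda>]\<close>, are
  elements of the library type \<^typ>\<open>'a poly\<close>. Everything with several indeterminates
  lives in the one space \<open>A[\<lambda>\<^sub>0, \<lambda>\<^sub>1, \<dots>]\<close>, represented by
  \<open>(nat \<Rightarrow>\<^sub>0 nat) \<Rightarrow>\<^sub>0 'a\<close>; the indeterminates are numbered from \<open>0\<close>.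
\<close>

type_synonym 'a mpol = "(nat \<Rightarrow>\<^sub>0 nat) \<Rightarrow>\<^sub>0 'a"

type_synonym 'a cmod = "complex poly \<Rightarrow> 'a \<Rightarrow> 'a"

text \<open>The coefficient ring \<open>\<complex>[\<partial>][\<lambda>\<^sub>0, \<lambda>\<^sub>1, \<dots>]\<close>, in which the expressions that get
  substituted for an indeterminate (such as \<open>- \<lambda> - \<partial>\<close>) live.\<close>

type_synonym coef = "complex poly mpol"

definition var :: "nat \<Rightarrow> coef" where
  "var i = Poly_Mapping.single (Poly_Mapping.single i 1) 1"

definition dpar :: coef where
  "dpar = Poly_Mapping.single 0 [:0, 1:]"

definition cst :: "'a \<Rightarrow> ('a::zero) mpol" where
  "cst a = Poly_Mapping.single 0 a"

definition del :: "'a cmod \<Rightarrow> 'a \<Rightarrow> 'a" where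
  "del s a = s [:0, 1:] a"

text \<open>\<open>\<complex>[\<partial>][\<lambda>\<^sub>0, \<lambda>\<^sub>1, \<dots>]\<close> acting on \<open>A[\<lambda>\<^sub>0, \<lambda>\<^sub>1, \<dots>]\<close>, with \<open>\<partial>\<close> acting on the coefficients.\<close>

definition act :: "'a cmod \<Rightarrow> coef \<Rightarrow> ('a::ab_group_add) mpol \<Rightarrow> 'a mpol" where
  "act s p f = (\<Sum>\<alpha>\<in>Poly_Mapping.keys p. \<Sum>\<beta>\<in>Poly_Mapping.keys f.
     Poly_Mapping.single (\<alpha> + \<beta>) (s (Poly_Mapping.lookup p \<alpha>) (Poly_Mapping.lookup f \<beta>)))"

text \<open>Substitution for the indeterminate(s), the substituted expressions being moved to
  the left of the coefficients: \<open>eval1 s X (\<Sum>n. c\<^sub>n \<lambda>\<^sup>n) = \<Sum>n. X\<^sup>n c\<^sub>n\<close>, and likewise for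
  several indeterminates.\<close>

definition eval1 :: "'a cmod \<Rightarrow> coef \<Rightarrow> ('a::ab_group_add) poly \<Rightarrow> 'a mpol" where
  "eval1 s X f = (\<Sum>n\<le>degree f. act s (X ^ n) (cst (coeff f n)))"

definition subst :: "'a cmod \<Rightarrow> (nat \<Rightarrow> coef) \<Rightarrow> ('a::ab_group_add) mpol \<Rightarrow> 'a mpol" where
  "subst s X f = (\<Sum>\<alpha>\<in>Poly_Mapping.keys f.
     act s (\<Prod>i\<in>Poly_Mapping.keys \<alpha>. X i ^ Poly_Mapping.lookup \<alpha> i)
       (cst (Poly_Mapping.lookup f \<alpha>)))"

text \<open>The extension of a linear map \<open>g\<close> from \<open>A\<close> to a \<open>\<complex>[\<lambda>\<^sub>0, \<lambda>\<^sub>1, \<dots>]\<close>-linear map from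
  \<open>A[\<lambda>\<^sub>0, \<lambda>\<^sub>1, \<dots>]\<close>; it gives a meaning to products and brackets of polynomials, such as
  \<open>a\<^sub>\<lambda> (b\<^sub>\<mu> c)\<close>.\<close>

definition lift :: "'b cmod \<Rightarrow> ('a \<Rightarrow> 'b mpol) \<Rightarrow> ('a::zero) mpol \<Rightarrow> ('b::ab_group_add) mpol" where
  "lift s g f = (\<Sum>\<beta>\<in>Poly_Mapping.keys f.
     act s (Poly_Mapping.single \<beta> 1) (g (Poly_Mapping.lookup f \<beta>)))"

text \<open>\<open>prd s op X f g\<close> is \<open>f op\<^sub>X g\<close>, where \<open>s\<close> is the module structure on the values of \<open>op\<close>.
  A \<open>\<partial>\<close> occurring in \<open>X\<close> acts on the value of \<open>op\<close>.\<close>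

definition prd :: "'c cmod \<Rightarrow> ('a \<Rightarrow> 'b \<Rightarrow> 'c poly) \<Rightarrow> coef \<Rightarrow>
    ('a::zero) mpol \<Rightarrow> ('b::zero) mpol \<Rightarrow> ('c::ab_group_add) mpol" where
  "prd s op X f g = lift s (\<lambda>a. lift s (\<lambda>b. eval1 s X (op a b)) g) f"


section \<open>Noncommutative Poisson conformal algebras and their modules\<close>

text \<open>Bilinear maps \<open>A \<times> B \<rightarrow> C[\<lambda>]\<close> obeying the conformal rule. On \<^typ>\<open>'c poly\<close>,
  \<^term>\<open>pCons 0\<close> is multiplication by \<open>\<lambda>\<close>.\<close>

definition conformal_op :: "'a cmod \<Rightarrow> 'b cmod \<Rightarrow> 'c cmod \<Rightarrow>
    (('a::ab_group_add) \<Rightarrow> ('b::ab_group_add) \<Rightarrow> ('c::ab_group_add) poly) \<Rightarrow> bool" where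
  "conformal_op sA sB sC op \<longleftrightarrow>
     (\<forall>a a' b. op (a + a') b = op a b + op a' b) \<and>
     (\<forall>a b b'. op a (b + b') = op a b + op a b') \<and>
     (\<forall>c a b. op (sA [:c:] a) b = map_poly (sC [:c:]) (op a b)) \<and>
     (\<forall>c a b. op a (sB [:c:] b) = map_poly (sC [:c:]) (op a b)) \<and>
     (\<forall>a b. op (del sA a) b = - pCons 0 (op a b)) \<and>
     (\<forall>a b. op a (del sB b) = map_poly (del sC) (op a b) + pCons 0 (op a b))"

text \<open>Structure maps of an algebra \<open>P\<close> (\<open>a \<circ>\<^sub>\<lambda> b\<close> and \<open>[a\<^sub>\<lambda> b]\<close>) and of a \<open>P\<close>-module \<open>V\<close>
  (\<open>a \<circ>\<^sub>\<lambda> v\<close>, \<open>v \<circ>\<^sub>\<lambda> a\<close> and \<open>a\<^sub>\<lambda> v\<close>).\<close>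

record (overloaded) 'p npca =
  sclP :: "'p cmod"
  circ :: "'p \<Rightarrow> 'p \<Rightarrow> 'p poly"
  brak :: "'p \<Rightarrow> 'p \<Rightarrow> 'p poly"

record (overloaded) ('p, 'v) npca_mod =
  sclV :: "'v cmod"
  lcirc :: "'p \<Rightarrow> 'v \<Rightarrow> 'v poly"
  rcirc :: "'v \<Rightarrow> 'p \<Rightarrow> 'v poly"
  lact :: "'p \<Rightarrow> 'v \<Rightarrow> 'v poly"

abbreviation circP :: "('p::ab_group_add) npca \<Rightarrow> coef \<Rightarrow> 'p mpol \<Rightarrow> 'p mpol \<Rightarrow> 'p mpol" where
  "circP P \<equiv> prd (sclP P) (circ P)"

abbreviation brakP :: "('p::ab_group_add) npca \<Rightarrow> coef \<Rightarrow> 'p mpol \<Rightarrow> 'p mpol \<Rightarrow> 'p mpol" where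
  "brakP P \<equiv> prd (sclP P) (brak P)"

abbreviation lcircV :: "('p::zero, 'v::ab_group_add) npca_mod \<Rightarrow> coef \<Rightarrow> 'p mpol \<Rightarrow> 'v mpol \<Rightarrow> 'v mpol" where
  "lcircV V \<equiv> prd (sclV V) (lcirc V)"

abbreviation rcircV :: "('p::zero, 'v::ab_group_add) npca_mod \<Rightarrow> coef \<Rightarrow> 'v mpol \<Rightarrow> 'p mpol \<Rightarrow> 'v mpol" where
  "rcircV V \<equiv> prd (sclV V) (rcirc V)"

abbreviation lactV :: "('p::zero, 'v::ab_group_add) npca_mod \<Rightarrow> coef \<Rightarrow> 'p mpol \<Rightarrow> 'v mpol \<Rightarrow> 'v mpol" where
  "lactV V \<equiv> prd (sclV V) (lact V)"

text \<open>In the axioms, \<open>\<lambda> = var 0\<close> and \<open>\<mu> = var 1\<close>.\<close>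

locale npc_algebra =
  fixes P :: "('p::ab_group_add) npca"
  assumes module: "module (sclP P)"
    and conformal_circ: "conformal_op (sclP P) (sclP P) (sclP P) (circ P)"
    and conformal_brak: "conformal_op (sclP P) (sclP P) (sclP P) (brak P)"
    and assoc: "circP P (var 0) (cst a) (circP P (var 1) (cst b) (cst c))
      = circP P (var 0 + var 1) (circP P (var 0) (cst a) (cst b)) (cst c)"
    and skew: "brakP P (var 0) (cst a) (cst b) = - brakP P (- var 0 - dpar) (cst b) (cst a)"
    and jacobi: "brakP P (var 0) (cst a) (brakP P (var 1) (cst b) (cst c))
      = brakP P (var 0 + var 1) (brakP P (var 0) (cst a) (cst b)) (cst c)
        + brakP P (var 1) (cst b) (brakP P (var 0) (cst a) (cst c))"
    and leibniz: "brakP P (var 0) (cst a) (circP P (var 1) (cst b) (cst c))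
      = circP P (var 0 + var 1) (brakP P (var 0) (cst a) (cst b)) (cst c)
        + circP P (var 1) (cst b) (brakP P (var 0) (cst a) (cst c))"

locale npc_module = npc_algebra P
  for P :: "('p::ab_group_add) npca" +
  fixes V :: "('p, 'v::ab_group_add) npca_mod"
  assumes moduleV: "module (sclV V)"
    and conformal_lcirc: "conformal_op (sclP P) (sclV V) (sclV V) (lcirc V)"
    and conformal_rcirc: "conformal_op (sclV V) (sclP P) (sclV V) (rcirc V)"
    and conformal_lact: "conformal_op (sclP P) (sclV V) (sclV V) (lact V)"
    and assoc_left: "lcircV V (var 0 + var 1) (circP P (var 0) (cst a) (cst b)) (cst v)
      = lcircV V (var 0) (cst a) (lcircV V (var 1) (cst b) (cst v))"
    and assoc_right: "rcircV V (var 0 + var 1) (rcircV V (var 0) (cst v) (cst b)) (cst a)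
      = rcircV V (var 0) (cst v) (circP P (var 1) (cst b) (cst a))"
    and assoc_mid: "rcircV V (var 0 + var 1) (lcircV V (var 0) (cst a) (cst v)) (cst b)
      = lcircV V (var 0) (cst a) (rcircV V (var 1) (cst v) (cst b))"
    and lie_module: "lactV V (var 0 + var 1) (brakP P (var 0) (cst a) (cst b)) (cst v)
      = lactV V (var 0) (cst a) (lactV V (var 1) (cst b) (cst v))
        - lactV V (var 1) (cst b) (lactV V (var 0) (cst a) (cst v))"
    and leibniz_left: "lcircV V (var 0 + var 1) (brakP P (var 0) (cst a) (cst b)) (cst v)
      = lactV V (var 0) (cst a) (lcircV V (var 1) (cst b) (cst v))
        - lcircV V (var 1) (cst b) (lactV V (var 0) (cst a) (cst v))"
    and leibniz_right: "rcircV V (var 1) (cst v) (brakP P (var 0) (cst a) (cst b))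
      = lactV V (var 0) (cst a) (rcircV V (var 1) (cst v) (cst b))
        - rcircV V (var 0 + var 1) (lactV V (var 0) (cst a) (cst v)) (cst b)"
    and leibniz_circ: "lactV V (- var 1 - dpar) (circP P (var 0) (cst a) (cst b)) (cst v)
      = lcircV V (var 0) (cst a) (lactV V (- var 1 - dpar) (cst b) (cst v))
        + rcircV V (var 0 + var 1) (lactV V (- var 1 - dpar) (cst a) (cst v)) (cst b)"


section \<open>Cochains\<close>

text \<open>A bracket with \<open>k\<close> arguments is a function on lists of length \<open>k\<close>, extended by \<open>0\<close> to
  all other lists. Arguments are numbered from \<open>0\<close>, and argument \<open>i < k - 1\<close> carries \<open>var i\<close>.\<close>

definition lambda_brackets :: "('p::ab_group_add) npca \<Rightarrow> ('p, 'v::ab_group_add) npca_mod \<Rightarrow>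
    nat \<Rightarrow> ('p list \<Rightarrow> 'v mpol) set" where
  "lambda_brackets P V k = {\<gamma>.
     (\<forall>as. length as \<noteq> k \<longrightarrow> \<gamma> as = 0) \<and>
     (\<forall>as. length as = k \<longrightarrow>
        (\<forall>\<alpha>\<in>Poly_Mapping.keys (\<gamma> as). Poly_Mapping.keys \<alpha> \<subseteq> {..<k - 1}) \<and>
        (\<forall>i<k. \<forall>a b. \<gamma> (as[i := a + b]) = \<gamma> (as[i := a]) + \<gamma> (as[i := b])) \<and>
        (\<forall>i<k. \<forall>c. \<gamma> (as[i := sclP P [:c:] (as ! i)]) = act (sclV V) (cst [:c:]) (\<gamma> as)) \<and>
        (\<forall>i<k - 1. \<gamma> (as[i := del (sclP P) (as ! i)]) = act (sclV V) (- var i) (\<gamma> as)) \<and>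
        \<gamma> (as[k - 1 := del (sclP P) (as ! (k - 1))])
          = act (sclV V) ((\<Sum>i<k - 1. var i) + dpar) (\<gamma> as))}"

text \<open>
  \<open>brk V \<gamma> [(f\<^sub>1, X\<^sub>1), \<dots>, (f\<^sub>k, X\<^sub>k)]\<close> is \<open>{f\<^sub>1 \<^sub>X\<^sub>1 \<dots> f\<^sub>k\<^sub>-\<^sub>1 \<^sub>X\<^sub>k\<^sub>-\<^sub>1 f\<^sub>k}\<^sub>\<gamma>\<close>. The last argument of a bracket has
  no subscript, and \<open>X\<^sub>k\<close> is ignored: values of a bracket do not involve \<open>var (k - 1)\<close>.
  This allows all slots to be treated alike below.
\<close>

fun multilift :: "'v cmod \<Rightarrow> ('p::zero) mpol list \<Rightarrow> ('p list \<Rightarrow> 'v mpol) \<Rightarrow> ('v::ab_group_add) mpol" where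
  "multilift s [] g = g []"
| "multilift s (f # fs) g = lift s (\<lambda>a. multilift s fs (\<lambda>as. g (a # as))) f"

definition brk :: "('p::zero, 'v::ab_group_add) npca_mod \<Rightarrow> ('p list \<Rightarrow> 'v mpol) \<Rightarrow>
    ('p mpol \<times> coef) list \<Rightarrow> 'v mpol" where
  "brk V \<gamma> ps = multilift (sclV V) (map fst ps) (\<lambda>as. subst (sclV V) (\<lambda>i. snd (ps ! i)) (\<gamma> as))"

definition slots :: "('p::zero) list \<Rightarrow> ('p mpol \<times> coef) list" where
  "slots as = map (\<lambda>i. (cst (as ! i), var i)) [0..<length as]"

text \<open>\<open>\<lambda>\<^sub>k\<^sup>\<dagger>\<close> for the argument number \<open>k\<close> (counted from \<open>0\<close>).\<close>

definition dagger :: "nat \<Rightarrow> coef" where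
  "dagger k = - (\<Sum>j<k. var j) - dpar"

text \<open>\<open>C\<^sup>m\<^sup>,\<^sup>n(P, V)\<close> for \<open>(m, n) \<noteq> (0, 0)\<close>. For \<open>n \<ge> 1\<close> the arguments are
  \<open>x\<^sub>1, \<dots>, x\<^sub>m, a\<^sub>1, \<dots>, a\<^sub>n\<close>, with \<open>\<lambda>\<^sub>i = var (i - 1)\<close> and \<open>\<mu>\<^sub>j = var (m + j - 1)\<close>.\<close>

definition Cmn :: "('p::ab_group_add) npca \<Rightarrow> ('p, 'v::ab_group_add) npca_mod \<Rightarrow>
    nat \<Rightarrow> nat \<Rightarrow> ('p list \<Rightarrow> 'v mpol) set" where
  "Cmn P V m n = {\<gamma> \<in> lambda_brackets P V (m + n).
     if n = 0
     then (\<forall>xs \<sigma>. length xs = m \<longrightarrow> \<sigma> permutes {..<m} \<longrightarrow>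
       \<gamma> xs = act (sclV V) (of_int (sign \<sigma>)) (brk V \<gamma>
         (map (\<lambda>i. (cst (xs ! \<sigma> i), if \<sigma> i = m - 1 then dagger (m - 1) else var (\<sigma> i))) [0..<m])))
     else (\<forall>xs \<sigma>. length xs = m + n \<longrightarrow> \<sigma> permutes {..<m} \<longrightarrow>
       brk V \<gamma> (map (\<lambda>i. (cst (xs ! \<sigma> i), var (\<sigma> i))) [0..<m + n])
         = act (sclV V) (of_int (sign \<sigma>)) (\<gamma> xs))}"

text \<open>\<open>C\<^sup>0\<^sup>,\<^sup>0(P, V) = V / \<partial>V\<close>, as a set of cosets.\<close>

definition C00 :: "('p, 'v::ab_group_add) npca_mod \<Rightarrow> 'v set set" where
  "C00 V = UNIV // {(v, w). w - v \<in> range (del (sclV V))}"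


section \<open>Differentials\<close>

text \<open>On \<open>V / \<partial>V\<close>, \<open>a\<^sub>-\<^sub>\<partial> v\<close> does not depend on the representative \<open>v\<close>, because
  \<open>a\<^sub>\<lambda> (\<partial> v)\<close> is a multiple of \<open>\<partial> + \<lambda>\<close>; the image below is then a singleton.\<close>

definition d_CE00 :: "('p::ab_group_add, 'v::ab_group_add) npca_mod \<Rightarrow> 'v set \<Rightarrow> 'p list \<Rightarrow> 'v mpol" where
  "d_CE00 V X = (\<lambda>as. if length as = 1
     then the_elem ((\<lambda>v. lactV V (- dpar) (cst (as ! 0)) (cst v)) ` X) else 0)"

text \<open>\<open>d\<^sub>C\<^sub>E\<close> on \<open>C\<^sup>k\<^sup>,\<^sup>0\<close>, \<open>k \<ge> 1\<close>. Since arguments are numbered from \<open>0\<close>, the sign exponents differ from the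
  one-based ones by \<open>1\<close> for every index occurring in them; \<open>as ! k\<close> is the argument \<open>a\<^sub>k\<^sub>+\<^sub>1\<close>.
  The component \<open>0\<close> in the last slots is the irrelevant \<open>X\<close> of the definition of \<^const>\<open>brk\<close>.\<close>

definition d_CE0 :: "('p::ab_group_add) npca \<Rightarrow> ('p, 'v::ab_group_add) npca_mod \<Rightarrow>
    nat \<Rightarrow> ('p list \<Rightarrow> 'v mpol) \<Rightarrow> 'p list \<Rightarrow> 'v mpol" where
  "d_CE0 P V k \<gamma> = (\<lambda>as. if length as = k + 1 then
      (\<Sum>i<k. act (sclV V) ((- 1) ^ i)
         (lactV V (var i) (cst (as ! i)) (brk V \<gamma> (nths (slots as) (- {i})))))
    + (\<Sum>j<k. \<Sum>i<j. act (sclV V) ((- 1) ^ (k + i + j + 1))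
         (brk V \<gamma> (nths (take k (slots as)) (- {i, j})
            @ [(cst (as ! k), dagger k), (brakP P (var i) (cst (as ! i)) (cst (as ! j)), 0)])))
    + act (sclV V) ((- 1) ^ k)
         (lactV V (dagger k) (cst (as ! k)) (brk V \<gamma> (take k (slots as))))
    + (\<Sum>i<k. act (sclV V) ((- 1) ^ (i + 1))
         (brk V \<gamma> (nths (take k (slots as)) (- {i})
            @ [(brakP P (var i) (cst (as ! i)) (cst (as ! k)), 0)])))
    else 0)"

text \<open>\<open>d\<^sub>C\<^sub>E\<close> on \<open>C\<^sup>m\<^sup>,\<^sup>n\<close>, \<open>n \<ge> 1\<close>. The arguments are \<open>x\<^sub>1, \<dots>, x\<^sub>m\<^sub>+\<^sub>1, a\<^sub>1, \<dots>, a\<^sub>n\<close>, so that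
  \<open>a\<^sub>j\<close> is the argument number \<open>m + j\<close>.\<close>

definition d_CE :: "('p::ab_group_add) npca \<Rightarrow> ('p, 'v::ab_group_add) npca_mod \<Rightarrow>
    nat \<Rightarrow> nat \<Rightarrow> ('p list \<Rightarrow> 'v mpol) \<Rightarrow> 'p list \<Rightarrow> 'v mpol" where
  "d_CE P V m n \<gamma> = (\<lambda>as. if length as = m + 1 + n then
      (\<Sum>i<m + 1. act (sclV V) ((- 1) ^ i)
         (lactV V (var i) (cst (as ! i)) (brk V \<gamma> (nths (slots as) (- {i})))
          - (\<Sum>j\<in>{m + 1..m + n}. brk V \<gamma> (nths
               ((slots as)[j := (brakP P (var i) (cst (as ! i)) (cst (as ! j)), var i + var j)])
               (- {i})))))
    + (\<Sum>j<m + 1. \<Sum>i<j. act (sclV V) ((- 1) ^ (i + j))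
         (brk V \<gamma> ((brakP P (var i) (cst (as ! i)) (cst (as ! j)), var i + var j)
            # nths (slots as) (- {i, j}))))
    else 0)"

text \<open>\<open>d\<^sub>H\<close> on \<open>C\<^sup>m\<^sup>,\<^sup>n\<close>, \<open>n \<ge> 1\<close>. The arguments are \<open>x\<^sub>1, \<dots>, x\<^sub>m, a\<^sub>1, \<dots>, a\<^sub>n\<^sub>+\<^sub>1\<close>, so that
  \<open>a\<^sub>i\<close> is the argument number \<open>m + i - 1\<close>.\<close>

definition d_H :: "('p::ab_group_add) npca \<Rightarrow> ('p, 'v::ab_group_add) npca_mod \<Rightarrow>
    nat \<Rightarrow> nat \<Rightarrow> ('p list \<Rightarrow> 'v mpol) \<Rightarrow> 'p list \<Rightarrow> 'v mpol" where
  "d_H P V m n \<gamma> = (\<lambda>as. if length as = m + n + 1 then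
      lcircV V (var m) (cst (as ! m)) (brk V \<gamma> (nths (slots as) (- {m})))
    + (\<Sum>i\<in>{1..n}. act (sclV V) ((- 1) ^ i)
         (brk V \<gamma> (take (m + i - 1) (slots as)
            @ [(circP P (var (m + i - 1)) (cst (as ! (m + i - 1))) (cst (as ! (m + i))),
                var (m + i - 1) + var (m + i))]
            @ drop (m + i + 1) (slots as))))
    + act (sclV V) ((- 1) ^ (n + 1))
         (rcircV V (\<Sum>i<m + n. var i) (brk V \<gamma> (take (m + n) (slots as))) (cst (as ! (m + n))))
    else 0)"

text \<open>The inclusion \<open>\<iota>\<^sub>m : C\<^sup>m\<^sup>,\<^sup>0 \<hookrightarrow> C\<^sup>m\<^sup>-\<^sup>1\<^sup>,\<^sup>1\<close> does not change the underlying bracket.\<close>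

definition iota :: "('p list \<Rightarrow> 'v mpol) \<Rightarrow> 'p list \<Rightarrow> ('v::zero) mpol" where
  "iota \<gamma> = \<gamma>"


section \<open>The complex\<close>

text \<open>\<open>Coset X\<close> is an element of \<open>C\<^sup>0 = C\<^sup>0\<^sup>,\<^sup>0\<close>; \<open>Family F\<close> is the element of \<open>C\<^sup>k\<close>, \<open>k \<ge> 1\<close>,
  whose component in \<open>C\<^sup>k\<^sup>-\<^sup>n\<^sup>,\<^sup>n\<close> is \<open>F n\<close>.\<close>

declare [[typedef_overloaded]]

datatype ('p, 'v) fgv = Coset "'v set" | Family "nat \<Rightarrow> 'p list \<Rightarrow> (nat \<Rightarrow>\<^sub>0 nat) \<Rightarrow>\<^sub>0 'v"

definition C_FGV :: "('p::ab_group_add) npca \<Rightarrow> ('p, 'v::ab_group_add) npca_mod \<Rightarrow>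
    nat \<Rightarrow> ('p, 'v) fgv set" where
  "C_FGV P V k = (if k = 0 then Coset ` C00 V
     else Family ` {F. \<forall>n. if n \<le> k \<and> n \<noteq> 1 then F n \<in> Cmn P V (k - n) n else F n = (\<lambda>_. 0)})"

fun add_FGV :: "('p, 'v::ab_group_add) fgv \<Rightarrow> ('p, 'v) fgv \<Rightarrow> ('p, 'v) fgv" where
  "add_FGV (Coset X) (Coset Y) = Coset {x + y | x y. x \<in> X \<and> y \<in> Y}"
| "add_FGV (Family F) (Family G) = Family (\<lambda>n as. F n as + G n as)"

fun scale_FGV :: "('p, 'v::ab_group_add) npca_mod \<Rightarrow> complex \<Rightarrow> ('p, 'v) fgv \<Rightarrow> ('p, 'v) fgv" where
  "scale_FGV V c (Coset X) = Coset {sclV V [:c:] x + del (sclV V) w | x w. x \<in> X}"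
| "scale_FGV V c (Family F) = Family (\<lambda>n as. act (sclV V) (cst [:c:]) (F n as))"

text \<open>The restriction of \<open>d\<^sub>F\<^sub>G\<^sub>V\<close> to \<open>C\<^sup>m\<^sup>,\<^sup>n\<close>, \<open>(m, n) \<noteq> (0, 0)\<close>; the last index \<open>l\<close> selects the component
  in \<open>C\<^sup>m\<^sup>+\<^sup>n\<^sup>+\<^sup>1\<^sup>-\<^sup>l\<^sup>,\<^sup>l\<close>.\<close>

definition d_comp :: "('p::ab_group_add) npca \<Rightarrow> ('p, 'v::ab_group_add) npca_mod \<Rightarrow>
    nat \<Rightarrow> nat \<Rightarrow> ('p list \<Rightarrow> 'v mpol) \<Rightarrow> nat \<Rightarrow> 'p list \<Rightarrow> 'v mpol" where
  "d_comp P V m n \<gamma> l as =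
    (if n = 0 then
       (if l = 0 then d_CE0 P V m \<gamma> as
        else if l = 2 then act (sclV V) ((- 1) ^ (m - 1)) (d_H P V (m - 1) 1 (iota \<gamma>) as)
        else 0)
     else
       (if l = n then d_CE P V m n \<gamma> as
        else if l = n + 1 then act (sclV V) ((- 1) ^ m) (d_H P V m n \<gamma> as)
        else 0))"

fun d_FGV :: "('p::ab_group_add) npca \<Rightarrow> ('p, 'v::ab_group_add) npca_mod \<Rightarrow>
    nat \<Rightarrow> ('p, 'v) fgv \<Rightarrow> ('p, 'v) fgv" where
  "d_FGV P V k (Coset X) = Family (\<lambda>l. if l = 0 then d_CE00 V X else (\<lambda>_. 0))"
| "d_FGV P V k (Family F) = Family (\<lambda>l as. \<Sum>n\<in>{0..k} - {1}. d_comp P V (k - n) n (F n) l as)"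

end

theory Submission
  imports Defs "HOL-Library.Multiset"
begin

text \<open>
  The proof translates \<open>\<lambda>\<close>-brackets into ordinary algebra by giving every argument a \<^emph>\<open>momentum\<close>.
  An element of \<open>P\<close> with momentum \<open>p\<close>, a sum of indeterminates, is regarded modulo \<open>\<partial> + p\<close>.
  Then \<open>[a\<^sub>p b]\<close> and \<open>a \<circ>\<^sub>p b\<close> are elements of momentum \<open>p + q\<close> when \<open>b\<close> has momentum \<open>q\<close>, and all axioms
  lose their subscripts: skew-symmetry \<open>[a\<^sub>\<lambda> b] = -[b\<^sub>-\<^sub>\<lambda>\<^sub>-\<^sub>\<partial> a]\<close> becomes \<open>[a, b] = -[b, a]\<close>, because
  \<open>-p - \<partial>\<close> and \<open>q\<close> agree modulo \<open>\<partial> + p + q\<close>, and the axiom for \<open>(a \<circ>\<^sub>\<lambda> b)\<^sub>-\<^sub>\<mu>\<^sub>-\<^sub>\<partial> v\<close> becomes the Leibniz rule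
  \<open>(ab)\<cdot>v = a(b\<cdot>v) + (a\<cdot>v)b\<close>. The locale \<open>momentum_poisson\<close> records a graded Poisson algebra with a module
  in this sense; a cochain is a function on lists of elements with momenta, and the substitution
  \<open>\<lambda>\<^sub>k\<^sup>\<dagger> = -\<lambda>\<^sub>1 - \<dots> - \<lambda>\<^sub>k\<^sub>-\<^sub>1 - \<partial>\<close> disappears, since the last momentum equals \<open>\<lambda>\<^sub>k\<^sup>\<dagger>\<close> modulo \<open>\<partial>\<close> plus the total momentum.

  In this language \<open>d\<^sub>C\<^sub>E\<close> has the same form for \<open>n = 0\<close> and for \<open>n \<ge> 1\<close>: skew-symmetry of the cochain lets one
  put each bracket \<open>[x\<^sub>i, y]\<close> into the place of its right argument \<open>y\<close>, so that
  \<open>(dG)(x, \<dots>) = (L\<^sub>x G)(\<dots>) - d(G(x, \<dots>))(\<dots>)\<close> with the Lie derivative \<open>L\<^sub>x\<close>. This is Cartan's formula, and the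
  relations follow from it by induction on the number of arguments:
  \<open>[L\<^sub>x, L\<^sub>y] = L\<^bsub>[x,y]\<^esub>\<close> gives \<open>L\<^sub>x d = d L\<^sub>x\<close>, hence \<open>d\<^sup>2 = 0\<close> (\<open>CE_CE\<close>), and since \<open>L\<^sub>x\<close> is a derivation of all
  products it commutes with the Hochschild differential, hence so does \<open>d\<^sub>C\<^sub>E\<close> (\<open>CE_Hoch\<close>). That
  \<open>d\<^sub>H\<close> squares to zero is the usual consequence of associativity (\<open>Hoch_Hoch\<close>).

  The one relation specific to the total complex concerns the passage from \<open>n = 0\<close> to \<open>n = 2\<close>. On \<open>C\<^sup>k\<^sup>,\<^sup>0\<close> the
  operator \<open>d\<^sub>C\<^sub>E\<close> has one summand more than on \<open>C\<^sup>k\<^sup>-\<^sup>1\<^sup>,\<^sup>1\<close>, namely \<open>\<plusminus>a\<^sub>k\<^sub>+\<^sub>1 \<cdot> G(a\<^sub>1, \<dots>, a\<^sub>k)\<close>. As a function of \<open>a\<^sub>k\<^sub>+\<^sub>1\<close> this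
  is a derivation by the Leibniz rule above, so \<open>d\<^sub>H\<close> kills it (\<open>Hoch_CE_last\<close>).

  To return to \<open>\<lambda>\<close>-brackets, \<open>represents m n \<gamma> F\<close> states that the bracket \<open>\<gamma>\<close> and the function \<open>F\<close> on
  elements with momenta are the same cochain. Such a \<open>\<gamma>\<close> is determined by \<open>F\<close> (\<open>represents_unique\<close>), because the values
  of \<open>\<gamma>\<close> do not involve the last indeterminate, and every \<open>F\<close> that is multilinear, compatible with \<open>\<partial>\<close>, natural
  under substitutions and alternating arises from a bracket in \<open>C\<^sup>m\<^sup>,\<^sup>n\<close> (\<open>represents_intro\<close>). The differentials preserve these
  properties, which also gives \<open>d : C\<^sup>k \<rightarrow> C\<^sup>k\<^sup>+\<^sup>1\<close>.
\<close>

section \<open>Graded Poisson algebras with momenta\<close>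

text \<open>
  \<open>'a\<close> and \<open>'w\<close> hold the elements of the algebra and of the module, \<open>'m\<close> the momenta. An element carries no
  momentum by itself; the momentum of the left factor is a parameter of each product. Equality at momentum \<open>p\<close> is
  equality modulo the subgroup \<open>ZA p\<close> or \<open>ZW p\<close>. Most axioms hold on the nose; only \<open>br_skew\<close> and \<open>la_mu\<close>, whose
  conformal versions involve \<open>\<partial>\<close> in a subscript, hold modulo these subgroups. Left factors from \<open>ZA p\<close> are
  killed, because \<open>(\<partial> a)\<^sub>p b = -p (a\<^sub>p b)\<close>.
\<close>

locale momentum_poisson =
  fixes br mu :: "'m::comm_monoid_add \<Rightarrow> 'a::ab_group_add \<Rightarrow> 'a \<Rightarrow> 'a"
    and la lc :: "'m \<Rightarrow> 'a \<Rightarrow> 'w::ab_group_add \<Rightarrow> 'w"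
    and rc :: "'m \<Rightarrow> 'w \<Rightarrow> 'a \<Rightarrow> 'w"
    and ZA :: "'m \<Rightarrow> 'a set" and ZW :: "'m \<Rightarrow> 'w set"
  assumes br_add1: "br p (a + a') b = br p a b + br p a' b"
    and br_add2: "br p a (b + b') = br p a b + br p a b'"
    and mu_add1: "mu p (a + a') b = mu p a b + mu p a' b"
    and mu_add2: "mu p a (b + b') = mu p a b + mu p a b'"
    and la_add1: "la p (a + a') v = la p a v + la p a' v"
    and la_add2: "la p a (v + v') = la p a v + la p a v'"
    and lc_add1: "lc p (a + a') v = lc p a v + lc p a' v"
    and lc_add2: "lc p a (v + v') = lc p a v + lc p a v'"
    and rc_add1: "rc p (v + v') a = rc p v a + rc p v' a"
    and rc_add2: "rc p v (a + a') = rc p v a + rc p v a'"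
    and mu_assoc: "mu p a (mu q b c) = mu (p + q) (mu p a b) c"
    and br_jacobi: "br p a (br q b c) = br (p + q) (br p a b) c + br q b (br p a c)"
    and br_leibniz: "br p a (mu q b c) = mu (p + q) (br p a b) c + mu q b (br p a c)"
    and lc_mu: "lc (p + q) (mu p a b) v = lc p a (lc q b v)"
    and rc_mu: "rc (q + p) (rc q v b) a = rc q v (mu p b a)"
    and rc_lc: "rc (p + q) (lc p a v) b = lc p a (rc q v b)"
    and la_br: "la (p + q) (br p a b) v = la p a (la q b v) - la q b (la p a v)"
    and lc_br: "lc (p + q) (br p a b) v = la p a (lc q b v) - lc q b (la p a v)"
    and rc_br: "rc q v (br p a b) = la p a (rc q v b) - rc (p + q) (la p a v) b"
    and ZA_0: "0 \<in> ZA p" and ZA_diff: "a \<in> ZA p \<Longrightarrow> b \<in> ZA p \<Longrightarrow> a - b \<in> ZA p"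
    and ZW_0: "0 \<in> ZW p" and ZW_diff: "v \<in> ZW p \<Longrightarrow> w \<in> ZW p \<Longrightarrow> v - w \<in> ZW p"
    and br_skew: "br p a b + br q b a \<in> ZA (p + q)"
    and la_mu: "la (p + q) (mu p a b) v - (lc p a (la q b v) + rc (p + r) (la p a v) b) \<in> ZW (p + q + r)"
    and br_Z1: "a \<in> ZA p \<Longrightarrow> br p a b = 0" and br_Z2: "b \<in> ZA q \<Longrightarrow> br p a b \<in> ZA (p + q)"
    and mu_Z1: "a \<in> ZA p \<Longrightarrow> mu p a b = 0" and mu_Z2: "b \<in> ZA q \<Longrightarrow> mu p a b \<in> ZA (p + q)"
    and la_Z1: "a \<in> ZA p \<Longrightarrow> la p a v = 0" and la_Z2: "v \<in> ZW q \<Longrightarrow> la p a v \<in> ZW (p + q)"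
    and lc_Z1: "a \<in> ZA p \<Longrightarrow> lc p a v = 0" and lc_Z2: "v \<in> ZW q \<Longrightarrow> lc p a v \<in> ZW (p + q)"
    and rc_Z1: "v \<in> ZW q \<Longrightarrow> rc q v a = 0" and rc_Z2: "a \<in> ZA p \<Longrightarrow> rc q v a \<in> ZW (q + p)"
begin

lemma la_0 [simp]: "la p a 0 = 0" using la_add2[of p a 0 0] by simp
lemma lc_0 [simp]: "lc p a 0 = 0" using lc_add2[of p a 0 0] by simp
lemma rc_0 [simp]: "rc p 0 a = 0" using rc_add1[of p 0 0 a] by simp
lemma la_minus: "la p a (- v) = - la p a v" using la_add2[of p a v "- v"] by (simp add: eq_neg_iff_add_eq_0 add.commute)
lemma lc_minus: "lc p a (- v) = - lc p a v" using lc_add2[of p a v "- v"] by (simp add: eq_neg_iff_add_eq_0 add.commute)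
lemma rc_minus: "rc p (- v) a = - rc p v a" using rc_add1[of p v "- v" a] by (simp add: eq_neg_iff_add_eq_0 add.commute)
lemma la_diff: "la p a (v - w) = la p a v - la p a w" using la_add2[of p a v "- w"] by (simp add: la_minus)
lemma lc_diff: "lc p a (v - w) = lc p a v - lc p a w" using lc_add2[of p a v "- w"] by (simp add: lc_minus)
lemma rc_diff: "rc p (v - w) a = rc p v a - rc p w a" using rc_add1[of p v "- w" a] by (simp add: rc_minus)
lemma ZW_minus: "v \<in> ZW p \<Longrightarrow> - v \<in> ZW p" using ZW_diff[OF ZW_0, of v p] by simp
lemma ZW_add: "v \<in> ZW p \<Longrightarrow> w \<in> ZW p \<Longrightarrow> v + w \<in> ZW p" using ZW_diff[of v p "- w"] ZW_minus by simp

text \<open>A pair consists of an element and its momentum.\<close>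
definition bra :: "'a \<times> 'm \<Rightarrow> 'a \<times> 'm \<Rightarrow> 'a \<times> 'm" where
  "bra x y = (br (snd x) (fst x) (fst y), snd x + snd y)"
definition mul :: "'a \<times> 'm \<Rightarrow> 'a \<times> 'm \<Rightarrow> 'a \<times> 'm" where
  "mul x y = (mu (snd x) (fst x) (fst y), snd x + snd y)"
abbreviation sact :: "'a \<times> 'm \<Rightarrow> 'w \<Rightarrow> 'w" where "sact x \<equiv> la (snd x) (fst x)"
abbreviation slmul :: "'a \<times> 'm \<Rightarrow> 'w \<Rightarrow> 'w" where "slmul x \<equiv> lc (snd x) (fst x)"
abbreviation srmul :: "'m \<Rightarrow> 'w \<Rightarrow> 'a \<times> 'm \<Rightarrow> 'w" where "srmul q v x \<equiv> rc q v (fst x)"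
definition tot :: "('a \<times> 'm) list \<Rightarrow> 'm" where "tot ss = sum_list (map snd ss)"

lemma tot_simps [simp]: "tot [] = 0" "tot (x # ss) = snd x + tot ss" "tot (us @ ss) = tot us + tot ss"
  by (simp_all add: tot_def)
lemma snd_bra [simp]: "snd (bra x y) = snd x + snd y" by (simp add: bra_def)
lemma snd_mul [simp]: "snd (mul x y) = snd x + snd y" by (simp add: mul_def)

section \<open>Lie derivative and differentials\<close>

text \<open>The part of the Lie derivative that lets \<open>x\<close> act on the arguments of \<open>G\<close>.\<close>
fun ad_sum :: "'a \<times> 'm \<Rightarrow> (('a \<times> 'm) list \<Rightarrow> 'w) \<Rightarrow> ('a \<times> 'm) list \<Rightarrow> 'w" where
  "ad_sum x G [] = 0"
| "ad_sum x G (s # ss) = G (bra x s # ss) + ad_sum x (\<lambda>t. G (s # t)) ss"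

definition Lie :: "'a \<times> 'm \<Rightarrow> (('a \<times> 'm) list \<Rightarrow> 'w) \<Rightarrow> ('a \<times> 'm) list \<Rightarrow> 'w" where
  "Lie x G ss = sact x (G ss) - ad_sum x G ss"

text \<open>The Chevalley--Eilenberg differential in the first \<open>m\<close> arguments, defined by Cartan's formula. The
  brackets stand in the place of their right argument, which makes the formula recursive in \<open>m\<close>.\<close>
fun CE :: "nat \<Rightarrow> (('a \<times> 'm) list \<Rightarrow> 'w) \<Rightarrow> ('a \<times> 'm) list \<Rightarrow> 'w" where
  "CE 0 G ss = 0"
| "CE (Suc m) G [] = 0"
| "CE (Suc m) G (x # ss) = Lie x G ss - CE m (\<lambda>t. G (x # t)) ss"

text \<open>The Hochschild differential without its first summand, that is, for the zero left action. \<open>q\<close> is the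
  total momentum of arguments that have already been split off: the momentum of the value of \<open>G\<close>
  is needed as the subscript of its right multiplication.\<close>
fun Hbar :: "'m \<Rightarrow> (('a \<times> 'm) list \<Rightarrow> 'w) \<Rightarrow> ('a \<times> 'm) list \<Rightarrow> 'w" where
  "Hbar q G [] = 0"
| "Hbar q G [y] = - srmul q (G []) y"
| "Hbar q G (x # y # ss) = - G (mul x y # ss) - Hbar (q + snd x) (\<lambda>t. G (x # t)) (y # ss)"

text \<open>The Hochschild differential in all arguments after the first \<open>m\<close>.\<close>
fun Hoch :: "'m \<Rightarrow> nat \<Rightarrow> (('a \<times> 'm) list \<Rightarrow> 'w) \<Rightarrow> ('a \<times> 'm) list \<Rightarrow> 'w" where
  "Hoch q m G [] = 0"
| "Hoch q 0 G (x # ss) = slmul x (G ss) + Hbar q G (x # ss)"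
| "Hoch q (Suc m) G (x # ss) = Hoch (q + snd x) m (\<lambda>t. G (x # t)) ss"

lemma ad_sum_add: "ad_sum x (\<lambda>t. G t + G' t) ss = ad_sum x G ss + ad_sum x G' ss"
  by (induction ss arbitrary: G G') (simp_all add: algebra_simps)
lemma ad_sum_zero [simp]: "ad_sum x (\<lambda>t. 0) ss = 0"
  by (induction ss) simp_all

lemma ad_sum_diff: "ad_sum x (\<lambda>t. G t - G' t) ss = ad_sum x G ss - ad_sum x G' ss"
  by (induction ss arbitrary: G G') (simp_all add: algebra_simps)
lemma ad_sum_la: "ad_sum x (\<lambda>t. la p a (G t)) ss = la p a (ad_sum x G ss)"
  by (induction ss arbitrary: G) (simp_all add: la_add2)
lemma ad_sum_lc: "ad_sum x (\<lambda>t. lc p a (G t)) ss = lc p a (ad_sum x G ss)"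
  by (induction ss arbitrary: G) (simp_all add: lc_add2)
lemma ad_sum_cong: "(\<And>t. length t = length ss \<Longrightarrow> G t = G' t) \<Longrightarrow> ad_sum x G ss = ad_sum x G' ss"
proof (induction ss arbitrary: G G')
  case (Cons s ss)
  have "ad_sum x (\<lambda>t. G (s # t)) ss = ad_sum x (\<lambda>t. G' (s # t)) ss"
    by (rule Cons.IH) (simp add: Cons.prems)
  then show ?case by (simp add: Cons.prems)
qed simp

lemma Lie_add: "Lie x (\<lambda>t. G t + G' t) ss = Lie x G ss + Lie x G' ss"
  by (simp add: Lie_def ad_sum_add la_add2)
lemma Lie_diff: "Lie x (\<lambda>t. G t - G' t) ss = Lie x G ss - Lie x G' ss"
  by (simp add: Lie_def ad_sum_diff la_diff)
lemma Lie_zero [simp]: "Lie x (\<lambda>t. 0) ss = 0"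
  by (simp add: Lie_def)
lemma Lie_Cons: "Lie x G (y # ss) = Lie x (\<lambda>t. G (y # t)) ss - G (bra x y # ss)"
  by (simp add: Lie_def)
lemma Lie_cong: "(\<And>t. length t = length ss \<Longrightarrow> G t = G' t) \<Longrightarrow> Lie x G ss = Lie x G' ss"
  unfolding Lie_def using ad_sum_cong[of ss G G' x] by simp

lemma CE_add: "CE m (\<lambda>t. G t + G' t) ss = CE m G ss + CE m G' ss"
  by (induction m G ss arbitrary: G' rule: CE.induct) (simp_all add: Lie_add)
lemma CE_diff: "CE m (\<lambda>t. G t - G' t) ss = CE m G ss - CE m G' ss"
  by (induction m G ss arbitrary: G' rule: CE.induct) (simp_all add: Lie_diff)
lemma CE_zero [simp]: "CE m (\<lambda>t. 0) ss = 0"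
  by (induction m arbitrary: ss) (simp, case_tac ss, auto)

lemma Hbar_add: "Hbar q (\<lambda>t. G t + G' t) ss = Hbar q G ss + Hbar q G' ss"
  by (induction q G ss arbitrary: G' rule: Hbar.induct) (simp_all add: rc_add1)
lemma Hbar_diff: "Hbar q (\<lambda>t. G t - G' t) ss = Hbar q G ss - Hbar q G' ss"
  by (induction q G ss arbitrary: G' rule: Hbar.induct) (simp_all add: rc_diff)
lemma Hbar_zero [simp]: "Hbar q (\<lambda>t. 0) ss = 0"
  by (induction q "\<lambda>t::('a \<times> 'm) list. 0::'w" ss rule: Hbar.induct) simp_all
lemma Hbar_cong: "(\<And>t. Suc (length t) = length ss \<Longrightarrow> G t = G' t) \<Longrightarrow> Hbar q G ss = Hbar q G' ss"
proof (induction q G ss arbitrary: G' rule: Hbar.induct)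
  case (3 q G x y ss)
  have "Hbar (q + snd x) (\<lambda>t. G (x # t)) (y # ss) = Hbar (q + snd x) (\<lambda>t. G' (x # t)) (y # ss)"
    by (rule "3.IH") (simp add: "3.prems")
  then show ?case using "3.prems"[of "mul x y # ss"] by simp
qed simp_all

lemma Hoch_add: "Hoch q m (\<lambda>t. G t + G' t) ss = Hoch q m G ss + Hoch q m G' ss"
  by (induction q m G ss arbitrary: G' rule: Hoch.induct) (simp_all add: Hbar_add lc_add2)
lemma Hoch_diff: "Hoch q m (\<lambda>t. G t - G' t) ss = Hoch q m G ss - Hoch q m G' ss"
  by (induction q m G ss arbitrary: G' rule: Hoch.induct) (simp_all add: Hbar_diff lc_diff)
lemma Hoch_zero [simp]: "Hoch q m (\<lambda>t. 0) ss = 0"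
  by (induction q m "\<lambda>t::('a \<times> 'm) list. 0::'w" ss rule: Hoch.induct) simp_all
lemma Hoch_minus: "Hoch q m (\<lambda>t. - G t) ss = - Hoch q m G ss"
  using Hoch_diff[of q m "\<lambda>t. 0" G ss] by simp

section \<open>The Chevalley--Eilenberg differential squares to zero\<close>

definition Additive :: "(('a \<times> 'm) list \<Rightarrow> 'w) \<Rightarrow> bool" where
  "Additive G \<longleftrightarrow> (\<forall>us f g p vs. G (us @ (f + g, p) # vs) = G (us @ (f, p) # vs) + G (us @ (g, p) # vs))"

lemma AdditiveD: "Additive G \<Longrightarrow> G (us @ (f + g, p) # vs) = G (us @ (f, p) # vs) + G (us @ (g, p) # vs)"
  by (simp add: Additive_def)
lemma AdditiveD1: "Additive G \<Longrightarrow> G ((f + g, p) # vs) = G ((f, p) # vs) + G ((g, p) # vs)"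
  using AdditiveD[of G "[]"] by simp
lemma Additive_Cons: "Additive G \<Longrightarrow> Additive (\<lambda>t. G (x # t))"
  unfolding Additive_def by (metis append_Cons)

lemma bra_jacobi: "Additive G \<Longrightarrow> G (bra x (bra y s) # ss) = G (bra (bra x y) s # ss) + G (bra y (bra x s) # ss)"
  using br_jacobi[of "snd x" "fst x" "snd y" "fst y" "fst s"] by (simp add: bra_def AdditiveD1 add_ac)

text \<open>The terms in which \<open>x\<close> and \<open>y\<close> act on different arguments are symmetric in \<open>x\<close> and \<open>y\<close>; those in which they act
  on the same argument combine by the Jacobi identity.\<close>
lemma ad_sum_comm:
  "Additive G \<Longrightarrow> ad_sum x (ad_sum y G) ss + ad_sum (bra x y) G ss = ad_sum y (ad_sum x G) ss"
proof (induction ss arbitrary: G)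
  case (Cons s ss)
  have "ad_sum x (ad_sum y (\<lambda>t. G (s # t))) ss + ad_sum (bra x y) (\<lambda>t. G (s # t)) ss
      = ad_sum y (ad_sum x (\<lambda>t. G (s # t))) ss"
    by (rule Cons.IH) (rule Additive_Cons[OF Cons.prems])
  then show ?case
    using bra_jacobi[OF Cons.prems, of x y s ss] by (simp add: ad_sum_add algebra_simps)
qed simp

lemma lact_bra: "sact (bra x y) v = sact x (sact y v) - sact y (sact x v)"
  by (simp add: bra_def la_br)

lemma Lie_Lie: "Additive G \<Longrightarrow> Lie x (Lie y G) ss = Lie (bra x y) G ss + Lie y (Lie x G) ss"
  using ad_sum_comm[of G x y ss] lact_bra[of x y "G ss"]
  by (simp add: Lie_def[abs_def] ad_sum_diff ad_sum_la la_diff algebra_simps)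

text \<open>Splitting off an argument \<open>y\<close> commutes with \<open>Lie x\<close> up to the term in which \<open>x\<close> acts on \<open>y\<close>, so Cartan's formula
  reduces the claim to \<open>Lie_Lie\<close> and to one argument less.\<close>
lemma CE_Lie: "Additive G \<Longrightarrow> CE m (Lie x G) ss = Lie x (CE m G) ss"
proof (induction m G ss rule: CE.induct)
  case (1 G ss)
  then show ?case by (simp add: Lie_def la_diff)
next
  case (2 m G)
  then show ?case by (simp add: Lie_def)
next
  case (3 m G y ss)
  have IH: "CE m (Lie x (\<lambda>t. G (y # t))) ss = Lie x (CE m (\<lambda>t. G (y # t))) ss"
    by (rule "3.IH") (rule Additive_Cons[OF "3.prems"])
  show ?case
    using Lie_Lie[OF "3.prems", of x y ss]
    by (simp add: Lie_Cons Lie_diff CE_diff IH algebra_simps)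
qed

text \<open>By Cartan's formula, \<open>d\<^sup>2\<close> with \<open>x\<close> as first argument is \<open>L\<^sub>x d - d L\<^sub>x\<close> plus \<open>d\<^sup>2\<close> of a cochain with one argument
  less.\<close>
lemma CE_CE: "Additive G \<Longrightarrow> CE (Suc m) (CE m G) ss = 0"
proof (induction m arbitrary: G ss)
  case 0
  show ?case by (cases ss) (simp_all add: Lie_def)
next
  case (Suc m)
  show ?case
  proof (cases ss)
    case (Cons x t)
    have "CE (Suc m) (CE m (\<lambda>t. G (x # t))) t = 0"
      by (rule Suc.IH) (rule Additive_Cons[OF Suc.prems])
    then show ?thesis
      by (simp add: Cons CE_diff CE_Lie[OF Suc.prems] del: CE.simps(1) CE.simps(3)) (simp add: CE_diff CE_Lie[OF Suc.prems])
  qed simp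
qed

section \<open>The Hochschild differential squares to zero\<close>

lemma mul_assoc: "mul x (mul y z) = mul (mul x y) z"
  by (simp add: mul_def mu_assoc add.assoc)
lemma lmul_mul: "slmul (mul x y) v = slmul x (slmul y v)"
  by (simp add: mul_def lc_mu)
lemma rmul_mul: "srmul q v (mul x y) = srmul (q + snd x) (srmul q v x) y"
  by (simp add: mul_def rc_mu)
lemma rmul_lmul: "srmul (q + snd x) (slmul x v) y = slmul x (srmul q v y)"
  using rc_lc[of "snd x" q] by (simp add: add.commute)

text \<open>Left and right multiplication on the module commute.\<close>
lemma Hbar_lmul: "Hbar (q + snd x) (\<lambda>t. slmul x (G t)) ss = slmul x (Hbar q G ss)"
proof (induction q G ss rule: Hbar.induct)
  case (3 q G y z ss)
  then show ?case by (simp add: lc_diff lc_minus add_ac)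
qed (simp_all add: rmul_lmul lc_minus)

text \<open>Induction on the arguments: apart from the square for one argument less, the terms that multiply \<open>x\<close> by \<open>y\<close>,
  collected in the function \<open>?k\<close>, remain, and they cancel by associativity.\<close>
lemma Hbar_Hbar: "Hbar q (Hbar q G) ss = 0"
proof (induction ss arbitrary: q G rule: induct_list012)
  case (3 x y ss)
  show ?case
  proof (cases ss)
    case Nil
    then show ?thesis by (simp add: rmul_mul rc_minus)
  next
    case (Cons z zs)
    let ?k = "\<lambda>t. case t of [] \<Rightarrow> 0 | y # t \<Rightarrow> G (mul x y # t)"
    have eq: "Hbar q G (x # t) = - ?k t - Hbar (q + snd x) (\<lambda>t. G (x # t)) t"
      if "Suc (length t) = length (y # z # zs)" for t
      using that by (cases t) auto
    have "Hbar (q + snd x) (\<lambda>t. Hbar q G (x # t)) (y # z # zs)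
        = Hbar (q + snd x) (\<lambda>t. (0 - ?k t) - Hbar (q + snd x) (\<lambda>t. G (x # t)) t) (y # z # zs)"
      by (rule Hbar_cong) (simp add: eq)
    also have "\<dots> = - Hbar (q + snd x) ?k (y # z # zs)"
      using "3.IH"(2)[of "q + snd x" "\<lambda>t. G (x # t)"] by (subst Hbar_diff, subst Hbar_diff) (simp add: Cons)
    finally show ?thesis
      by (simp add: Cons mul_assoc add_ac)
  qed
qed simp_all

text \<open>With the left multiplication \<open>l\<close> split off, the square is \<open>l\<^sup>2 + l Hbar + Hbar l + Hbar\<^sup>2\<close>; the last term vanishes
  and \<open>Hbar l = - l\<^sup>2 - l Hbar\<close>.\<close>
lemma Hoch_Hoch_0: "Hoch q 0 (Hoch q 0 G) ss = 0"
proof (cases ss)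
  case (Cons x t)
  have H: "Hoch q 0 G = (\<lambda>t. (case t of [] \<Rightarrow> 0 | x # ss \<Rightarrow> slmul x (G ss)) + Hbar q G t)" (is "_ = (\<lambda>t. ?l t + _)")
    by (rule ext) (case_tac t, simp_all)
  have "Hbar q (Hoch q 0 G) (x # t) = Hbar q ?l (x # t)"
    unfolding H by (simp only: Hbar_add Hbar_Hbar) simp
  also have "\<dots> = - slmul x (Hoch q 0 G t)"
  proof (cases t)
    case (Cons y ss)
    have "Hbar (q + snd x) (\<lambda>t. slmul x (G t)) (y # ss) = slmul x (Hbar q G (y # ss))"
      by (rule Hbar_lmul)
    then show ?thesis using lmul_mul[of x y "G ss"] by (simp add: Cons lc_add2)
  qed simp
  finally show ?thesis by (simp add: Cons)
qed simp

lemma Hoch_Hoch: "Hoch q m (Hoch q m G) ss = 0"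
  by (induction m arbitrary: q G ss) (simp add: Hoch_Hoch_0, case_tac ss, simp_all)

section \<open>The two differentials commute\<close>

lemma bra_mul: "Additive G \<Longrightarrow> G (bra x (mul y z) # ss) = G (mul (bra x y) z # ss) + G (mul y (bra x z) # ss)"
  by (simp add: bra_def mul_def br_leibniz AdditiveD1 add_ac)
lemma lmul_bra: "slmul (bra x y) v = sact x (slmul y v) - slmul y (sact x v)"
  by (simp add: bra_def lc_br)
lemma rmul_bra: "srmul q v (bra x y) = sact x (srmul q v y) - srmul (q + snd x) (sact x v) y"
  by (simp add: bra_def rc_br add.commute)

text \<open>\<open>x\<close> acts on the products by derivations. Acting with \<open>x\<close> raises the momentum of the value, which explains the
  offset \<open>q + snd x\<close>.\<close>
lemma Lie_Hbar: "Additive G \<Longrightarrow> Lie x (Hbar q G) ss = Hbar (q + snd x) (Lie x G) ss"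
proof (induction q G ss rule: Hbar.induct)
  case (1 q G)
  then show ?case by (simp add: Lie_def)
next
  case (2 q G y)
  then show ?case by (simp add: Lie_def rmul_bra la_minus)
next
  case (3 q G y z ss)
  let ?k = "\<lambda>t. case t of [] \<Rightarrow> 0 | z # t \<Rightarrow> G (mul y z # t)"
  have IH: "Lie x (Hbar (q + snd y) (\<lambda>t. G (y # t))) (z # ss)
      = Hbar (q + snd y + snd x) (Lie x (\<lambda>t. G (y # t))) (z # ss)"
    by (rule "3.IH") (rule Additive_Cons[OF "3.prems"])
  have "Lie x (\<lambda>t. Hbar q G (y # t)) (z # ss)
      = Lie x (\<lambda>t. (0 - ?k t) - Hbar (q + snd y) (\<lambda>t. G (y # t)) t) (z # ss)"
    by (rule Lie_cong) (case_tac t, simp_all)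
  also have "\<dots> = - Lie x ?k (z # ss) - Hbar (q + snd y + snd x) (Lie x (\<lambda>t. G (y # t))) (z # ss)"
    by (subst Lie_diff, subst Lie_diff) (simp only: IH Lie_zero diff_0)
  finally have 1: "Lie x (\<lambda>t. Hbar q G (y # t)) (z # ss)
      = - Lie x ?k (z # ss) - Hbar (q + snd y + snd x) (Lie x (\<lambda>t. G (y # t))) (z # ss)" .
  have 2: "Lie x ?k (z # ss) = Lie x (\<lambda>t. G (mul y z # t)) ss - G (mul y (bra x z) # ss)"
    by (simp add: Lie_Cons)
  have 3: "Hbar (q + snd x + snd y) (\<lambda>t. Lie x G (y # t)) (z # ss)
    = Hbar (q + snd x + snd y) (Lie x (\<lambda>t. G (y # t))) (z # ss) - Hbar (q + snd x + snd y) (\<lambda>t. G (bra x y # t)) (z # ss)"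
    by (simp only: Lie_Cons Hbar_diff)
  show ?case
    using bra_mul[OF "3.prems", of x y z ss] 3
    by (subst Lie_Cons) (simp add: 1 2 Lie_Cons[of x G "mul y z"] algebra_simps)
qed

lemma Lie_Hoch: "Additive G \<Longrightarrow> Lie x (Hoch q m G) ss = Hoch (q + snd x) m (Lie x G) ss"
proof (induction q m G ss rule: Hoch.induct)
  case (1 q m G)
  then show ?case by (simp add: Lie_def)
next
  case (2 q G y ss)
  have "Lie x (\<lambda>t. slmul y (G t) + Hbar q G (y # t)) ss = Lie x (\<lambda>t. slmul y (G t)) ss + Lie x (\<lambda>t. Hbar q G (y # t)) ss"
    by (rule Lie_add)
  then show ?case
    using Lie_Hbar[OF "2.prems", of x q "y # ss"] lmul_bra[of x y "G ss"]
    by (simp add: Lie_Cons) (simp add: Lie_def ad_sum_lc lc_diff algebra_simps)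
next
  case (3 q m G y ss)
  have "Lie x (Hoch (q + snd y) m (\<lambda>t. G (y # t))) ss = Hoch (q + snd y + snd x) m (Lie x (\<lambda>t. G (y # t))) ss"
    by (rule "3.IH") (rule Additive_Cons[OF "3.prems"])
  then show ?case
    by (simp add: Lie_Cons Hoch_diff add_ac)
qed

lemma CE_Hoch: "Additive G \<Longrightarrow> CE (Suc m) (Hoch q m G) ss = Hoch q (Suc m) (CE (Suc m) G) ss"
proof (induction m arbitrary: q G ss)
  case 0
  then show ?case by (cases ss) (simp_all add: Lie_Hoch)
next
  case (Suc m)
  show ?case
  proof (cases ss)
    case (Cons x t)
    have "CE (Suc m) (Hoch (q + snd x) m (\<lambda>t. G (x # t))) t = Hoch (q + snd x) (Suc m) (CE (Suc m) (\<lambda>t. G (x # t))) t"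
      by (rule Suc.IH) (rule Additive_Cons[OF Suc.prems])
    then show ?thesis
      by (simp add: Cons CE.simps(3)[of "Suc m"] Lie_Hoch[OF Suc.prems] Hoch_diff del: CE.simps)
  qed simp
qed

section \<open>Inherited properties of cochains\<close>

text \<open>The differentials are compatible with equality at the appropriate momentum. In this and the following
  lemmas \<open>q\<close> is the momentum of arguments that have been split off.\<close>
lemma ad_sum_Z: "(\<And>t. G t \<in> ZW (q + tot t)) \<Longrightarrow> ad_sum x G ss \<in> ZW (q + snd x + tot ss)"
proof (induction ss arbitrary: q G)
  case (Cons s ss)
  have "ad_sum x (\<lambda>t. G (s # t)) ss \<in> ZW (q + snd s + snd x + tot ss)"
    by (rule Cons.IH) (use Cons.prems[of "s # _"] in \<open>simp add: add_ac\<close>)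
  moreover have "G (bra x s # ss) \<in> ZW (q + snd x + tot (s # ss))"
    using Cons.prems[of "bra x s # ss"] by (simp add: add_ac)
  ultimately show ?case by (simp add: ZW_add add_ac)
qed (simp add: ZW_0)

lemma Lie_Z: "(\<And>t. G t \<in> ZW (q + tot t)) \<Longrightarrow> Lie x G ss \<in> ZW (q + snd x + tot ss)"
  unfolding Lie_def using la_Z2[of "G ss" "q + tot ss" "snd x" "fst x"]
  by (intro ZW_diff ad_sum_Z) (simp_all add: add_ac)

lemma CE_Z: "(\<And>t. G t \<in> ZW (q + tot t)) \<Longrightarrow> CE m G ss \<in> ZW (q + tot ss)"
proof (induction m G ss arbitrary: q rule: CE.induct)
  case (3 m G x ss)
  have "CE m (\<lambda>t. G (x # t)) ss \<in> ZW (q + snd x + tot ss)"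
    by (rule "3.IH") (use "3.prems"[of "x # _"] in \<open>simp add: add_ac\<close>)
  then show ?case
    using Lie_Z[of G q x ss] "3.prems" by (simp add: ZW_diff add_ac)
qed (simp_all add: ZW_0)

lemma Hbar_Z: "(\<And>t. G t \<in> ZW (q + tot t)) \<Longrightarrow> Hbar q G ss \<in> ZW (q + tot ss)"
proof (induction q G ss rule: Hbar.induct)
  case (2 q G y)
  show ?case using "2"[of "[]"] by (simp add: rc_Z1 ZW_0)
next
  case (3 q G x y ss)
  have "Hbar (q + snd x) (\<lambda>t. G (x # t)) (y # ss) \<in> ZW (q + snd x + tot (y # ss))"
    by (rule "3.IH") (use "3.prems"[of "x # _"] in \<open>simp add: add_ac\<close>)
  moreover have "- G (mul x y # ss) \<in> ZW (q + tot (x # y # ss))"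
    using ZW_minus[OF "3.prems"[of "mul x y # ss"]] by (simp add: add_ac)
  ultimately show ?case by (simp add: ZW_diff add_ac)
qed (simp_all add: ZW_0)

lemma Hoch_Z: "(\<And>t. G t \<in> ZW (q + tot t)) \<Longrightarrow> Hoch q m G ss \<in> ZW (q + tot ss)"
proof (induction q m G ss rule: Hoch.induct)
  case (2 q G x ss)
  have "slmul x (G ss) \<in> ZW (q + tot (x # ss))"
    using lc_Z2[OF "2"[of ss], of "snd x" "fst x"] by (simp add: add_ac)
  then show ?case using Hbar_Z[of G q "x # ss"] "2" by (simp add: ZW_add)
next
  case (3 q m G x ss)
  have "Hoch (q + snd x) m (\<lambda>t. G (x # t)) ss \<in> ZW (q + snd x + tot ss)"
    by (rule "3.IH") (use "3.prems"[of "x # _"] in \<open>simp add: add_ac\<close>)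
  then show ?case by (simp add: add_ac)
qed (simp_all add: ZW_0)

text \<open>\<open>G\<close> depends only on the classes of its arguments: \<open>\<partial>\<close> acts on an argument of momentum \<open>p\<close> as \<open>- p\<close>.\<close>
definition Null :: "'m \<Rightarrow> (('a \<times> 'm) list \<Rightarrow> 'w) \<Rightarrow> bool" where
  "Null q G \<longleftrightarrow> (\<forall>us f p vs. f \<in> ZA p \<longrightarrow> G (us @ (f, p) # vs) \<in> ZW (q + tot us + p + tot vs))"

lemma NullD: "Null q G \<Longrightarrow> f \<in> ZA p \<Longrightarrow> G (us @ (f, p) # vs) \<in> ZW (q + tot us + p + tot vs)"
  by (simp add: Null_def)
lemma NullD1: "Null q G \<Longrightarrow> f \<in> ZA p \<Longrightarrow> G ((f, p) # vs) \<in> ZW (q + p + tot vs)"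
  using NullD[of q G f p "[]"] by simp
lemma Null_Cons: "Null q G \<Longrightarrow> Null (q + snd x) (\<lambda>t. G (x # t))"
  unfolding Null_def
proof (intro allI impI)
  fix us vs :: "('a \<times> 'm) list" and f p
  assume *: "\<forall>us f p vs. f \<in> ZA p \<longrightarrow> G (us @ (f, p) # vs) \<in> ZW (q + tot us + p + tot vs)" "f \<in> ZA p"
  show "G (x # us @ (f, p) # vs) \<in> ZW (q + snd x + tot us + p + tot vs)"
    using *(1)[rule_format, OF *(2), of "x # us" vs] by (simp add: add_ac)
qed

lemma Additive_0: "Additive G \<Longrightarrow> G ((0, p) # vs) = 0"
  using AdditiveD1[of G 0 0 p vs] by simp

lemma Null_ad_sum: "Null q G \<Longrightarrow> Null (q + snd x) (ad_sum x G)"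
  unfolding Null_def[of _ "ad_sum x G"]
proof (intro allI impI)
  fix us vs :: "('a \<times> 'm) list" and f p
  show "Null q G \<Longrightarrow> f \<in> ZA p \<Longrightarrow> ad_sum x G (us @ (f, p) # vs) \<in> ZW (q + snd x + tot us + p + tot vs)"
  proof (induction us arbitrary: q G)
    case Nil
    have "G (bra x (f, p) # vs) \<in> ZW (q + (snd x + p) + tot vs)"
      unfolding bra_def using NullD1[OF Nil(1) br_Z2[OF Nil(2)]] by simp
    moreover have "ad_sum x (\<lambda>t. G ((f, p) # t)) vs \<in> ZW (q + p + snd x + tot vs)"
      using Nil by (intro ad_sum_Z NullD1)
    ultimately show ?case by (simp add: ZW_add add_ac)
  next
    case (Cons u us)
    have "ad_sum x (\<lambda>t. G (u # t)) (us @ (f, p) # vs) \<in> ZW (q + snd u + snd x + tot us + p + tot vs)"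
      by (intro Cons.IH Null_Cons Cons.prems)
    moreover have "G (bra x u # us @ (f, p) # vs) \<in> ZW (q + tot (bra x u # us) + p + tot vs)"
      using NullD[OF Cons.prems, of "bra x u # us" vs] by simp
    ultimately show ?case by (simp add: ZW_add add_ac)
  qed
qed

lemma Null_Lie: "Null q G \<Longrightarrow> Null (q + snd x) (Lie x G)"
  unfolding Null_def[of _ "Lie x G"] Lie_def
proof (intro allI impI ZW_diff)
  fix us vs :: "('a \<times> 'm) list" and f p
  assume *: "Null q G" "f \<in> ZA p"
  show "sact x (G (us @ (f, p) # vs)) \<in> ZW (q + snd x + tot us + p + tot vs)"
    using la_Z2[OF NullD[OF *, of us vs], of "snd x" "fst x"] by (simp add: add_ac)
  show "ad_sum x G (us @ (f, p) # vs) \<in> ZW (q + snd x + tot us + p + tot vs)"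
    using NullD[OF Null_ad_sum[OF *(1)] *(2)] .
qed

lemma Lie_Z1:
  assumes "Additive G" "f \<in> ZA p" shows "Lie (f, p) G ss = 0"
proof -
  have "ad_sum (f, p) G ss = 0"
    using assms(1)
  proof (induction ss arbitrary: G)
    case (Cons s ss)
    then show ?case using Cons.IH[OF Additive_Cons[OF Cons.prems]]
      by (simp add: bra_def br_Z1[OF assms(2)] Additive_0)
  qed simp
  then show ?thesis by (simp add: Lie_def la_Z1[OF assms(2)])
qed

lemma Null_CE: "Additive G \<Longrightarrow> Null q G \<Longrightarrow> Null q (CE m G)"
  unfolding Null_def[of _ "CE m G"]
proof (intro allI impI)
  fix us vs :: "('a \<times> 'm) list" and f p
  show "Additive G \<Longrightarrow> Null q G \<Longrightarrow> f \<in> ZA p \<Longrightarrow> CE m G (us @ (f, p) # vs) \<in> ZW (q + tot us + p + tot vs)"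
  proof (induction m arbitrary: q G us)
    case (Suc m)
    show ?case
    proof (cases us)
      case Nil
      have "CE m (\<lambda>t. G ((f, p) # t)) vs \<in> ZW (q + p + tot vs)"
        using Suc.prems by (intro CE_Z NullD1)
      then show ?thesis by (simp add: Nil Lie_Z1 Suc.prems ZW_minus)
    next
      case (Cons u us')
      have "CE m (\<lambda>t. G (u # t)) (us' @ (f, p) # vs) \<in> ZW (q + snd u + tot us' + p + tot vs)"
        by (intro Suc.IH Null_Cons Additive_Cons Suc.prems)
      moreover have "Lie u G (us' @ (f, p) # vs) \<in> ZW (q + snd u + tot us' + p + tot vs)"
        by (intro NullD Null_Lie Suc.prems)
      ultimately show ?thesis by (simp add: Cons ZW_diff add_ac)
    qed
  qed (simp add: ZW_0)
qed

lemma Null_Hbar: "Additive G \<Longrightarrow> Null q G \<Longrightarrow> Null q (Hbar q G)"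
  unfolding Null_def[of _ "Hbar q G"]
proof (intro allI impI)
  fix us vs :: "('a \<times> 'm) list" and f p
  show "Additive G \<Longrightarrow> Null q G \<Longrightarrow> f \<in> ZA p \<Longrightarrow> Hbar q G (us @ (f, p) # vs) \<in> ZW (q + tot us + p + tot vs)"
  proof (induction us arbitrary: q G)
    case Nil
    show ?case
    proof (cases vs)
      case Nil
      then show ?thesis using rc_Z2[OF \<open>f \<in> ZA p\<close>] by (simp add: ZW_minus)
    next
      case (Cons y ss)
      have "Hbar (q + p) (\<lambda>t. G ((f, p) # t)) (y # ss) \<in> ZW (q + p + tot (y # ss))"
        using Nil.prems by (intro Hbar_Z NullD1)
      then show ?thesis
        by (simp add: Cons mul_def mu_Z1[OF Nil.prems(3)] Additive_0[OF Nil.prems(1)] ZW_minus)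
    qed
  next
    case (Cons u us)
    have IH: "Hbar (q + snd u) (\<lambda>t. G (u # t)) (us @ (f, p) # vs) \<in> ZW (q + snd u + tot us + p + tot vs)"
      by (intro Cons.IH Null_Cons Additive_Cons Cons.prems)
    show ?case
    proof (cases us)
      case Nil
      have "G (mul u (f, p) # vs) \<in> ZW (q + (snd u + p) + tot vs)"
        unfolding mul_def using NullD1[OF Cons.prems(2) mu_Z2[OF Cons.prems(3)]] by simp
      then show ?thesis using IH by (simp add: Nil ZW_diff ZW_minus add_ac)
    next
      case (Cons y us')
      have "G (mul u y # us' @ (f, p) # vs) \<in> ZW (q + tot (mul u y # us') + p + tot vs)"
        using NullD[OF Cons.prems(2,3), of "mul u y # us'" vs] by simp
      then show ?thesis using IH by (simp add: Cons ZW_diff ZW_minus add_ac)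
    qed
  qed
qed

lemma Null_Hoch: "Additive G \<Longrightarrow> Null q G \<Longrightarrow> Null q (Hoch q m G)"
  unfolding Null_def[of _ "Hoch q m G"]
proof (intro allI impI)
  fix us vs :: "('a \<times> 'm) list" and f p
  show "Additive G \<Longrightarrow> Null q G \<Longrightarrow> f \<in> ZA p \<Longrightarrow> Hoch q m G (us @ (f, p) # vs) \<in> ZW (q + tot us + p + tot vs)"
  proof (induction m arbitrary: q G us)
    case 0
    have H: "Hbar q G (us @ (f, p) # vs) \<in> ZW (q + tot us + p + tot vs)"
      by (intro NullD Null_Hbar 0)
    show ?case
    proof (cases us)
      case Nil
      then show ?thesis using H by (simp add: lc_Z1[OF 0(3)])
    next
      case (Cons u us')
      have "slmul u (G (us' @ (f, p) # vs)) \<in> ZW (snd u + (q + tot us' + p + tot vs))"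
        by (intro lc_Z2 NullD 0)
      then show ?thesis using H by (simp add: Cons ZW_add add_ac)
    qed
  next
    case (Suc m)
    show ?case
    proof (cases us)
      case Nil
      then show ?thesis using Suc.prems Hoch_Z[of "\<lambda>t. G ((f, p) # t)" "q + p" m vs] by (simp add: NullD1)
    next
      case (Cons u us')
      have "Hoch (q + snd u) m (\<lambda>t. G (u # t)) (us' @ (f, p) # vs) \<in> ZW (q + snd u + tot us' + p + tot vs)"
        by (intro Suc.IH Null_Cons Additive_Cons Suc.prems)
      then show ?thesis by (simp add: Cons add_ac)
    qed
  qed
qed

definition Alt :: "'m \<Rightarrow> nat \<Rightarrow> (('a \<times> 'm) list \<Rightarrow> 'w) \<Rightarrow> bool" where
  "Alt q m G \<longleftrightarrow> (\<forall>us x y vs. length us + 2 \<le> m \<longrightarrow>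
     G (us @ x # y # vs) + G (us @ y # x # vs) \<in> ZW (q + tot us + snd x + snd y + tot vs))"

lemma AltD: "Alt q m G \<Longrightarrow> length us + 2 \<le> m \<Longrightarrow>
     G (us @ x # y # vs) + G (us @ y # x # vs) \<in> ZW (q + tot us + snd x + snd y + tot vs)"
  unfolding Alt_def by blast
lemma AltD1: "Alt q m G \<Longrightarrow> 2 \<le> m \<Longrightarrow>
     G (x # y # vs) + G (y # x # vs) \<in> ZW (q + snd x + snd y + tot vs)"
  using AltD[of q m G "[]" x y vs] by simp
lemma Alt_Cons: "Alt q (Suc m) G \<Longrightarrow> Alt (q + snd u) m (\<lambda>t. G (u # t))"
  unfolding Alt_def[of _ m]
proof (intro allI impI)
  fix us vs :: "('a \<times> 'm) list" and x y :: "'a \<times> 'm"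
  assume *: "Alt q (Suc m) G" "length us + 2 \<le> m"
  show "G (u # us @ x # y # vs) + G (u # us @ y # x # vs) \<in> ZW (q + snd u + tot us + snd x + snd y + tot vs)"
    using AltD[OF *(1), of "u # us" x y vs] *(2) by (simp add: add_ac)
qed
lemma Alt_mono: "Alt q m G \<Longrightarrow> m' \<le> m \<Longrightarrow> Alt q m' G"
  by (simp add: Alt_def)

lemma Alt_ad_sum: "Alt q m G \<Longrightarrow> Alt (q + snd u) m (ad_sum u G)"
  unfolding Alt_def[of _ _ "ad_sum u G"]
proof (intro allI impI)
  fix us vs :: "('a \<times> 'm) list" and x y :: "'a \<times> 'm"
  show "Alt q m G \<Longrightarrow> length us + 2 \<le> m \<Longrightarrow> ad_sum u G (us @ x # y # vs) + ad_sum u G (us @ y # x # vs)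
     \<in> ZW (q + snd u + tot us + snd x + snd y + tot vs)"
  proof (induction us arbitrary: q m G)
    case Nil
    have "ad_sum u (\<lambda>t. G (x # y # t) + G (y # x # t)) vs \<in> ZW (q + snd x + snd y + snd u + tot vs)"
      by (intro ad_sum_Z AltD1[OF Nil.prems(1)]) (use Nil.prems in simp)
    moreover have "G (bra u x # y # vs) + G (y # bra u x # vs) \<in> ZW (q + snd x + snd y + snd u + tot vs)"
      using AltD1[OF Nil.prems(1), of "bra u x" y vs] Nil.prems by (simp add: add_ac)
    moreover have "G (x # bra u y # vs) + G (bra u y # x # vs) \<in> ZW (q + snd x + snd y + snd u + tot vs)"
      using AltD1[OF Nil.prems(1), of x "bra u y" vs] Nil.prems by (simp add: add_ac)
    ultimately have "ad_sum u (\<lambda>t. G (x # y # t) + G (y # x # t)) vs + ((G (bra u x # y # vs) + G (y # bra u x # vs))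
       + (G (x # bra u y # vs) + G (bra u y # x # vs))) \<in> ZW (q + snd x + snd y + snd u + tot vs)"
      by (rule ZW_add[OF _ ZW_add])
    then show ?case by (simp add: ad_sum_add add_ac)
  next
    case (Cons w us)
    obtain m' where m: "m = Suc m'" using Cons.prems(2) by (cases m) auto
    have "ad_sum u (\<lambda>t. G (w # t)) (us @ x # y # vs) + ad_sum u (\<lambda>t. G (w # t)) (us @ y # x # vs)
      \<in> ZW (q + snd w + snd u + tot us + snd x + snd y + tot vs)"
      by (rule Cons.IH[of _ m'], rule Alt_Cons) (use Cons.prems m in auto)
    moreover have "G (bra u w # us @ x # y # vs) + G (bra u w # us @ y # x # vs)
      \<in> ZW (q + snd w + snd u + tot us + snd x + snd y + tot vs)"
      using AltD[OF Cons.prems(1), of "bra u w # us" x y vs] Cons.prems(2) by (simp add: add_ac)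
    ultimately have "ad_sum u (\<lambda>t. G (w # t)) (us @ x # y # vs) + ad_sum u (\<lambda>t. G (w # t)) (us @ y # x # vs)
      + (G (bra u w # us @ x # y # vs) + G (bra u w # us @ y # x # vs))
      \<in> ZW (q + snd w + snd u + tot us + snd x + snd y + tot vs)" by (rule ZW_add)
    then show ?case by (simp add: add_ac)
  qed
qed

lemma Alt_Lie: "Alt q m G \<Longrightarrow> Alt (q + snd u) m (Lie u G)"
  unfolding Alt_def[of _ _ "Lie u G"]
proof (intro allI impI)
  fix us vs :: "('a \<times> 'm) list" and x y :: "'a \<times> 'm"
  assume *: "Alt q m G" "length us + 2 \<le> m"
  have "sact u (G (us @ x # y # vs) + G (us @ y # x # vs)) \<in> ZW (snd u + (q + tot us + snd x + snd y + tot vs))"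
    by (rule la_Z2, rule AltD[OF *])
  moreover have "ad_sum u G (us @ x # y # vs) + ad_sum u G (us @ y # x # vs) \<in> ZW (q + snd u + tot us + snd x + snd y + tot vs)"
    by (rule AltD[OF Alt_ad_sum[OF *(1)] *(2)])
  ultimately have "sact u (G (us @ x # y # vs) + G (us @ y # x # vs)) - (ad_sum u G (us @ x # y # vs) + ad_sum u G (us @ y # x # vs))
     \<in> ZW (q + snd u + tot us + snd x + snd y + tot vs)"
    by (intro ZW_diff) (simp_all add: add_ac)
  then show "Lie u G (us @ x # y # vs) + Lie u G (us @ y # x # vs) \<in> ZW (q + snd u + tot us + snd x + snd y + tot vs)"
    by (simp add: Lie_def la_add2 algebra_simps)
qed

lemma bra_skew:
  assumes "Additive G" "Null q G"
  shows "G (bra x y # vs) + G (bra y x # vs) \<in> ZW (q + snd x + snd y + tot vs)"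
proof -
  have "G ((br (snd x) (fst x) (fst y) + br (snd y) (fst y) (fst x), snd x + snd y) # vs) \<in> ZW (q + (snd x + snd y) + tot vs)"
    by (intro NullD1 assms br_skew)
  then show ?thesis by (simp add: AdditiveD1[OF assms(1)] bra_def add_ac)
qed

text \<open>For the first two arguments, Cartan's formula applied twice leaves \<open>- G([x, y], \<dots>) - G([y, x], \<dots>)\<close>, which is
  zero by skew-symmetry of the bracket, and the differential of the symmetrization of \<open>G\<close>.\<close>
lemma Alt_CE: "Additive G \<Longrightarrow> Null q G \<Longrightarrow> Alt q m G \<Longrightarrow> Alt q (Suc m) (CE (Suc m) G)"
  unfolding Alt_def[of _ _ "CE (Suc m) G"]
proof (intro allI impI)
  fix us vs :: "('a \<times> 'm) list" and x y :: "'a \<times> 'm"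
  show "Additive G \<Longrightarrow> Null q G \<Longrightarrow> Alt q m G \<Longrightarrow> length us + 2 \<le> Suc m \<Longrightarrow>
    CE (Suc m) G (us @ x # y # vs) + CE (Suc m) G (us @ y # x # vs) \<in> ZW (q + tot us + snd x + snd y + tot vs)"
  proof (induction m arbitrary: q G us)
    case (Suc m)
    show ?case
    proof (cases us)
      case Nil
      have "CE m (\<lambda>t. G (x # y # t) + G (y # x # t)) vs \<in> ZW (q + snd x + snd y + tot vs)"
      proof (cases m)
        case (Suc m')
        show ?thesis by (intro CE_Z AltD1[OF Suc.prems(3)]) (simp add: Suc)
      qed (simp add: ZW_0)
      then have "CE m (\<lambda>t. G (x # y # t) + G (y # x # t)) vs - (G (bra x y # vs) + G (bra y x # vs)) \<in> ZW (q + snd x + snd y + tot vs)"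
        by (intro ZW_diff bra_skew Suc.prems)
      then show ?thesis by (simp add: Nil Lie_Cons CE_add algebra_simps)
    next
      case (Cons u us')
      have "CE (Suc m) (\<lambda>t. G (u # t)) (us' @ x # y # vs) + CE (Suc m) (\<lambda>t. G (u # t)) (us' @ y # x # vs)
        \<in> ZW (q + snd u + tot us' + snd x + snd y + tot vs)"
        using Suc.prems Cons by (intro Suc.IH Additive_Cons Null_Cons Alt_Cons) auto
      moreover have "Lie u G (us' @ x # y # vs) + Lie u G (us' @ y # x # vs) \<in> ZW (q + snd u + tot us' + snd x + snd y + tot vs)"
        using Suc.prems Cons by (intro AltD[OF Alt_Lie]) auto
      ultimately have "Lie u G (us' @ x # y # vs) + Lie u G (us' @ y # x # vs)
         - (CE (Suc m) (\<lambda>t. G (u # t)) (us' @ x # y # vs) + CE (Suc m) (\<lambda>t. G (u # t)) (us' @ y # x # vs))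
         \<in> ZW (q + snd u + tot us' + snd x + snd y + tot vs)" by (intro ZW_diff)
      then show ?thesis by (simp add: Cons algebra_simps)
    qed
  qed simp
qed

lemma Alt_Hoch: "Alt q m G \<Longrightarrow> Alt q m (Hoch q m G)"
  unfolding Alt_def[of _ _ "Hoch q m G"]
proof (intro allI impI)
  fix us vs :: "('a \<times> 'm) list" and x y :: "'a \<times> 'm"
  show "Alt q m G \<Longrightarrow> length us + 2 \<le> m \<Longrightarrow>
    Hoch q m G (us @ x # y # vs) + Hoch q m G (us @ y # x # vs) \<in> ZW (q + tot us + snd x + snd y + tot vs)"
  proof (induction us arbitrary: q m G)
    case Nil
    obtain m' where m: "m = Suc (Suc m')" using Nil.prems(2) by (cases m; cases "m - 1") auto
    have "Hoch (q + snd x + snd y) m' (\<lambda>t. G (x # y # t) + G (y # x # t)) vs \<in> ZW (q + snd x + snd y + tot vs)"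
      using Nil.prems by (intro Hoch_Z AltD1) auto
    then show ?case by (simp add: m Hoch_add add_ac)
  next
    case (Cons u us)
    obtain m' where m: "m = Suc m'" using Cons.prems(2) by (cases m) auto
    have "Hoch (q + snd u) m' (\<lambda>t. G (u # t)) (us @ x # y # vs) + Hoch (q + snd u) m' (\<lambda>t. G (u # t)) (us @ y # x # vs)
      \<in> ZW (q + snd u + tot us + snd x + snd y + tot vs)"
      by (rule Cons.IH, rule Alt_Cons) (use Cons.prems m in auto)
    then show ?case by (simp add: m add_ac)
  qed
qed

text \<open>Additivity and homogeneity in one condition: for \<open>T = id\<close> and \<open>U = id\<close> it is additivity, and with additivity it
  yields \<open>G(\<dots>, T g, \<dots>) = U (G(\<dots>, g, \<dots>))\<close>. It will be used with scalars \<open>T\<close> and \<open>U\<close>.\<close>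
definition Slotlin :: "('a \<Rightarrow> 'a) \<Rightarrow> ('w \<Rightarrow> 'w) \<Rightarrow> (('a \<times> 'm) list \<Rightarrow> 'w) \<Rightarrow> bool" where
  "Slotlin T U G \<longleftrightarrow> (\<forall>us f g p vs. G (us @ (f + T g, p) # vs) = G (us @ (f, p) # vs) + U (G (us @ (g, p) # vs)))"

definition scalar :: "('a \<Rightarrow> 'a) \<Rightarrow> ('w \<Rightarrow> 'w) \<Rightarrow> bool" where
  "scalar T U \<longleftrightarrow> (\<forall>v w. U (v + w) = U v + U w) \<and>
     (\<forall>p a b. br p (T a) b = T (br p a b) \<and> br p a (T b) = T (br p a b)) \<and>
     (\<forall>p a b. mu p (T a) b = T (mu p a b) \<and> mu p a (T b) = T (mu p a b)) \<and>
     (\<forall>p a v. la p (T a) v = U (la p a v) \<and> la p a (U v) = U (la p a v)) \<and>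
     (\<forall>p a v. lc p (T a) v = U (lc p a v) \<and> lc p a (U v) = U (lc p a v)) \<and>
     (\<forall>p a v. rc p (U v) a = U (rc p v a) \<and> rc p v (T a) = U (rc p v a))"

lemma SlotlinD: "Slotlin T U G \<Longrightarrow> G (us @ (f + T g, p) # vs) = G (us @ (f, p) # vs) + U (G (us @ (g, p) # vs))"
  by (simp add: Slotlin_def)
lemma SlotlinD1: "Slotlin T U G \<Longrightarrow> G ((f + T g, p) # vs) = G ((f, p) # vs) + U (G ((g, p) # vs))"
  using SlotlinD[of T U G "[]"] by simp
lemma Slotlin_Cons: "Slotlin T U G \<Longrightarrow> Slotlin T U (\<lambda>t. G (x # t))"
  unfolding Slotlin_def by (metis append_Cons)

context
  fixes T :: "'a \<Rightarrow> 'a" and U :: "'w \<Rightarrow> 'w"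
  assumes TU: "scalar T U"
begin

lemma U_add: "U (v + w) = U v + U w" using TU by (simp add: scalar_def)
lemma U_0 [simp]: "U 0 = 0" using U_add[of 0 0] by simp
lemma U_minus: "U (- v) = - U v" using U_add[of v "- v"] by (simp add: eq_neg_iff_add_eq_0 add.commute)
lemma U_diff: "U (v - w) = U v - U w" using U_add[of v "- w"] by (simp add: U_minus)

lemma bra_slotlin: "bra x (f + T g, p) = (fst (bra x (f, p)) + T (fst (bra x (g, p))), snd x + p)"
  "bra (f + T g, p) x = (fst (bra (f, p) x) + T (fst (bra (g, p) x)), p + snd x)"
  using TU by (simp_all add: bra_def scalar_def br_add1 br_add2)
lemma mul_slotlin: "mul x (f + T g, p) = (fst (mul x (f, p)) + T (fst (mul x (g, p))), snd x + p)"
  "mul (f + T g, p) x = (fst (mul (f, p) x) + T (fst (mul (g, p) x)), p + snd x)"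
  using TU by (simp_all add: mul_def scalar_def mu_add1 mu_add2)
lemma la_slotlin: "la p (f + T g) v = la p f v + U (la p g v)" "la p f (v + U w) = la p f v + U (la p f w)"
  using TU by (simp_all add: scalar_def la_add1 la_add2)
lemma lc_slotlin: "lc p (f + T g) v = lc p f v + U (lc p g v)" "lc p f (v + U w) = lc p f v + U (lc p f w)"
  using TU by (simp_all add: scalar_def lc_add1 lc_add2)
lemma rc_slotlin: "rc p v (f + T g) = rc p v f + U (rc p v g)" "rc p (v + U w) f = rc p v f + U (rc p w f)"
  using TU by (simp_all add: scalar_def rc_add1 rc_add2)

lemma ad_sum_U: "ad_sum x (\<lambda>t. G t + U (G' t)) ss = ad_sum x G ss + U (ad_sum x G' ss)"
  by (induction ss arbitrary: G G') (simp_all add: U_add add_ac)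
lemma Lie_U: "Lie x (\<lambda>t. G t + U (G' t)) ss = Lie x G ss + U (Lie x G' ss)"
  by (simp add: Lie_def ad_sum_U la_slotlin U_diff)
lemma CE_U: "CE m (\<lambda>t. G t + U (G' t)) ss = CE m G ss + U (CE m G' ss)"
  by (induction m G ss arbitrary: G' rule: CE.induct) (simp_all add: Lie_U U_diff)
lemma Hbar_U: "Hbar q (\<lambda>t. G t + U (G' t)) ss = Hbar q G ss + U (Hbar q G' ss)"
  by (induction q G ss arbitrary: G' rule: Hbar.induct) (simp_all add: rc_slotlin U_add U_diff U_minus)
lemma Hoch_U: "Hoch q m (\<lambda>t. G t + U (G' t)) ss = Hoch q m G ss + U (Hoch q m G' ss)"
  by (induction q m G ss arbitrary: G' rule: Hoch.induct) (simp_all add: Hbar_U lc_slotlin U_add)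

lemma Slotlin_ad_sum: "Slotlin T U G \<Longrightarrow> Slotlin T U (ad_sum x G)"
  unfolding Slotlin_def[of _ _ "ad_sum x G"]
proof (intro allI)
  fix us vs :: "('a \<times> 'm) list" and f g p
  show "Slotlin T U G \<Longrightarrow> ad_sum x G (us @ (f + T g, p) # vs) = ad_sum x G (us @ (f, p) # vs) + U (ad_sum x G (us @ (g, p) # vs))"
  proof (induction us arbitrary: G)
    case Nil
    have "bra x (h, p) = (fst (bra x (h, p)), snd x + p)" for h by (simp add: prod_eq_iff)
    then show ?case
      using SlotlinD1[OF Nil, of "fst (bra x (f, p))" "fst (bra x (g, p))" "snd x + p" vs]
      by (simp add: bra_slotlin SlotlinD1[OF Nil] ad_sum_U U_add add_ac)
  next
    case (Cons u us)
    then show ?case using SlotlinD[OF Cons.prems, of "bra x u # us"]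
      by (simp add: Cons.IH[OF Slotlin_Cons[OF Cons.prems]] U_add add_ac)
  qed
qed

lemma Slotlin_Lie: "Slotlin T U G \<Longrightarrow> Slotlin T U (Lie x G)"
  using Slotlin_ad_sum[of G x] unfolding Slotlin_def Lie_def by (simp add: la_slotlin U_diff)

lemma ad_sum_slotlin: "Slotlin T U G \<Longrightarrow> ad_sum (f + T g, p) G ss = ad_sum (f, p) G ss + U (ad_sum (g, p) G ss)"
proof (induction ss arbitrary: G)
  case (Cons s ss)
  have "bra (h, p) s = (fst (bra (h, p) s), p + snd s)" for h by (simp add: prod_eq_iff)
  then show ?case
    using SlotlinD1[OF Cons.prems, of "fst (bra (f, p) s)" "fst (bra (g, p) s)" "p + snd s" ss]
    by (simp add: bra_slotlin Cons.IH[OF Slotlin_Cons[OF Cons.prems]] U_add add_ac)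
qed simp

lemma Lie_slotlin: "Slotlin T U G \<Longrightarrow> Lie (f + T g, p) G ss = Lie (f, p) G ss + U (Lie (g, p) G ss)"
  by (simp add: Lie_def ad_sum_slotlin la_slotlin U_diff)

lemma Slotlin_CE: "Slotlin T U G \<Longrightarrow> Slotlin T U (CE m G)"
  unfolding Slotlin_def[of _ _ "CE m G"]
proof (intro allI)
  fix us vs :: "('a \<times> 'm) list" and f g p
  show "Slotlin T U G \<Longrightarrow> CE m G (us @ (f + T g, p) # vs) = CE m G (us @ (f, p) # vs) + U (CE m G (us @ (g, p) # vs))"
  proof (induction m arbitrary: G us)
    case (Suc m)
    show ?case
    proof (cases us)
      case Nil
      then show ?thesis
        by (simp add: Lie_slotlin[OF Suc.prems] SlotlinD1[OF Suc.prems] CE_U U_diff)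
    next
      case (Cons u us')
      then show ?thesis
        by (simp add: SlotlinD[OF Slotlin_Lie[OF Suc.prems]] Suc.IH[OF Slotlin_Cons[OF Suc.prems]] U_diff)
    qed
  qed simp
qed

lemma Slotlin_Hbar: "Slotlin T U G \<Longrightarrow> Slotlin T U (Hbar q G)"
  unfolding Slotlin_def[of _ _ "Hbar q G"]
proof (intro allI)
  fix us vs :: "('a \<times> 'm) list" and f g p
  have eta: "mul x (h, p) = (fst (mul x (h, p)), snd x + p)" "mul (h, p) x = (fst (mul (h, p) x), p + snd x)" for x h
    by (simp_all add: prod_eq_iff)
  show "Slotlin T U G \<Longrightarrow> Hbar q G (us @ (f + T g, p) # vs) = Hbar q G (us @ (f, p) # vs) + U (Hbar q G (us @ (g, p) # vs))"
  proof (induction us arbitrary: G q)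
    case Nil
    show ?case
    proof (cases vs)
      case Nil
      then show ?thesis by (simp add: rc_slotlin U_minus)
    next
      case (Cons y ss)
      then show ?thesis
        using SlotlinD1[OF Nil.prems, of "fst (mul (f, p) y)" "fst (mul (g, p) y)" "p + snd y" ss]
        by (simp add: mul_slotlin SlotlinD1[OF Nil.prems] Hbar_U U_diff U_minus eta(2)[symmetric])
    qed
  next
    case (Cons u us)
    note IH = Cons.IH[OF Slotlin_Cons[OF Cons.prems]]
    show ?case
    proof (cases us)
      case Nil
      then show ?thesis
        using SlotlinD1[OF Cons.prems, of "fst (mul u (f, p))" "fst (mul u (g, p))" "snd u + p" vs] IH[of "q + snd u" u]
        by (simp add: mul_slotlin U_diff U_minus eta(1)[symmetric])
    next
      case (Cons y us')
      then show ?thesis using SlotlinD[OF Cons.prems, of "mul u y # us'"] IH[of "q + snd u" u]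
        by (simp add: U_diff U_minus)
    qed
  qed
qed

lemma Slotlin_Hoch: "Slotlin T U G \<Longrightarrow> Slotlin T U (Hoch q m G)"
  unfolding Slotlin_def[of _ _ "Hoch q m G"]
proof (intro allI)
  fix us vs :: "('a \<times> 'm) list" and f g p
  show "Slotlin T U G \<Longrightarrow> Hoch q m G (us @ (f + T g, p) # vs) = Hoch q m G (us @ (f, p) # vs) + U (Hoch q m G (us @ (g, p) # vs))"
  proof (induction m arbitrary: q G us)
    case 0
    have *: "Hbar q G (us @ (f + T g, p) # vs) = Hbar q G (us @ (f, p) # vs) + U (Hbar q G (us @ (g, p) # vs))"
      by (rule SlotlinD[OF Slotlin_Hbar[OF 0]])
    show ?case
      using * by (cases us) (simp_all add: lc_slotlin U_add SlotlinD[OF 0] add_ac)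
  next
    case (Suc m)
    show ?case
      by (cases us) (simp_all add: Hoch_U SlotlinD1[OF Suc.prems] Suc.IH[OF Slotlin_Cons[OF Suc.prems]])
  qed
qed

end

text \<open>A triple of maps that respects all operations, as substitutions for the indeterminates do.\<close>
definition endo :: "('a \<Rightarrow> 'a) \<Rightarrow> ('m \<Rightarrow> 'm) \<Rightarrow> ('w \<Rightarrow> 'w) \<Rightarrow> bool" where
  "endo T t U \<longleftrightarrow> (\<forall>v w. U (v - w) = U v - U w) \<and> (\<forall>p q. t (p + q) = t p + t q) \<and>
     (\<forall>p a b. T (br p a b) = br (t p) (T a) (T b)) \<and> (\<forall>p a b. T (mu p a b) = mu (t p) (T a) (T b)) \<and>
     (\<forall>p a v. U (la p a v) = la (t p) (T a) (U v)) \<and> (\<forall>p a v. U (lc p a v) = lc (t p) (T a) (U v)) \<and>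
     (\<forall>p a v. U (rc p v a) = rc (t p) (U v) (T a))"

definition Natural :: "('a \<Rightarrow> 'a) \<Rightarrow> ('m \<Rightarrow> 'm) \<Rightarrow> ('w \<Rightarrow> 'w) \<Rightarrow> (('a \<times> 'm) list \<Rightarrow> 'w) \<Rightarrow> bool" where
  "Natural T t U G \<longleftrightarrow> (\<forall>ss. U (G ss) = G (map (map_prod T t) ss))"

context
  fixes T :: "'a \<Rightarrow> 'a" and t :: "'m \<Rightarrow> 'm" and U :: "'w \<Rightarrow> 'w"
  assumes TtU: "endo T t U"
begin

lemma endo_diff: "U (v - w) = U v - U w" using TtU by (simp add: endo_def)
lemma endo_0 [simp]: "U 0 = 0" using endo_diff[of 0 0] by simp
lemma endo_minus: "U (- v) = - U v" using endo_diff[of 0 v] by simp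
lemma endo_add: "U (v + w) = U v + U w" using endo_diff[of v "- w"] by (simp add: endo_minus)
lemma endo_bra: "map_prod T t (bra x y) = bra (map_prod T t x) (map_prod T t y)"
  using TtU by (cases x; cases y) (simp add: endo_def bra_def)
lemma endo_mul: "map_prod T t (mul x y) = mul (map_prod T t x) (map_prod T t y)"
  using TtU by (cases x; cases y) (simp add: endo_def mul_def)
lemma endo_act: "U (la p a v) = la (t p) (T a) (U v)" "U (lc p a v) = lc (t p) (T a) (U v)"
   "U (rc p v a) = rc (t p) (U v) (T a)" "t (p + q) = t p + t q"
  using TtU by (simp_all add: endo_def)

lemma endo_ad_sum: "(\<And>ss. U (G ss) = G' (map (map_prod T t) ss)) \<Longrightarrow> U (ad_sum x G ss) = ad_sum (map_prod T t x) G' (map (map_prod T t) ss)"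
proof (induction ss arbitrary: G G')
  case (Cons s ss)
  then show ?case using Cons.IH[of "\<lambda>t. G (s # t)" "\<lambda>u. G' (map_prod T t s # u)"]
    by (simp add: endo_add Cons.prems endo_bra)
qed simp

lemma endo_Lie: "(\<And>ss. U (G ss) = G' (map (map_prod T t) ss)) \<Longrightarrow> U (Lie x G ss) = Lie (map_prod T t x) G' (map (map_prod T t) ss)"
  by (simp add: Lie_def endo_diff endo_act endo_ad_sum)

lemma endo_CE: "(\<And>ss. U (G ss) = G' (map (map_prod T t) ss)) \<Longrightarrow> U (CE m G ss) = CE m G' (map (map_prod T t) ss)"
proof (induction m G ss arbitrary: G' rule: CE.induct)
  case (3 m G x ss)
  have "U (CE m (\<lambda>u. G (x # u)) ss) = CE m (\<lambda>u. G' (map_prod T t x # u)) (map (map_prod T t) ss)"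
    by (rule "3.IH") (simp add: "3.prems")
  then show ?case by (simp add: endo_diff endo_Lie[of G G', OF "3.prems"])
qed simp_all

lemma endo_Hbar: "(\<And>ss. U (G ss) = G' (map (map_prod T t) ss)) \<Longrightarrow> U (Hbar q G ss) = Hbar (t q) G' (map (map_prod T t) ss)"
proof (induction q G ss arbitrary: G' rule: Hbar.induct)
  case (3 q G x y ss)
  have "U (Hbar (q + snd x) (\<lambda>u. G (x # u)) (y # ss))
    = Hbar (t (q + snd x)) (\<lambda>u. G' (map_prod T t x # u)) (map (map_prod T t) (y # ss))"
    by (rule "3.IH") (simp add: "3.prems")
  then show ?case by (simp add: endo_diff endo_minus endo_act "3.prems" endo_mul)
qed (simp_all add: endo_minus endo_act)

lemma endo_Hoch: "(\<And>ss. U (G ss) = G' (map (map_prod T t) ss)) \<Longrightarrow> U (Hoch q m G ss) = Hoch (t q) m G' (map (map_prod T t) ss)"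
proof (induction q m G ss arbitrary: G' rule: Hoch.induct)
  case (2 q G x ss)
  show ?case using endo_Hbar[of G G' q "x # ss", OF "2"] by (simp add: endo_add endo_act "2")
next
  case (3 q m G x ss)
  have "U (Hoch (q + snd x) m (\<lambda>u. G (x # u)) ss)
    = Hoch (t (q + snd x)) m (\<lambda>u. G' (map_prod T t x # u)) (map (map_prod T t) ss)"
    by (rule "3.IH") (simp add: "3.prems")
  then show ?case by (simp add: endo_act)
qed simp_all

lemma Natural_CE: "Natural T t U G \<Longrightarrow> Natural T t U (CE m G)"
  unfolding Natural_def by (intro allI endo_CE) simp
lemma Natural_Hoch: "Natural T t U G \<Longrightarrow> t q = q \<Longrightarrow> Natural T t U (Hoch q m G)"
  unfolding Natural_def using endo_Hoch[of G G q m] by simp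

end

end

section \<open>Explicit formulas for the differentials\<close>

text \<open>The sign \<open>(-1)\<^sup>i\<close> on an abelian group.\<close>
definition sg :: "nat \<Rightarrow> 'w::ab_group_add \<Rightarrow> 'w" where
  "sg i v = (if even i then v else - v)"

lemma sg_0 [simp]: "sg 0 v = v" by (simp add: sg_def)
lemma sg_Suc: "sg (Suc i) v = - sg i v" by (simp add: sg_def)
lemma sg_zero [simp]: "sg i 0 = 0" by (simp add: sg_def)

lemma sg_add: "sg i (v + w) = sg i v + sg i w" by (simp add: sg_def)
lemma sg_diff: "sg i (v - w) = sg i v - sg i w" by (simp add: sg_def)
lemma sg_sum: "sg i (sum f I) = (\<Sum>j\<in>I. sg i (f j))" by (simp add: sg_def sum_negf)

definition omit :: "nat \<Rightarrow> 'b list \<Rightarrow> 'b list" where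
  "omit i ss = take i ss @ drop (Suc i) ss"

lemma omit_0 [simp]: "omit 0 (x # ss) = ss" by (simp add: omit_def)
lemma omit_Suc [simp]: "omit (Suc i) (x # ss) = x # omit i ss" by (simp add: omit_def)

definition omit2 :: "nat \<Rightarrow> nat \<Rightarrow> 'b list \<Rightarrow> 'b list" where
  "omit2 i j ss = take i ss @ drop (Suc i) (take j ss) @ drop (Suc j) ss"

lemma omit_update:
  assumes "i < j" "j < length ss"
  shows "omit i (ss[j := b]) = (take i ss @ drop (Suc i) (take j ss)) @ b # drop (Suc j) ss"
proof -
  have "ss[j := b] = take j ss @ b # drop (Suc j) ss"
    using assms by (rule_tac upd_conv_take_nth_drop)
  then show ?thesis using assms by (simp add: omit_def min_def drop_Cons')
qed

lemma sum_triangle_swap: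
  fixes f :: "nat \<Rightarrow> nat \<Rightarrow> 'w::comm_monoid_add"
  shows "(\<Sum>j<m. \<Sum>i<j. f i j) = (\<Sum>i<m. \<Sum>j\<in>{Suc i..<m}. f i j)"
proof (induction m)
  case (Suc m)
  have "(\<Sum>i<Suc m. \<Sum>j\<in>{Suc i..<Suc m}. f i j) = (\<Sum>i<m. (\<Sum>j\<in>{Suc i..<m}. f i j) + f i m)"
    by simp
  then show ?case by (simp add: Suc sum.distrib)
qed simp

context momentum_poisson
begin

definition eqv :: "'m \<Rightarrow> 'w \<Rightarrow> 'w \<Rightarrow> bool" where "eqv q v w \<longleftrightarrow> v - w \<in> ZW q"

lemma eqv_refl [simp, intro]: "eqv q v v" by (simp add: eqv_def ZW_0)
lemma eqv_sym: "eqv q v w \<Longrightarrow> eqv q w v" using ZW_minus[of "v - w" q] by (simp add: eqv_def)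
lemma eqv_trans [trans]: "eqv q u v \<Longrightarrow> eqv q v w \<Longrightarrow> eqv q u w"
  using ZW_add[of "u - v" q "v - w"] by (simp add: eqv_def)
lemma eqv_add: "eqv q v w \<Longrightarrow> eqv q v' w' \<Longrightarrow> eqv q (v + v') (w + w')"
  using ZW_add[of "v - w" q "v' - w'"] by (simp add: eqv_def algebra_simps)
lemma eqv_minus: "eqv q v w \<Longrightarrow> eqv q (- v) (- w)"
  using ZW_minus[of "v - w" q] by (simp add: eqv_def algebra_simps)

lemma eqv_sg: "eqv q v w \<Longrightarrow> eqv q (sg i v) (sg i w)"
  by (simp add: sg_def eqv_minus)
lemma eqv_sum: "(\<And>i. i \<in> I \<Longrightarrow> eqv q (f i) (g i)) \<Longrightarrow> eqv q (sum f I) (sum g I)"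
  by (induction I rule: infinite_finite_induct) (auto intro: eqv_add)
lemma eqv_0: "eqv q v 0 \<longleftrightarrow> v \<in> ZW q" by (simp add: eqv_def)

lemma ad_sum_explicit: "ad_sum x G ss = (\<Sum>j<length ss. G (ss[j := bra x (ss ! j)]))"
  by (induction ss arbitrary: G) (simp_all add: sum.lessThan_Suc_shift del: sum.lessThan_Suc)

lemma CE_explicit: "m \<le> length ss \<Longrightarrow> CE m G ss = (\<Sum>i<m. sg i (sact (ss ! i) (G (omit i ss))
    - (\<Sum>j\<in>{Suc i..<length ss}. G (omit i (ss[j := bra (ss ! i) (ss ! j)])))))"
proof (induction m G ss rule: CE.induct)
  case (3 m G x ss)
  have "ad_sum x G ss = (\<Sum>j\<in>{Suc 0..<Suc (length ss)}. G (omit 0 ((x # ss)[j := bra x ((x # ss) ! j)])))"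
    unfolding ad_sum_explicit sum.shift_bounds_Suc_ivl by (simp add: atLeast0LessThan)
  then have Lie: "Lie x G ss = sg 0 (sact x (G (omit 0 (x # ss)))
    - (\<Sum>j\<in>{Suc 0..<Suc (length ss)}. G (omit 0 ((x # ss)[j := bra x ((x # ss) ! j)]))))"
    by (simp add: Lie_def)
  have "CE m (\<lambda>t. G (x # t)) ss = (\<Sum>i<m. sg i (sact (ss ! i) (G (x # omit i ss))
    - (\<Sum>j\<in>{Suc i..<length ss}. G (x # omit i (ss[j := bra (ss ! i) (ss ! j)])))))"
    using "3" by simp
  then show ?case
    unfolding CE.simps Lie by (subst sum.lessThan_Suc_shift) (simp add: sum.shift_bounds_Suc_ivl sg_Suc sum_negf del: sum.op_ivl_Suc sum.lessThan_Suc)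
qed simp_all

lemma Hbar_explicit: "length ss = Suc n \<Longrightarrow> Hbar q G ss =
    (\<Sum>i<n. sg (Suc i) (G (take i ss @ mul (ss ! i) (ss ! Suc i) # drop (Suc (Suc i)) ss)))
    + sg (Suc n) (srmul (q + tot (take n ss)) (G (take n ss)) (ss ! n))"
proof (induction q G ss arbitrary: n rule: Hbar.induct)
  case (3 q G x y ss)
  obtain k where n: "n = Suc k" using "3.prems" by (cases n) auto
  show ?case
    using "3.IH"[of k] "3.prems" unfolding n
    by (subst sum.lessThan_Suc_shift) (simp add: sg_Suc sum_negf add_ac)
qed (auto simp: sg_Suc)

lemma Hoch_explicit: "length ss = m + n + 1 \<Longrightarrow> Hoch q m G ss =
    slmul (ss ! m) (G (omit m ss))
    + (\<Sum>i\<in>{1..n}. sg i (G (take (m + i - 1) ss @ mul (ss ! (m + i - 1)) (ss ! (m + i)) # drop (m + i + 1) ss)))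
    + sg (n + 1) (srmul (q + tot (take (m + n) ss)) (G (take (m + n) ss)) (ss ! (m + n)))"
proof (induction q m G ss rule: Hoch.induct)
  case (2 q G x ss)
  have *: "(\<Sum>i\<in>{1..n}. f i) = (\<Sum>i<n. f (Suc i))" for f :: "nat \<Rightarrow> 'w"
    by (simp add: sum.atLeast1_atMost_eq)
  show ?case
    using Hbar_explicit[of "x # ss" n q G] "2" unfolding * by (simp add: add_ac)
next
  case (3 q m G x ss)
  have "(\<Sum>i\<in>{1..n}. sg i (G (x # take (m + i - 1) ss @ mul (ss ! (m + i - 1)) (ss ! (m + i)) # drop (m + i + 1) ss)))
    = (\<Sum>i\<in>{1..n}. sg i (G (take (Suc m + i - 1) (x # ss) @ mul ((x # ss) ! (Suc m + i - 1)) ((x # ss) ! (Suc m + i)) # drop (Suc m + i + 1) (x # ss))))"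
    by (rule sum.cong) (auto simp: nth_Cons' take_Cons')
  then show ?case using "3" by (simp add: add_ac)
qed simp

lemma Hoch_cong: "(\<And>t. Suc (length t) = length ss \<Longrightarrow> G t = G' t) \<Longrightarrow> Hoch q m G ss = Hoch q m G' ss"
proof (induction q m G ss arbitrary: G' rule: Hoch.induct)
  case (2 q G x ss)
  then show ?case using Hbar_cong[of "x # ss" G G' q] by simp
next
  case (3 q m G x ss)
  have "Hoch (q + snd x) m (\<lambda>t. G (x # t)) ss = Hoch (q + snd x) m (\<lambda>t. G' (x # t)) ss"
    by (rule "3.IH") (simp add: "3.prems")
  then show ?case by simp
qed simp

definition last_acts :: "(('a \<times> 'm) list \<Rightarrow> 'w) \<Rightarrow> ('a \<times> 'm) list \<Rightarrow> 'w" where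
  "last_acts G ss = sact (last ss) (G (butlast ss))"

text \<open>The sum defining the differential, split at the term in which the last argument acts.\<close>
lemma CE_last: "length ss = Suc k \<Longrightarrow> CE (Suc k) G ss = CE k G ss + sg k (last_acts G ss)"
proof (induction k arbitrary: G ss)
  case 0
  then show ?case by (cases ss) (simp_all add: Lie_def last_acts_def)
next
  case (Suc k)
  obtain x t where ss: "ss = x # t" "length t = Suc k" using Suc.prems by (cases ss) auto
  then have "last_acts G ss = last_acts (\<lambda>t. G (x # t)) t" by (auto simp: last_acts_def)
  then show ?case
    using Suc.IH[of t "\<lambda>t. G (x # t)"] ss by (simp add: CE.simps(3)[of "Suc k"] CE.simps(3)[of k] sg_Suc del: CE.simps)
qed

text \<open>\<open>a \<mapsto> a \<cdot> v\<close> is a derivation up to equality at the total momentum, by \<open>la_mu\<close>.\<close>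
lemma Hoch_last_acts: "length ss = k + 2 \<Longrightarrow> Hoch q k (last_acts G) ss \<in> ZW (q + tot ss)"
proof (induction k arbitrary: q G ss)
  case 0
  then obtain a b where ss: "ss = [a, b]" by (auto simp: length_Suc_conv eval_nat_numeral)
  have "Hoch q 0 (last_acts G) ss = - (la (snd a + snd b) (mu (snd a) (fst a) (fst b)) (G [])
    - (lc (snd a) (fst a) (la (snd b) (fst b) (G [])) + rc (snd a + q) (la (snd a) (fst a) (G [])) (fst b)))"
    by (simp add: ss last_acts_def mul_def add_ac)
  moreover have "\<dots> \<in> ZW (q + tot ss)"
    using ZW_minus[OF la_mu[of "snd a" "snd b" "fst a" "fst b" "G []" q]] by (simp add: ss add_ac)
  ultimately show ?case by simp
next
  case (Suc k)
  obtain x t where ss: "ss = x # t" "length t = k + 2" using Suc.prems by (cases ss) auto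
  have "Hoch (q + snd x) k (\<lambda>t. last_acts G (x # t)) t = Hoch (q + snd x) k (last_acts (\<lambda>t. G (x # t))) t"
    by (rule Hoch_cong) (use ss in \<open>auto simp: last_acts_def\<close>)
  then show ?case using Suc.IH[of t "q + snd x" "\<lambda>t. G (x # t)"] ss by (simp add: add_ac)
qed

text \<open>This makes the complex with the columns \<open>n = 0\<close> and \<open>n \<ge> 2\<close> work: after \<open>d\<^sub>H\<close> it does not matter whether
  \<open>d\<^sub>C\<^sub>E\<close> was formed as for \<open>C\<^sup>k\<^sup>+\<^sup>1\<^sup>,\<^sup>0\<close> or as for \<open>C\<^sup>k\<^sup>,\<^sup>1\<close>.\<close>
lemma Hoch_CE_last:
  assumes "length ss = k + 2"
  shows "eqv (q + tot ss) (Hoch q k (CE (Suc k) G) ss) (Hoch q k (CE k G) ss)"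
proof -
  have "Hoch q k (CE (Suc k) G) ss = Hoch q k (\<lambda>t. CE k G t + sg k (last_acts G t)) ss"
    by (rule Hoch_cong) (simp add: CE_last assms)
  also have "\<dots> = Hoch q k (CE k G) ss + sg k (Hoch q k (last_acts G) ss)"
    by (simp add: Hoch_add) (simp add: sg_def Hoch_minus)
  finally show ?thesis
    using eqv_sg[of "q + tot ss" "Hoch q k (last_acts G) ss" 0 k] Hoch_last_acts[OF assms, of q G]
    by (simp add: eqv_0) (simp add: eqv_def)
qed

lemma Alt_move:
  "Alt q m G \<Longrightarrow> length us + length vs + 1 \<le> m \<Longrightarrow>
   eqv (q + tot us + snd x + tot vs + tot ws) (G (us @ x # vs @ ws)) (sg (length vs) (G (us @ vs @ x # ws)))"
proof (induction vs arbitrary: us)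
  case (Cons y vs)
  let ?q = "q + tot us + snd x + tot (y # vs) + tot ws"
  have "G (us @ x # y # vs @ ws) + G (us @ y # x # vs @ ws) \<in> ZW (q + tot us + snd x + snd y + tot (vs @ ws))"
    using Cons.prems by (intro AltD) auto
  then have "eqv ?q (G (us @ x # y # vs @ ws)) (- G (us @ y # x # vs @ ws))"
    by (simp add: eqv_def add_ac)
  also have "eqv ?q (- G (us @ y # x # vs @ ws)) (- sg (length vs) (G (us @ y # vs @ x # ws)))"
    using Cons.IH[of "us @ [y]"] Cons.prems by (intro eqv_minus) (simp add: add_ac)
  finally show ?case by (simp add: sg_Suc)
qed simp

definition CE_skew :: "nat \<Rightarrow> (('a \<times> 'm) list \<Rightarrow> 'w) \<Rightarrow> ('a \<times> 'm) list \<Rightarrow> 'w" where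
  "CE_skew m G ss = (\<Sum>i<m. sg i (sact (ss ! i) (G (omit i ss))
       - (\<Sum>j\<in>{m..<length ss}. G (omit i (ss[j := bra (ss ! i) (ss ! j)])))))
     + (\<Sum>j<m. \<Sum>i<j. sg (i + j) (G (bra (ss ! i) (ss ! j) # omit2 i j ss)))"

lemma omit_update_front:
  assumes "Alt 0 m G" "i < j" "j \<le> m" "j < length ss"
  shows "eqv (tot ss) (sg (i + j) (G (bra (ss ! i) (ss ! j) # omit2 i j ss)))
     (- sg i (G (omit i (ss[j := bra (ss ! i) (ss ! j)]))))"
proof -
  let ?b = "bra (ss ! i) (ss ! j)" and ?vs = "take i ss @ drop (Suc i) (take j ss)" and ?ws = "drop (Suc j) ss"
  have "ss = take i ss @ ss ! i # drop (Suc i) (take j ss) @ ss ! j # ?ws"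
    using assms id_take_nth_drop[of j ss] id_take_nth_drop[of i "take j ss"]
    by (simp add: min_def) (metis append.assoc append_Cons)
  then have tot: "tot ss = snd ?b + tot ?vs + tot ?ws"
    using arg_cong[of ss _ tot] by (metis (no_types, lifting) add.assoc add.left_commute snd_bra tot_simps(2,3))
  have len: "length ?vs = j - 1" using assms by auto
  have "eqv (0 + tot [] + snd ?b + tot ?vs + tot ?ws) (G ([] @ ?b # ?vs @ ?ws)) (sg (length ?vs) (G ([] @ ?vs @ ?b # ?ws)))"
    using assms len by (intro Alt_move) auto
  then have "eqv (tot ss) (G (?b # omit2 i j ss)) (sg (j - 1) (G (omit i (ss[j := ?b]))))"
    using tot len assms by (simp add: omit2_def omit_update)
  then have "eqv (tot ss) (sg (i + j) (G (?b # omit2 i j ss))) (sg (i + j) (sg (j - 1) (G (omit i (ss[j := ?b])))))"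
    by (rule eqv_sg)
  also have "sg (i + j) (sg (j - 1) v) = - sg i v" for v :: 'w
    using assms by (auto simp: sg_def)
  finally show ?thesis .
qed

text \<open>The usual formula puts \<open>[x\<^sub>i, x\<^sub>j]\<close> in front. Moving it back to the place of \<open>x\<^sub>j\<close>, past the \<open>j - 1\<close> remaining
  arguments before it, changes the sign from \<open>(-1)\<^sup>i\<^sup>+\<^sup>j\<close> to \<open>- (-1)\<^sup>i\<close>.\<close>
lemma CE_skew_eqv:
  assumes "Alt 0 m G" "Suc m \<le> length ss"
  shows "eqv (tot ss) (CE_skew (Suc m) G ss) (CE (Suc m) G ss)"
proof -
  have "eqv (tot ss) (\<Sum>j<Suc m. \<Sum>i<j. sg (i + j) (G (bra (ss ! i) (ss ! j) # omit2 i j ss)))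
     (\<Sum>j<Suc m. \<Sum>i<j. - sg i (G (omit i (ss[j := bra (ss ! i) (ss ! j)]))))"
    by (intro eqv_sum omit_update_front assms) (use assms in auto)
  then have "eqv (tot ss) (CE_skew (Suc m) G ss) ((\<Sum>i<Suc m. sg i (sact (ss ! i) (G (omit i ss))
       - (\<Sum>j\<in>{Suc m..<length ss}. G (omit i (ss[j := bra (ss ! i) (ss ! j)])))))
     + (\<Sum>i<Suc m. \<Sum>j\<in>{Suc i..<Suc m}. - sg i (G (omit i (ss[j := bra (ss ! i) (ss ! j)])))))"
    unfolding CE_skew_def sum_triangle_swap by (intro eqv_add eqv_refl)
  also have "\<dots> = CE (Suc m) G ss"
    unfolding CE_explicit[OF assms(2)] sum.distrib[symmetric]
  proof (rule sum.cong)
    fix i assume "i \<in> {..<Suc m}"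
    then have "(\<Sum>j\<in>{Suc i..<length ss}. g j) = (\<Sum>j\<in>{Suc i..<Suc m}. g j) + (\<Sum>j\<in>{Suc m..<length ss}. g j)" for g :: "nat \<Rightarrow> 'w"
      using assms by (intro sum.atLeastLessThan_concat[symmetric]) auto
    then show "sg i (sact (ss ! i) (G (omit i ss)) - (\<Sum>j\<in>{Suc m..<length ss}. G (omit i (ss[j := bra (ss ! i) (ss ! j)]))))
       + (\<Sum>j\<in>{Suc i..<Suc m}. - sg i (G (omit i (ss[j := bra (ss ! i) (ss ! j)]))))
      = sg i (sact (ss ! i) (G (omit i ss)) - (\<Sum>j\<in>{Suc i..<length ss}. G (omit i (ss[j := bra (ss ! i) (ss ! j)]))))"
      by (simp add: sg_diff sg_add sg_sum sum_negf algebra_simps del: sum.op_ivl_Suc sum.lessThan_Suc)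
  qed simp
  finally show ?thesis .
qed

text \<open>The formula for \<open>n = 0\<close>, where the last argument takes part in the alternation.\<close>
definition CE_full :: "nat \<Rightarrow> (('a \<times> 'm) list \<Rightarrow> 'w) \<Rightarrow> ('a \<times> 'm) list \<Rightarrow> 'w" where
  "CE_full k G ss = (\<Sum>i<k. sg i (sact (ss ! i) (G (omit i ss))))
     + (\<Sum>j<k. \<Sum>i<j. sg (k + i + j + 1) (G (omit2 i j (take k ss) @ [ss ! k, bra (ss ! i) (ss ! j)])))
     + sg k (sact (ss ! k) (G (take k ss)))
     + (\<Sum>i<k. sg (i + 1) (G (omit i (take k ss) @ [bra (ss ! i) (ss ! k)])))"

lemma omit_update_back:
  assumes "Alt 0 k G" "i < j" "j < k" "length ss = Suc k"
  shows "eqv (tot ss) (sg (k + i + j + 1) (G (omit2 i j (take k ss) @ [ss ! k, bra (ss ! i) (ss ! j)])))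
     (- sg i (G (omit i (ss[j := bra (ss ! i) (ss ! j)]))))"
proof -
  let ?b = "bra (ss ! i) (ss ! j)" and ?us = "take i ss @ drop (Suc i) (take j ss)" and ?vs = "drop (Suc j) ss"
  have vs: "?vs = drop (Suc j) (take k ss) @ [ss ! k]"
  proof -
    have "ss = take k ss @ [ss ! k]" using assms(4) take_Suc_conv_app_nth[of k ss] by simp
    then have "?vs = drop (Suc j) (take k ss @ [ss ! k])" by (rule arg_cong)
    then show ?thesis using assms by simp
  qed
  have "ss = take i ss @ ss ! i # drop (Suc i) (take j ss) @ ss ! j # ?vs"
    using assms id_take_nth_drop[of j ss] id_take_nth_drop[of i "take j ss"]
    by (simp add: min_def) (metis append.assoc append_Cons)
  then have tot: "tot ss = tot ?us + snd ?b + tot ?vs"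
    using arg_cong[of ss _ tot] by (metis (no_types, lifting) add.assoc add.left_commute snd_bra tot_simps(2,3))
  have "eqv (0 + tot ?us + snd ?b + tot ?vs + tot []) (G (?us @ ?b # ?vs @ [])) (sg (length ?vs) (G (?us @ ?vs @ ?b # [])))"
    using assms by (intro Alt_move) auto
  then have "eqv (tot ss) (G (?us @ ?b # ?vs)) (sg (k - j) (G (?us @ ?vs @ [?b])))"
    using assms tot by simp
  moreover have "omit i (ss[j := ?b]) = ?us @ ?b # ?vs"
    using assms by (simp add: omit_update)
  moreover have "omit2 i j (take k ss) @ [ss ! k, ?b] = ?us @ ?vs @ [?b]"
    using assms by (simp add: omit2_def vs min_def)
  ultimately have "eqv (tot ss) (G (omit i (ss[j := ?b]))) (sg (k - j) (G (omit2 i j (take k ss) @ [ss ! k, ?b])))"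
    by (simp only:)
  then have "eqv (tot ss) (- sg i (G (omit i (ss[j := ?b])))) (- sg i (sg (k - j) (G (omit2 i j (take k ss) @ [ss ! k, ?b]))))"
    by (intro eqv_minus eqv_sg)
  also have "- sg i (sg (k - j) v) = sg (k + i + j + 1) v" for v :: 'w
    using assms by (auto simp: sg_def)
  finally show ?thesis by (rule eqv_sym)
qed

text \<open>Here the brackets stand at the end, and the argument \<open>x\<^sub>k\<close> is one of the \<open>k - j\<close> arguments that they
  have to pass.\<close>
lemma CE_full_eqv:
  assumes "Alt 0 k G" "length ss = Suc k"
  shows "eqv (tot ss) (CE_full k G ss) (CE (Suc k) G ss)"
proof -
  have 1: "eqv (tot ss) (\<Sum>j<k. \<Sum>i<j. sg (k + i + j + 1) (G (omit2 i j (take k ss) @ [ss ! k, bra (ss ! i) (ss ! j)])))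
     (\<Sum>j<k. \<Sum>i<j. - sg i (G (omit i (ss[j := bra (ss ! i) (ss ! j)]))))"
    by (intro eqv_sum omit_update_back assms) (use assms in auto)
  have last: "omit i (ss[k := b]) = omit i (take k ss) @ [b]" if "i < k" for i b
    using assms that by (subst omit_update) (auto simp: omit_def min_def)
  have "eqv (tot ss) (CE_full k G ss) ((\<Sum>i<k. sg i (sact (ss ! i) (G (omit i ss))))
     + (\<Sum>i<k. \<Sum>j\<in>{Suc i..<k}. - sg i (G (omit i (ss[j := bra (ss ! i) (ss ! j)]))))
     + sg k (sact (ss ! k) (G (take k ss)))
     + (\<Sum>i<k. sg (i + 1) (G (omit i (take k ss) @ [bra (ss ! i) (ss ! k)]))))"
    unfolding CE_full_def by (intro eqv_add eqv_refl) (use 1 in \<open>simp only: sum_triangle_swap\<close>)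
  also have "\<dots> = (\<Sum>i<k. sg i (sact (ss ! i) (G (omit i ss)))
     + (\<Sum>j\<in>{Suc i..<k}. - sg i (G (omit i (ss[j := bra (ss ! i) (ss ! j)]))))
     + sg (i + 1) (G (omit i (take k ss) @ [bra (ss ! i) (ss ! k)])))
     + sg k (sact (ss ! k) (G (take k ss)))"
    by (simp add: sum.distrib algebra_simps)
  also have "\<dots> = (\<Sum>i<k. sg i (sact (ss ! i) (G (omit i ss))
      - (\<Sum>j\<in>{Suc i..<length ss}. G (omit i (ss[j := bra (ss ! i) (ss ! j)])))))
     + sg k (sact (ss ! k) (G (take k ss)))"
    using assms by (intro arg_cong2[where f = "(+)"] sum.cong refl)
      (simp add: last sg_diff sg_add sg_sum sg_Suc sum_negf algebra_simps)
  also have "\<dots> = CE (Suc k) G ss"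
    using assms by (subst CE_explicit) (simp_all add: omit_def)
  finally show ?thesis .
qed

lemma tot_permute: "\<sigma> permutes {..<length ss} \<Longrightarrow> tot (permute_list \<sigma> ss) = tot ss"
  unfolding tot_def by (metis mset_map mset_permute_list sum_mset_sum_list)

lemma permute_list_adjacent:
  "permute_list (Transposition.transpose (length us) (Suc (length us))) (us @ x # y # vs) = us @ y # x # vs"
proof (rule nth_equalityI)
  fix j assume j: "j < length (permute_list (Transposition.transpose (length us) (Suc (length us))) (us @ x # y # vs))"
  consider "j < length us" | "j = length us" | "j = Suc (length us)" | k where "j = Suc (Suc (length us)) + k"
    by (metis less_Suc_eq not_less less_eqE Suc_leI)
  then show "permute_list (Transposition.transpose (length us) (Suc (length us))) (us @ x # y # vs) ! j = (us @ y # x # vs) ! j"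
    using j by cases (simp_all add: permute_list_def Transposition.transpose_def nth_append del: upt_Suc)
qed simp

text \<open>The action of a sign \<open>e = 1\<close> or \<open>e = -1\<close>, as returned by \<^const>\<open>sign\<close>.\<close>
definition sgs :: "int \<Rightarrow> 'w \<Rightarrow> 'w" where "sgs e v = (if e = 1 then v else - v)"

lemma eqv_sgs: "eqv q v w \<Longrightarrow> eqv q (sgs e v) (sgs e w)"
  by (simp add: sgs_def eqv_minus)

text \<open>Every permutation is a product of transpositions of neighbours.\<close>
lemma Alt_permute:
  assumes "Alt 0 m G" "\<sigma> permutes {..<m}" "m \<le> length ss"
  shows "eqv (tot ss) (G (permute_list \<sigma> ss)) (sgs (sign \<sigma>) (G ss))"
proof -
  define P where "P \<sigma> \<longleftrightarrow> (\<forall>ss. m \<le> length ss \<longrightarrow> eqv (tot ss) (G (permute_list \<sigma> ss)) (sgs (sign \<sigma>) (G ss)))" for \<sigma>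
  have comp: "P (f \<circ> g)" if "P f" "P g" and p: "f permutes {..<m}" "g permutes {..<m}" for f g
    unfolding P_def
  proof (intro allI impI)
    fix ss :: "('a \<times> 'm) list" assume len: "m \<le> length ss"
    have p': "f permutes {..<length ss}" "g permutes {..<length ss}"
      using p len by (auto intro: permutes_subset)
    have s: "sign (f \<circ> g) = sign f * sign g"
      using p by (intro sign_compose permutation_permutes[THEN iffD2]) auto
    have "eqv (tot ss) (G (permute_list g (permute_list f ss))) (sgs (sign g) (G (permute_list f ss)))"
      using that(2) len p' unfolding P_def by (metis length_permute_list tot_permute)
    also have "eqv (tot ss) (sgs (sign g) (G (permute_list f ss))) (sgs (sign g) (sgs (sign f) (G ss)))"
      using that(1) len unfolding P_def by (intro eqv_sgs) auto
    also have "sgs (sign g) (sgs (sign f) (G ss)) = sgs (sign (f \<circ> g)) (G ss)"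
      unfolding s by (cases f rule: sign_cases; cases g rule: sign_cases) (auto simp: sgs_def)
    finally show "eqv (tot ss) (G (permute_list (f \<circ> g) ss)) (sgs (sign (f \<circ> g)) (G ss))"
      using p' by (simp add: permute_list_compose)
  qed
  have id: "P id" by (simp add: P_def sgs_def)
  have adj: "P (Transposition.transpose i (Suc i))" if "Suc i < m" for i
    unfolding P_def
  proof (intro allI impI)
    fix ss :: "('a \<times> 'm) list" assume len: "m \<le> length ss"
    have ss: "ss = take i ss @ ss ! i # ss ! Suc i # drop (Suc (Suc i)) ss"
      using that len by (metis Cons_nth_drop_Suc Suc_lessD id_take_nth_drop order_less_le_trans)
    have "length (take i ss) = i" using that len by simp
    then have "permute_list (Transposition.transpose i (Suc i)) ss = take i ss @ ss ! Suc i # ss ! i # drop (Suc (Suc i)) ss"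
      using permute_list_adjacent[of "take i ss" "ss ! i" "ss ! Suc i" "drop (Suc (Suc i)) ss"] ss by simp
    then have "G (permute_list (Transposition.transpose i (Suc i)) ss) + G ss \<in> ZW (0 + tot (take i ss) + snd (ss ! Suc i) + snd (ss ! i) + tot (drop (Suc (Suc i)) ss))"
      using AltD[OF assms(1), of "take i ss" "ss ! Suc i" "ss ! i" "drop (Suc (Suc i)) ss"] that len
      by (simp flip: ss)
    moreover have "tot ss = 0 + tot (take i ss) + snd (ss ! Suc i) + snd (ss ! i) + tot (drop (Suc (Suc i)) ss)"
      by (subst ss) (simp add: add_ac)
    ultimately show "eqv (tot ss) (G (permute_list (Transposition.transpose i (Suc i)) ss)) (sgs (sign (Transposition.transpose i (Suc i))) (G ss))"
      by (simp add: eqv_def sgs_def sign_swap_id)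
  qed
  have seq: "P (apply_adj_transps xs)" if "\<forall>x\<in>set xs. Suc x < m" for xs
    using that
  proof (induction xs)
    case (Cons x xs)
    have "apply_adj_transps xs permutes {..<m}"
      using Cons.prems by (intro permutes_apply_adj_transps) auto
    moreover have "Transposition.transpose x (Suc x) permutes {..<m}"
      using Cons.prems by (intro permutes_swap_id) auto
    ultimately have "P (Transposition.transpose x (Suc x) \<circ> apply_adj_transps xs)"
      using Cons by (intro comp adj) auto
    then show ?case by (simp add: o_def)
  qed (simp add: id)
  have swap: "P (Transposition.transpose a b)" if "a < m" "b < m" for a b
    using that
  proof (induction a b rule: linorder_wlog)
    case (le a b)
    show ?case
    proof (cases "a = b")
      case False
      then have "a < b" using le by simp
      then show ?thesis using seq[of "adj_transp_seq a b"] le by (auto simp: adj_transp_seq_correct set_adj_transp_seq)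
    qed (use id in \<open>simp add: id_def\<close>)
  next
    case (sym a b)
    then show ?case by (simp add: Transposition.transpose_commute)
  qed
  have "P \<sigma>"
    using assms(2) finite_lessThan[of m]
  proof (induction rule: permutes_induct)
    case (swap a b p)
    show ?case
      by (intro comp \<open>\<And>a b. a < m \<Longrightarrow> b < m \<Longrightarrow> P (Transposition.transpose a b)\<close> permutes_swap_id)
        (use swap in auto)
  qed (rule id)
  then show ?thesis using assms(3) by (simp add: P_def)
qed

end

section \<open>Polynomials with coefficients in a module\<close>

lemma pm_induct [case_names single add]:
  fixes f :: "'b \<Rightarrow>\<^sub>0 'c::ab_group_add"
  assumes single: "\<And>k v. Q (Poly_Mapping.single k v)" and add: "\<And>f g. Q f \<Longrightarrow> Q g \<Longrightarrow> Q (f + g)"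
  shows "Q f"
proof -
  have Q0: "Q 0" using single[of _ 0] by simp
  have "Q (\<Sum>k\<in>K. Poly_Mapping.single k (Poly_Mapping.lookup f k))" for K
    by (induction K rule: infinite_finite_induct) (auto intro: Q0 single add)
  moreover have "f = (\<Sum>k\<in>Poly_Mapping.keys f. Poly_Mapping.single k (Poly_Mapping.lookup f k))"
    by (rule poly_mapping_eqI) (auto simp: lookup_sum lookup_single when_def in_keys_iff)
  ultimately show ?thesis by metis
qed

lemma exponent_induct [case_names zero add_one]:
  fixes \<beta> :: "nat \<Rightarrow>\<^sub>0 nat"
  assumes zero: "Q 0" and add: "\<And>i \<beta>. Q \<beta> \<Longrightarrow> Q (Poly_Mapping.single i 1 + \<beta>)"
  shows "Q \<beta>"
proof -
  have *: "Q (Poly_Mapping.single i n + \<beta>)" if "Q \<beta>" for i n \<beta>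
    using that
  proof (induction n)
    case (Suc n)
    have "Poly_Mapping.single i (Suc n) = Poly_Mapping.single i 1 + Poly_Mapping.single i n"
      by (simp flip: single_add)
    then show ?case using add[OF Suc.IH[OF Suc.prems], of i] by (simp add: add_ac)
  qed simp
  have "Q (\<Sum>k\<in>K. Poly_Mapping.single k (Poly_Mapping.lookup \<beta> k))" for K
    by (induction K rule: infinite_finite_induct) (auto intro: zero *)
  moreover have "\<beta> = (\<Sum>k\<in>Poly_Mapping.keys \<beta>. Poly_Mapping.single k (Poly_Mapping.lookup \<beta> k))"
    by (rule poly_mapping_eqI) (auto simp: lookup_sum lookup_single when_def in_keys_iff)
  ultimately show ?thesis by metis
qed

lemma cst_add: "cst (a + b) = cst a + cst b" for a :: "'a::monoid_add" by (simp add: cst_def single_add)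
lemma cst_0 [simp]: "cst 0 = 0" by (simp add: cst_def)
lemma cst_uminus: "cst (- a) = - cst a" for a :: "'a::ab_group_add" by (simp add: cst_def single_uminus)
lemma cst_1: "cst 1 = 1" by (simp add: cst_def)

locale cmodule = module s for s :: "('a::ab_group_add) cmod"
begin

lemma act_add1: "act s (p + q) f = act s p f + act s q f"
  unfolding act_def
  by (rule setsum_keys_plus_distrib) (simp_all add: scale_left_distrib single_add sum.distrib)

lemma act_add2: "act s p (f + g) = act s p f + act s p g"
  unfolding act_def sum.distrib[symmetric]
  by (intro sum.cong refl setsum_keys_plus_distrib) (simp_all add: scale_right_distrib single_add)

lemma act_0 [simp]: "act s 0 f = 0" "act s p 0 = 0" by (simp_all add: act_def)
lemma act_minus1: "act s (- p) f = - act s p f"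
  using act_add1[of p "- p" f] by (simp add: eq_neg_iff_add_eq_0 add.commute)
lemma act_minus2: "act s p (- f) = - act s p f"
  using act_add2[of p f "- f"] by (simp add: eq_neg_iff_add_eq_0 add.commute)
lemma act_diff1: "act s (p - q) f = act s p f - act s q f"
  using act_add1[of p "- q" f] by (simp add: act_minus1)
lemma act_diff2: "act s p (f - g) = act s p f - act s p g"
  using act_add2[of p f "- g"] by (simp add: act_minus2)
lemma act_sum2: "act s p (sum f I) = (\<Sum>i\<in>I. act s p (f i))"
  by (induction I rule: infinite_finite_induct) (simp_all add: act_add2)

lemma act_single: "act s (Poly_Mapping.single \<alpha> c) (Poly_Mapping.single \<beta> v) = Poly_Mapping.single (\<alpha> + \<beta>) (s c v)"
  by (cases "c = 0"; cases "v = 0") (simp_all add: act_def)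

lemma act_mult: "act s (p * q) f = act s p (act s q f)"
proof (induction p rule: pm_induct)
  case (single \<alpha> c)
  show ?case
  proof (induction q rule: pm_induct)
    case (single \<beta> d)
    show ?case
      by (induction f rule: pm_induct) (simp_all add: act_single mult_single act_add2 add_ac)
  qed (simp add: act_add1 act_add2 distrib_left)
qed (simp add: act_add1 distrib_right)

lemma act_comm: "act s p (act s q f) = act s q (act s p f)"
  by (simp add: mult.commute flip: act_mult)

lemma act_1 [simp]: "act s 1 f = f"
proof (induction f rule: pm_induct)
  case (single \<alpha> a)
  show ?case using act_single[of 0 1 \<alpha> a] by simp
qed (simp add: act_add2)

lemma act_cst: "act s (cst c) (cst a) = cst (s c a)"
  by (simp add: cst_def act_single)
lemma act_dpar_cst: "act s dpar (cst a) = cst (del s a)"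
  by (simp add: cst_def act_single dpar_def del_def)

lemma act_var_single: "act s (var i) (Poly_Mapping.single \<beta> a) = Poly_Mapping.single (Poly_Mapping.single i 1 + \<beta>) a"
  by (simp add: var_def act_single)

lemma mpol_induct [case_names cst add var]:
  assumes "\<And>a. Q (cst a)" "\<And>f g. Q f \<Longrightarrow> Q g \<Longrightarrow> Q (f + g)" "\<And>i f. Q f \<Longrightarrow> Q (act s (var i) f)"
  shows "Q f"
proof (induction f rule: pm_induct)
  case (single \<beta> a)
  show ?case
    by (induction \<beta> rule: exponent_induct) (use assms in \<open>simp_all add: cst_def del: One_nat_def flip: act_var_single\<close>)
qed (rule assms)

text \<open>Congruences are always taken modulo a submodule: \<open>{0}\<close> gives equalities, the image of \<open>\<partial> + p\<close> gives equality at
  momentum \<open>p\<close>.\<close>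
definition submod :: "'a mpol set \<Rightarrow> bool" where
  "submod Z \<longleftrightarrow> 0 \<in> Z \<and> (\<forall>f\<in>Z. \<forall>g\<in>Z. f + g \<in> Z) \<and> (\<forall>c. \<forall>f\<in>Z. act s c f \<in> Z)"

lemma submod_0: "submod {0}" by (simp add: submod_def)
lemma submod_range: "submod (range (act s c))"
  unfolding submod_def by (auto simp: image_iff) (metis act_0(2), metis act_add2, metis act_comm)
lemma submodD: "submod Z \<Longrightarrow> 0 \<in> Z" "submod Z \<Longrightarrow> f \<in> Z \<Longrightarrow> g \<in> Z \<Longrightarrow> f + g \<in> Z" "submod Z \<Longrightarrow> f \<in> Z \<Longrightarrow> act s c f \<in> Z"
  by (auto simp: submod_def)
lemma submod_minus: "submod Z \<Longrightarrow> f \<in> Z \<Longrightarrow> - f \<in> Z"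
  using submodD(3)[of Z f "- 1"] by (simp add: act_minus1)
lemma submod_diff: "submod Z \<Longrightarrow> f \<in> Z \<Longrightarrow> g \<in> Z \<Longrightarrow> f - g \<in> Z"
  using submodD(2)[of Z f "- g"] submod_minus by simp
lemma submod_sum: "submod Z \<Longrightarrow> (\<And>i. i \<in> I \<Longrightarrow> f i \<in> Z) \<Longrightarrow> sum f I \<in> Z"
  by (induction I rule: infinite_finite_induct) (auto intro: submodD)

lemma eval1_bound: "degree f \<le> N \<Longrightarrow> eval1 s X f = (\<Sum>n\<le>N. act s (X ^ n) (cst (coeff f n)))"
  unfolding eval1_def by (rule sum.mono_neutral_left) (auto simp: coeff_eq_0)

lemma eval1_add: "eval1 s X (f + g) = eval1 s X f + eval1 s X g"
proof -
  let ?N = "max (degree f) (degree g)"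
  show ?thesis
    by (simp add: eval1_bound[of _ ?N] degree_add_le cst_add act_add2 sum.distrib)
qed
lemma eval1_0 [simp]: "eval1 s X 0 = 0" by (simp add: eval1_def)
lemma eval1_minus: "eval1 s X (- f) = - eval1 s X f"
  using eval1_add[of X f "- f"] by (simp add: eq_neg_iff_add_eq_0 add.commute)

lemma eval1_map: "eval1 s X (map_poly (s q) f) = act s (cst q) (eval1 s X f)"
  by (simp add: eval1_bound[of _ "degree f"] map_poly_degree_leq coeff_map_poly act_sum2 flip: act_cst)
    (simp add: act_comm)

lemma eval1_pCons: "eval1 s X (pCons a f) = cst a + act s X (eval1 s X f)"
proof -
  have "eval1 s X (pCons a f) = (\<Sum>n\<le>Suc (degree f). act s (X ^ n) (cst (coeff (pCons a f) n)))"
    by (rule eval1_bound) (rule degree_pCons_le)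
  then show ?thesis
    by (simp only: sum.atMost_Suc_shift) (simp add: eval1_def act_mult act_sum2)
qed

lemma eval1_dpar: "eval1 s X (map_poly (del s) f) = act s dpar (eval1 s X f)"
  using eval1_map[of X "[:0, 1:]" f] by (simp add: del_def[abs_def] dpar_def cst_def)

text \<open>\<open>X\<^sup>n - Y\<^sup>n\<close> is a multiple of \<open>X - Y\<close>.\<close>
lemma eval1_cong:
  assumes Z: "submod Z" and XY: "\<And>f. act s (X - Y) f \<in> Z"
  shows "eval1 s X f - eval1 s Y f \<in> Z"
proof (induction f)
  case (pCons a f)
  have "act s X (eval1 s X f - eval1 s Y f) + act s (X - Y) (eval1 s Y f) \<in> Z"
    using pCons by (intro submodD[OF Z] XY)
  then show ?case by (simp add: eval1_pCons act_diff1 act_diff2)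
qed (simp add: submodD[OF Z])

lemma lift_add: "(\<And>a b. g (a + b) = g a + g b) \<Longrightarrow> lift s g (f + f') = lift s g f + lift s g f'"
  for g :: "'b::ab_group_add \<Rightarrow> 'a mpol"
  unfolding lift_def
  by (rule setsum_keys_plus_distrib) (auto simp: act_add2, metis act_0(2) add_cancel_right_right)

lemma additive_0: "(\<And>a b. g (a + b) = g a + g b) \<Longrightarrow> g 0 = 0"
  for g :: "'b::ab_group_add \<Rightarrow> 'c::ab_group_add"
  by (metis add_cancel_right_right)

lemma lift_single: "(\<And>a b. g (a + b) = g a + g b) \<Longrightarrow> lift s g (Poly_Mapping.single \<beta> a) = act s (Poly_Mapping.single \<beta> 1) (g a)"
  for g :: "'b::ab_group_add \<Rightarrow> 'a mpol"
  by (cases "a = 0") (simp_all add: lift_def additive_0)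

lemma lift_cst: "(\<And>a b. g (a + b) = g a + g b) \<Longrightarrow> lift s g (cst a) = g a"
  for g :: "'b::ab_group_add \<Rightarrow> 'a mpol"
  by (simp add: cst_def lift_single)

lemma lift_add_fun: "lift s (\<lambda>a. g a + g' a) f = lift s g f + lift s g' f"
  by (simp add: lift_def act_add2 sum.distrib)
lemma lift_act_fun: "lift s (\<lambda>a. act s c (g a)) f = act s c (lift s g f)"
  by (simp add: lift_def act_sum2) (rule sum.cong, simp, rule act_comm)
lemma lift_mem: "submod Z \<Longrightarrow> (\<And>a. g a \<in> Z) \<Longrightarrow> lift s g f \<in> Z"
  by (simp add: lift_def submod_sum submodD)
lemma lift_diff_fun: "lift s (\<lambda>a. g a - g' a) f = lift s g f - lift s g' f"
  by (simp add: lift_def act_diff2 sum_subtractf)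

definition mon :: "(nat \<Rightarrow> coef) \<Rightarrow> (nat \<Rightarrow>\<^sub>0 nat) \<Rightarrow> coef" where
  "mon X \<alpha> = (\<Prod>i\<in>Poly_Mapping.keys \<alpha>. X i ^ Poly_Mapping.lookup \<alpha> i)"

lemma mon_bound: "finite S \<Longrightarrow> Poly_Mapping.keys \<alpha> \<subseteq> S \<Longrightarrow> mon X \<alpha> = (\<Prod>i\<in>S. X i ^ Poly_Mapping.lookup \<alpha> i)"
  unfolding mon_def by (rule prod.mono_neutral_left) (auto simp: in_keys_iff)

lemma mon_add: "mon X (\<alpha> + \<beta>) = mon X \<alpha> * mon X \<beta>"
proof -
  let ?S = "Poly_Mapping.keys \<alpha> \<union> Poly_Mapping.keys \<beta>"
  have "mon X (\<alpha> + \<beta>) = (\<Prod>i\<in>?S. X i ^ Poly_Mapping.lookup (\<alpha> + \<beta>) i)"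
    by (rule mon_bound) (use keys_add[of \<alpha> \<beta>] in auto)
  then show ?thesis
    by (simp add: mon_bound[of ?S] lookup_add power_add prod.distrib)
qed
lemma mon_0 [simp]: "mon X 0 = 1" by (simp add: mon_def)
lemma mon_one: "mon X (Poly_Mapping.single i 1) = X i" by (simp add: mon_def)

lemma subst_add: "subst s X (f + g) = subst s X f + subst s X g"
  unfolding subst_def by (rule setsum_keys_plus_distrib) (simp_all add: cst_add act_add2)
lemma subst_0 [simp]: "subst s X 0 = 0" by (simp add: subst_def)
lemma subst_minus: "subst s X (- f) = - subst s X f"
  using subst_add[of X f "- f"] by (simp add: eq_neg_iff_add_eq_0 add.commute)
lemma subst_diff: "subst s X (f - g) = subst s X f - subst s X g"
  using subst_add[of X f "- g"] by (simp add: subst_minus)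

lemma subst_single: "subst s X (Poly_Mapping.single \<alpha> a) = act s (mon X \<alpha>) (cst a)"
  by (cases "a = 0") (simp_all add: subst_def mon_def)
lemma subst_cst [simp]: "subst s X (cst a) = cst a"
  using subst_single[of X 0 a] by (simp add: cst_def)

end

lemma cmodule_coef: "cmodule ((*) :: complex poly cmod)"
  by unfold_locales (simp_all add: algebra_simps)

text \<open>The coefficient ring acts on itself, so that substitution into coefficients is a special case of substitution.\<close>
interpretation C: cmodule "(*) :: complex poly cmod" by (rule cmodule_coef)

lemma act_coef: "act (*) p q = p * q"
proof (induction p rule: pm_induct)
  case (single \<alpha> c)
  show ?case
    by (induction q rule: pm_induct) (simp_all add: C.act_single mult_single C.act_add2 distrib_left)
qed (simp add: C.act_add1 distrib_right)

abbreviation substc :: "(nat \<Rightarrow> coef) \<Rightarrow> coef \<Rightarrow> coef" where "substc \<equiv> subst (*)"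

context cmodule
begin

text \<open>Substitution is semilinear; on coefficients it fixes \<open>\<partial>\<close>.\<close>
lemma subst_act: "subst s X (act s c f) = act s (substc X c) (subst s X f)"
proof (induction c rule: pm_induct)
  case (single \<alpha> c)
  show ?case
  proof (induction f rule: pm_induct)
    case (single \<beta> a)
    show ?case
      by (simp add: act_single subst_single C.subst_single act_coef act_mult mon_add flip: act_cst)
        (metis act_comm act_mult)
  qed (simp add: subst_add act_add2)
qed (simp add: act_add1 subst_add C.subst_add)

end

lemma substc_var [simp]: "substc X (var i) = X i"
  by (simp add: var_def C.subst_single C.mon_one act_coef cst_1 del: One_nat_def)
lemma substc_dpar [simp]: "substc X dpar = dpar"
  using C.subst_cst[of X "[:0, 1:]"] by (simp add: cst_def dpar_def)

context cmodule
begin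

lemma subst_cong:
  assumes Z: "submod Z" and XY: "\<And>i f. act s (X i - Y i) f \<in> Z"
  shows "subst s X f - subst s Y f \<in> Z"
proof (induction f rule: mpol_induct)
  case (add f g)
  then show ?case using submodD(2)[OF Z] by (simp add: subst_add) (metis add_diff_add)
next
  case (var i f)
  have "act s (X i) (subst s X f - subst s Y f) + act s (X i - Y i) (subst s Y f) \<in> Z"
    using var by (intro submodD[OF Z] XY)
  then show ?case by (simp add: subst_act act_diff1 act_diff2)
qed (simp add: submodD[OF Z])

lemma subst_subst: "subst s X (subst s Y f) = subst s (\<lambda>i. substc X (Y i)) f"
  by (induction f rule: mpol_induct) (simp_all add: subst_add subst_act)

lemma subst_eval1: "subst s Y (eval1 s X f) = eval1 s (substc Y X) f"
  by (induction f) (simp_all add: eval1_pCons subst_add subst_act)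

end

text \<open>\<open>f\<close> involves only indeterminates with index in \<open>S\<close>.\<close>
definition in_vars :: "nat set \<Rightarrow> ('a::zero) mpol \<Rightarrow> bool" where
  "in_vars S f \<longleftrightarrow> (\<forall>\<alpha>\<in>Poly_Mapping.keys f. Poly_Mapping.keys \<alpha> \<subseteq> S)"

lemma in_varsD: "in_vars S f \<Longrightarrow> \<alpha> \<in> Poly_Mapping.keys f \<Longrightarrow> i \<in> Poly_Mapping.keys \<alpha> \<Longrightarrow> i \<in> S"
  by (auto simp: in_vars_def)
lemma in_vars_0 [simp]: "in_vars S 0" by (simp add: in_vars_def)
lemma in_vars_cst [simp]: "in_vars S (cst a)" by (simp add: in_vars_def cst_def)
lemma in_vars_add: "in_vars S f \<Longrightarrow> in_vars S g \<Longrightarrow> in_vars S (f + g)" for f :: "'a::ab_group_add mpol"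
  unfolding in_vars_def using keys_add[of f g] by blast
lemma in_vars_minus: "in_vars S (- f) = in_vars S f" for f :: "'a::ab_group_add mpol"
  by (simp add: in_vars_def keys_def)
lemma in_vars_diff: "in_vars S f \<Longrightarrow> in_vars S g \<Longrightarrow> in_vars S (f - g)" for f :: "'a::ab_group_add mpol"
  using in_vars_add[of S f "- g"] by (simp add: in_vars_minus)
lemma in_vars_sum: "(\<And>i. i \<in> I \<Longrightarrow> in_vars S (f i)) \<Longrightarrow> in_vars S (sum f I)" for f :: "_ \<Rightarrow> 'a::ab_group_add mpol"
  by (induction I rule: infinite_finite_induct) (auto intro: in_vars_add)
lemma in_vars_var: "i \<in> S \<Longrightarrow> in_vars S (var i)" by (simp add: in_vars_def var_def)
lemma in_vars_dpar: "in_vars S dpar" by (simp add: in_vars_def dpar_def)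
lemma in_vars_mono: "in_vars S f \<Longrightarrow> S \<subseteq> S' \<Longrightarrow> in_vars S' f" by (auto simp: in_vars_def)

context cmodule
begin

lemma in_vars_act: "in_vars S c \<Longrightarrow> in_vars S f \<Longrightarrow> in_vars S (act s c f)"
  unfolding act_def
proof (intro in_vars_sum)
  fix \<alpha> \<beta> assume "in_vars S c" "in_vars S f" "\<alpha> \<in> Poly_Mapping.keys c" "\<beta> \<in> Poly_Mapping.keys f"
  then have "Poly_Mapping.keys (\<alpha> + \<beta>) \<subseteq> S" using keys_add[of \<alpha> \<beta>] unfolding in_vars_def by blast
  then show "in_vars S (Poly_Mapping.single (\<alpha> + \<beta>) (s (Poly_Mapping.lookup c \<alpha>) (Poly_Mapping.lookup f \<beta>)))"
    by (simp add: in_vars_def)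
qed

lemma in_vars_lift: "(\<And>a. in_vars S (g a)) \<Longrightarrow> in_vars S f \<Longrightarrow> in_vars S (lift s g f)"
  unfolding lift_def by (intro in_vars_sum in_vars_act) (auto simp: in_vars_def)

lemma in_vars_eval1: "in_vars S X \<Longrightarrow> in_vars S (eval1 s X f)"
  by (induction f) (auto simp: eval1_pCons intro: in_vars_add in_vars_act)

lemma in_vars_prd: "in_vars S X \<Longrightarrow> in_vars S f \<Longrightarrow> in_vars S g \<Longrightarrow> in_vars S (prd s op X f g)"
  unfolding prd_def by (intro in_vars_lift in_vars_eval1)

end

lemma in_vars_mult: "in_vars S p \<Longrightarrow> in_vars S q \<Longrightarrow> in_vars S (p * q)" for p q :: coef
  using C.in_vars_act[of S p q] by (simp add: act_coef)
lemma in_vars_1 [simp]: "in_vars S (1 :: coef)" using in_vars_cst[of S "1 :: complex poly"] by (simp add: cst_1)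
lemma in_vars_power: "in_vars S p \<Longrightarrow> in_vars S (p ^ n)" for p :: coef
  by (induction n) (auto intro: in_vars_mult)
lemma in_vars_prod: "(\<And>i. i \<in> I \<Longrightarrow> in_vars S (f i)) \<Longrightarrow> in_vars S (prod f I)" for f :: "_ \<Rightarrow> coef"
  by (induction I rule: infinite_finite_induct) (auto intro: in_vars_mult)

context cmodule
begin

lemma in_vars_subst: "in_vars S' f \<Longrightarrow> (\<And>i. i \<in> S' \<Longrightarrow> in_vars S (X i)) \<Longrightarrow> in_vars S (subst s X f)"
  unfolding subst_def by (intro in_vars_sum in_vars_act in_vars_prod in_vars_power in_vars_cst) (auto dest: in_varsD)

lemma subst_cong_vars: "in_vars S f \<Longrightarrow> (\<And>i. i \<in> S \<Longrightarrow> X i = Y i) \<Longrightarrow> subst s X f = subst s Y f"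
  unfolding subst_def by (intro sum.cong prod.cong refl arg_cong2[where f = "act s"] arg_cong2[where f = power]) (auto dest: in_varsD)

lemma subst_var: "subst s var f = f"
  by (induction f rule: mpol_induct) (simp_all add: subst_add subst_act)

lemma subst_id_vars: "in_vars S f \<Longrightarrow> (\<And>i. i \<in> S \<Longrightarrow> X i = var i) \<Longrightarrow> subst s X f = f"
  using subst_cong_vars[of S f X var] by (simp add: subst_var)

end

text \<open>\<open>\<complex>[\<lambda>\<^sub>0, \<lambda>\<^sub>1, \<dots>]\<close>-linear maps, described on generators of the ring. Such a map is determined by its values on
  constants, but may fail to commute with \<open>\<partial>\<close>.\<close>
definition clinear :: "('a::ab_group_add) cmod \<Rightarrow> ('b::ab_group_add) cmod \<Rightarrow> ('a mpol \<Rightarrow> 'b mpol) \<Rightarrow> bool" where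
  "clinear s t T \<longleftrightarrow> (\<forall>f g. T (f + g) = T f + T g) \<and> (\<forall>i f. T (act s (var i) f) = act t (var i) (T f))
     \<and> (\<forall>c f. T (act s (cst [:c:]) f) = act t (cst [:c:]) (T f))"

text \<open>The subring of the coefficients that do not involve \<open>\<partial>\<close>.\<close>
inductive_set pure :: "coef set" where
  pure_var: "var i \<in> pure"
| pure_cst: "cst [:c:] \<in> pure"
| pure_add: "p \<in> pure \<Longrightarrow> q \<in> pure \<Longrightarrow> p + q \<in> pure"
| pure_mult: "p \<in> pure \<Longrightarrow> q \<in> pure \<Longrightarrow> p * q \<in> pure"

lemma clinear_add: "clinear s t T \<Longrightarrow> T (f + g) = T f + T g"
  and clinear_var: "clinear s t T \<Longrightarrow> T (act s (var i) f) = act t (var i) (T f)"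
  and clinear_cst: "clinear s t T \<Longrightarrow> T (act s (cst [:c:]) f) = act t (cst [:c:]) (T f)"
  by (auto simp: clinear_def)

lemma clinear_0: "clinear s t T \<Longrightarrow> T 0 = 0"
  using clinear_add[of s t T 0 0] by simp
lemma clinear_minus: "clinear s t T \<Longrightarrow> T (- f) = - T f"
  using clinear_add[of s t T f "- f"] clinear_0[of s t T] by (simp add: eq_neg_iff_add_eq_0 add.commute)
lemma clinear_diff: "clinear s t T \<Longrightarrow> T (f - g) = T f - T g"
  using clinear_add[of s t T f "- g"] clinear_minus[of s t T g] by simp

lemma clinear_pure:
  assumes "cmodule s" "cmodule t" "clinear s t T" "q \<in> pure"
  shows "T (act s q f) = act t q (T f)"
  using assms(4)
proof (induction q arbitrary: f rule: pure.induct)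
  case (pure_add p q f)
  then show ?case
    by (simp add: cmodule.act_add1[OF assms(1)] cmodule.act_add1[OF assms(2)] clinear_add[OF assms(3)])
next
  case (pure_mult p q f)
  then show ?case
    by (simp add: cmodule.act_mult[OF assms(1)] cmodule.act_mult[OF assms(2)])
qed (simp_all add: clinear_var[OF assms(3)] clinear_cst[OF assms(3)])

lemma (in cmodule) clinear_mem:
  assumes "cmodule t" "cmodule.submod t Z" "clinear s t T" "\<And>a. T (cst a) \<in> Z"
  shows "T f \<in> Z"
proof -
  interpret t: cmodule t by fact
  show ?thesis
    by (induction f rule: mpol_induct) (auto simp: clinear_add[OF assms(3)] clinear_var[OF assms(3)] assms(4) intro: t.submodD[OF assms(2)])
qed

lemma clinear_id: "clinear s s (\<lambda>f. f)" by (simp add: clinear_def)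
lemma clinear_comp_diff: "cmodule t \<Longrightarrow> clinear s t T \<Longrightarrow> clinear s t T' \<Longrightarrow> clinear s t (\<lambda>f. T f - T' f)"
  by (auto simp: clinear_def cmodule.act_diff2)
lemma clinear_comp_add: "cmodule t \<Longrightarrow> clinear s t T \<Longrightarrow> clinear s t T' \<Longrightarrow> clinear s t (\<lambda>f. T f + T' f)"
  by (auto simp: clinear_def cmodule.act_add2)
lemma clinear_comp_act: "cmodule t \<Longrightarrow> clinear s t T \<Longrightarrow> clinear s t (\<lambda>f. act t c (T f))"
  by (auto simp: clinear_def cmodule.act_add2) (metis cmodule.act_comm)+
lemma clinear_comp: "clinear t u T \<Longrightarrow> clinear s t T' \<Longrightarrow> clinear s u (\<lambda>f. T (T' f))"
  by (auto simp: clinear_def)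

lemma clinear_lift:
  assumes "cmodule s" "cmodule t" "\<And>a b. g (a + b) = g a + g b" "\<And>c a. g (s [:c:] a) = act t (cst [:c:]) (g a)"
  shows "clinear s t (lift t g)"
proof -
  interpret s: cmodule s by fact
  interpret t: cmodule t by fact
  note [simp] = t.lift_single[OF assms(3)] t.lift_add[OF assms(3)]
  have var: "lift t g (act s (var i) f) = act t (var i) (lift t g f)" for i f
  proof (induction f rule: pm_induct)
    case (single \<beta> a)
    show ?case by (simp add: s.act_var_single del: One_nat_def)
       (simp add: var_def mult_single flip: t.act_mult)
  qed (simp add: s.act_add2 t.act_add2)
  have cst: "lift t g (act s (cst [:c:]) f) = act t (cst [:c:]) (lift t g f)" for c f
  proof (induction f rule: pm_induct)
    case (single \<beta> a)
    show ?case by (simp add: cst_def s.act_single) (simp add: assms(4) cst_def mult_single flip: t.act_mult)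
  qed (simp add: s.act_add2 t.act_add2)
  show ?thesis unfolding clinear_def using var cst by simp
qed

section \<open>Conformal products at a momentum\<close>

text \<open>A momentum is a sum of indeterminates, encoded as a multiset of indices; being a monoid, momenta can be substituted
  for indeterminates.\<close>
definition emb :: "nat multiset \<Rightarrow> coef" where "emb p = (\<Sum>i\<in>#p. var i)"

lemma emb_simps [simp]: "emb {#} = 0" "emb (add_mset i p) = var i + emb p" "emb (p + q) = emb p + emb q"
  by (simp_all add: emb_def)

lemma pure_0 [simp]: "0 \<in> pure" using pure_cst[of 0] by simp
lemma emb_pure [simp]: "emb p \<in> pure"
  by (induction p) (auto intro: pure.intros)

text \<open>Modulo the image of this operator, \<open>\<partial>\<close> acts as \<open>- p\<close>.\<close>
definition mass :: "nat multiset \<Rightarrow> coef" where "mass p = dpar + emb p"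

definition zer :: "('a::ab_group_add) cmod \<Rightarrow> nat multiset \<Rightarrow> 'a mpol set" where
  "zer s p = range (act s (mass p))"

definition rename :: "(nat \<Rightarrow> nat multiset) \<Rightarrow> nat multiset \<Rightarrow> nat multiset" where
  "rename \<theta> p = \<Sum>\<^sub># (image_mset \<theta> p)"

lemma rename_add: "rename \<theta> (p + q) = rename \<theta> p + rename \<theta> q" by (simp add: rename_def)
lemma rename_0 [simp]: "rename \<theta> {#} = {#}" by (simp add: rename_def)
lemma rename_single [simp]: "rename \<theta> {#i#} = \<theta> i" by (simp add: rename_def)

lemma substc_add: "substc X (p + q) = substc X p + substc X q" by (rule C.subst_add)
lemma substc_minus: "substc X (- p) = - substc X p" by (rule C.subst_minus)
lemma substc_diff: "substc X (p - q) = substc X p - substc X q" by (rule C.subst_diff)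

lemma substc_emb: "substc (\<lambda>i. emb (\<theta> i)) (emb p) = emb (rename \<theta> p)"
  by (induction p) (simp_all add: substc_add rename_def)

lemma (in cmodule) submod_zer: "submod (zer s p)"
  unfolding zer_def by (rule submod_range)

lemma (in cmodule) act_mass_zer: "act s (mass p * c) f \<in> zer s p"
  by (simp add: zer_def act_mult)

locale conformal = A: cmodule sA + B: cmodule sB + V: cmodule sC
  for sA :: "('a::ab_group_add) cmod" and sB :: "('b::ab_group_add) cmod" and sC :: "('c::ab_group_add) cmod" +
  fixes bop :: "'a \<Rightarrow> 'b \<Rightarrow> 'c poly"
  assumes conformal_op: "conformal_op sA sB sC bop"
begin

lemma op_simps: "bop (a + a') b = bop a b + bop a' b" "bop a (b + b') = bop a b + bop a b'"
  "bop (sA [:c:] a) b = map_poly (sC [:c:]) (bop a b)" "bop a (sB [:c:] b) = map_poly (sC [:c:]) (bop a b)"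
  "bop (del sA a) b = - pCons 0 (bop a b)" "bop a (del sB b) = map_poly (del sC) (bop a b) + pCons 0 (bop a b)"
  using conformal_op by (auto simp: conformal_op_def)

lemma inner_clinear: "clinear sB sC (lift sC (\<lambda>b. eval1 sC X (bop a b)))"
  by (rule clinear_lift) (simp_all add: A.cmodule_axioms B.cmodule_axioms V.cmodule_axioms op_simps V.eval1_add V.eval1_map)

lemma prd_clinear1: "clinear sA sC (\<lambda>f. prd sC bop X f g)"
  unfolding prd_def
  by (rule clinear_lift) (simp_all add: A.cmodule_axioms B.cmodule_axioms V.cmodule_axioms op_simps V.eval1_add V.eval1_map V.lift_add_fun V.lift_act_fun)

lemma prd_clinear2: "clinear sB sC (\<lambda>g. prd sC bop X f g)"
  using inner_clinear[of X] unfolding prd_def clinear_def by (simp add: V.lift_add_fun V.lift_act_fun)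

lemma prd_comp1: "clinear s sA F \<Longrightarrow> clinear s sC (\<lambda>x. prd sC bop X (F x) g)"
  by (rule clinear_comp[OF prd_clinear1])
lemma prd_comp2: "clinear s sB F \<Longrightarrow> clinear s sC (\<lambda>x. prd sC bop X f (F x))"
  by (rule clinear_comp[OF prd_clinear2])

lemma prd_cst: "prd sC bop X (cst a) (cst b) = eval1 sC X (bop a b)"
  unfolding prd_def by (subst V.lift_cst; (subst V.lift_cst)?) (simp_all add: op_simps V.eval1_add V.lift_add_fun)

lemma prd_pure1: "q \<in> pure \<Longrightarrow> prd sC bop X (act sA q f) g = act sC q (prd sC bop X f g)"
  by (rule clinear_pure[OF A.cmodule_axioms V.cmodule_axioms prd_clinear1])
lemma prd_pure2: "q \<in> pure \<Longrightarrow> prd sC bop X f (act sB q g) = act sC q (prd sC bop X f g)"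
  by (rule clinear_pure[OF B.cmodule_axioms V.cmodule_axioms prd_clinear2])
lemmas prd_pure = prd_pure1 prd_pure2

lemma prd_eqI:
  assumes "\<And>g. clinear sA sC (\<lambda>f. T f g)" "\<And>f. clinear sB sC (T f)" "\<And>a b. T (cst a) (cst b) \<in> Z" "V.submod Z"
  shows "T f g \<in> Z"
  by (rule A.clinear_mem[OF _ assms(4,1)], rule V.cmodule_axioms, rule B.clinear_mem[OF _ assms(4,2)], rule V.cmodule_axioms, rule assms)

lemma act_clinear: "clinear sA sA (act sA c)" "clinear sB sB (act sB c)"
  using A.act_comm B.act_comm by (auto simp: clinear_def A.act_add2 B.act_add2)

lemma prd_dpar1: "prd sC bop X (act sA dpar f) g = act sC (- X) (prd sC bop X f g)"
proof -
  have "prd sC bop X (act sA dpar f) g - act sC (- X) (prd sC bop X f g) \<in> {0}"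
  proof (rule prd_eqI[where T = "\<lambda>f g. prd sC bop X (act sA dpar f) g - act sC (- X) (prd sC bop X f g)"])
    fix a b
    show "prd sC bop X (act sA dpar (cst a)) (cst b) - act sC (- X) (prd sC bop X (cst a) (cst b)) \<in> {0}"
      by (simp add: A.act_dpar_cst prd_cst op_simps V.eval1_minus V.eval1_pCons V.act_minus1 V.act_minus2)
  qed (intro clinear_comp_diff clinear_comp_act prd_comp1 prd_clinear2 clinear_id act_clinear V.cmodule_axioms V.submod_0)+
  then show ?thesis by simp
qed

lemma prd_dpar2: "prd sC bop X f (act sB dpar g) = act sC (dpar + X) (prd sC bop X f g)"
proof -
  have "prd sC bop X f (act sB dpar g) - act sC (dpar + X) (prd sC bop X f g) \<in> {0}"
  proof (rule prd_eqI[where T = "\<lambda>f g. prd sC bop X f (act sB dpar g) - act sC (dpar + X) (prd sC bop X f g)"])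
    fix a b
    show "prd sC bop X (cst a) (act sB dpar (cst b)) - act sC (dpar + X) (prd sC bop X (cst a) (cst b)) \<in> {0}"
      by (simp add: B.act_dpar_cst prd_cst op_simps V.eval1_add V.eval1_dpar V.eval1_pCons V.act_add1)
  qed (intro clinear_comp_diff clinear_comp_act prd_comp2 prd_clinear1 clinear_id act_clinear V.cmodule_axioms V.submod_0)+
  then show ?thesis by simp
qed

lemma prd_zer1: "f \<in> zer sA p \<Longrightarrow> prd sC bop (emb p) f g = 0"
  unfolding zer_def mass_def
  by (auto simp: A.act_add1 clinear_add[OF prd_clinear1] prd_dpar1 prd_pure V.act_minus1)

text \<open>\<open>f\<^sub>p (\<partial> + q) h = (\<partial> + p + q) (f\<^sub>p h)\<close>.\<close>
lemma prd_zer2: "g \<in> zer sB q \<Longrightarrow> prd sC bop (emb p) f g \<in> zer sC (p + q)"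
proof -
  assume "g \<in> zer sB q"
  then obtain h where g: "g = act sB (mass q) h" by (auto simp: zer_def)
  have "prd sC bop (emb p) f g = act sC (mass (p + q)) (prd sC bop (emb p) f h)"
    unfolding g mass_def by (simp add: B.act_add1 V.act_add1 clinear_add[OF prd_clinear2] prd_dpar2 prd_pure add_ac)
  then show ?thesis by (simp add: zer_def)
qed

lemma prd_cong: "V.submod Z \<Longrightarrow> (\<And>f. act sC (X - Y) f \<in> Z) \<Longrightarrow> prd sC bop X f g - prd sC bop Y f g \<in> Z"
  unfolding prd_def V.lift_diff_fun[symmetric] by (intro V.lift_mem V.eval1_cong)

text \<open>The substituted expressions must not involve \<open>\<partial>\<close>, which inside a factor would act on the factor instead of the product.\<close>
lemma subst_prd:
  assumes "\<And>i. X i \<in> pure"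
  shows "subst sC X (prd sC bop Y f g) = prd sC bop (substc X Y) (subst sA X f) (subst sB X g)"
proof (induction f rule: A.mpol_induct)
  case (cst a)
  show ?case
    by (induction g rule: B.mpol_induct)
      (simp_all add: prd_cst V.subst_eval1 clinear_add[OF prd_clinear2] clinear_var[OF prd_clinear2] V.subst_add B.subst_add
         V.subst_act B.subst_act prd_pure assms)
qed (simp_all add: clinear_add[OF prd_clinear1] clinear_var[OF prd_clinear1] V.subst_add A.subst_add
         V.subst_act A.subst_act prd_pure assms)

end

text \<open>Identities between elements with polynomial coefficients follow from the case of constants.\<close>
lemma trilinear_mem:
  assumes "cmodule s1" "cmodule s2" "cmodule s3" "cmodule t" "cmodule.submod t Z"
    and cst: "\<And>a b c. T (cst a) (cst b) (cst c) \<in> Z"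
    and lin: "\<And>g h. clinear s1 t (\<lambda>f. T f g h)" "\<And>f h. clinear s2 t (\<lambda>g. T f g h)" "\<And>f g. clinear s3 t (\<lambda>h. T f g h)"
  shows "\<forall>f g h. T f g h \<in> Z"
  by (intro allI, rule cmodule.clinear_mem[OF assms(1,4,5) lin(1)], rule cmodule.clinear_mem[OF assms(2,4,5) lin(2)],
      rule cmodule.clinear_mem[OF assms(3,4,5) lin(3)], rule cst)

lemma trilinear_eq:
  assumes "cmodule s1" "cmodule s2" "cmodule s3" "cmodule t"
    and cst: "\<And>a b c. T (cst a) (cst b) (cst c) = T' (cst a) (cst b) (cst c)"
    and lin: "\<And>g h. clinear s1 t (\<lambda>f. T f g h)" "\<And>f h. clinear s2 t (\<lambda>g. T f g h)" "\<And>f g. clinear s3 t (\<lambda>h. T f g h)"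
    and lin': "\<And>g h. clinear s1 t (\<lambda>f. T' f g h)" "\<And>f h. clinear s2 t (\<lambda>g. T' f g h)" "\<And>f g. clinear s3 t (\<lambda>h. T' f g h)"
  shows "\<forall>f g h. T f g h = T' f g h"
proof -
  have "\<forall>f g h. T f g h - T' f g h \<in> {0}"
    by (rule trilinear_mem[OF assms(1-4) cmodule.submod_0[OF assms(4)]])
      (simp_all add: cst clinear_comp_diff lin lin' assms(4))
  then show ?thesis by simp
qed

definition two :: "nat multiset \<Rightarrow> nat multiset \<Rightarrow> nat \<Rightarrow> nat multiset" where
  "two p q i = (if i = 0 then p else if i = 1 then q else {#})"
lemma two_simps [simp]: "two p q 0 = p" "two p q (Suc 0) = q" by (simp_all add: two_def)

context npc_module
begin

abbreviation "sP \<equiv> sclP P"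
abbreviation "sV \<equiv> sclV V"

lemma cmodule_P: "cmodule sP" by (simp add: cmodule_def module)
lemma cmodule_V: "cmodule sV" by (simp add: cmodule_def moduleV)

sublocale PM: cmodule sP by (rule cmodule_P)
sublocale VM: cmodule sV by (rule cmodule_V)
sublocale br: conformal sP sP sP "brak P"
  by (simp add: conformal_def conformal_axioms_def cmodule_P conformal_brak)
sublocale mu: conformal sP sP sP "circ P"
  by (simp add: conformal_def conformal_axioms_def cmodule_P conformal_circ)
sublocale la: conformal sP sV sV "lact V"
  by (simp add: conformal_def conformal_axioms_def cmodule_P cmodule_V conformal_lact)
sublocale lc: conformal sP sV sV "lcirc V"
  by (simp add: conformal_def conformal_axioms_def cmodule_P cmodule_V conformal_lcirc)
sublocale rc: conformal sV sP sV "rcirc V"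
  by (simp add: conformal_def conformal_axioms_def cmodule_P cmodule_V conformal_rcirc)

lemmas comps = br.prd_comp1 br.prd_comp2 mu.prd_comp1 mu.prd_comp2 la.prd_comp1 la.prd_comp2
  lc.prd_comp1 lc.prd_comp2 rc.prd_comp1 rc.prd_comp2
lemmas clinear_rules = clinear_comp_diff[OF cmodule_P] clinear_comp_diff[OF cmodule_V]
  clinear_comp_add[OF cmodule_P] clinear_comp_add[OF cmodule_V] clinear_id comps

lemma subst_prd_emb:
  "subst sP (\<lambda>i. emb (\<theta> i)) (brakP P Y p1 p2) = brakP P (substc (\<lambda>i. emb (\<theta> i)) Y) (subst sP (\<lambda>i. emb (\<theta> i)) p1) (subst sP (\<lambda>i. emb (\<theta> i)) p2)"
  "subst sP (\<lambda>i. emb (\<theta> i)) (circP P Y p1 p2) = circP P (substc (\<lambda>i. emb (\<theta> i)) Y) (subst sP (\<lambda>i. emb (\<theta> i)) p1) (subst sP (\<lambda>i. emb (\<theta> i)) p2)"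
  "subst sV (\<lambda>i. emb (\<theta> i)) (lactV V Y p1 v2) = lactV V (substc (\<lambda>i. emb (\<theta> i)) Y) (subst sP (\<lambda>i. emb (\<theta> i)) p1) (subst sV (\<lambda>i. emb (\<theta> i)) v2)"
  "subst sV (\<lambda>i. emb (\<theta> i)) (lcircV V Y p1 v2) = lcircV V (substc (\<lambda>i. emb (\<theta> i)) Y) (subst sP (\<lambda>i. emb (\<theta> i)) p1) (subst sV (\<lambda>i. emb (\<theta> i)) v2)"
  "subst sV (\<lambda>i. emb (\<theta> i)) (rcircV V Y v1 p2) = rcircV V (substc (\<lambda>i. emb (\<theta> i)) Y) (subst sV (\<lambda>i. emb (\<theta> i)) v1) (subst sP (\<lambda>i. emb (\<theta> i)) p2)"
  by (rule br.subst_prd mu.subst_prd la.subst_prd lc.subst_prd rc.subst_prd, rule emb_pure)+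
lemmas subst_prds = subst_prd_emb
  substc_add substc_minus substc_diff PM.subst_add VM.subst_add PM.subst_diff VM.subst_diff PM.subst_minus

abbreviation "BR p \<equiv> brakP P (emb p)"
abbreviation "MU p \<equiv> circP P (emb p)"
abbreviation "LA p \<equiv> lactV V (emb p)"
abbreviation "LC p \<equiv> lcircV V (emb p)"
abbreviation "RC p \<equiv> rcircV V (emb p)"

text \<open>Each axiom of the algebra or the module concerns constants and the subscripts \<open>\<lambda>\<close>, \<open>\<mu>\<close>. Substituting momenta for
  \<open>\<lambda>\<close> and \<open>\<mu>\<close> and extending linearly gives the corresponding axiom with momenta.\<close>
lemma mu_assoc: "\<forall>f g h. MU p f (MU q g h) = MU (p + q) (MU p f g) h"
  by (rule trilinear_eq[OF cmodule_P cmodule_P cmodule_P cmodule_P], use arg_cong[OF assoc, of "subst sP (\<lambda>i. emb (two p q i))"] in \<open>simp add: subst_prds\<close>)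
    (intro clinear_rules)+

lemma br_jacobi: "\<forall>f g h. BR p f (BR q g h) = BR (p + q) (BR p f g) h + BR q g (BR p f h)"
  by (rule trilinear_eq[OF cmodule_P cmodule_P cmodule_P cmodule_P], use arg_cong[OF jacobi, of "subst sP (\<lambda>i. emb (two p q i))"] in \<open>simp add: subst_prds\<close>)
    (intro clinear_rules)+

lemma br_leibniz: "\<forall>f g h. BR p f (MU q g h) = MU (p + q) (BR p f g) h + MU q g (BR p f h)"
  by (rule trilinear_eq[OF cmodule_P cmodule_P cmodule_P cmodule_P], use arg_cong[OF leibniz, of "subst sP (\<lambda>i. emb (two p q i))"] in \<open>simp add: subst_prds\<close>)
    (intro clinear_rules)+

lemma lc_mu: "\<forall>f g v. LC (p + q) (MU p f g) v = LC p f (LC q g v)"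
  by (rule trilinear_eq[OF cmodule_P cmodule_P cmodule_V cmodule_V], use arg_cong[OF assoc_left, of "subst sV (\<lambda>i. emb (two p q i))"] in \<open>simp add: subst_prds\<close>)
    (intro clinear_rules)+

lemma rc_mu: "\<forall>v g f. RC (q + p) (RC q v g) f = RC q v (MU p g f)"
  by (rule trilinear_eq[OF cmodule_V cmodule_P cmodule_P cmodule_V], use arg_cong[OF assoc_right, of "subst sV (\<lambda>i. emb (two q p i))"] in \<open>simp add: subst_prds\<close>)
    (intro clinear_rules)+

lemma rc_lc: "\<forall>f v g. RC (p + q) (LC p f v) g = LC p f (RC q v g)"
  by (rule trilinear_eq[OF cmodule_P cmodule_V cmodule_P cmodule_V], use arg_cong[OF assoc_mid, of "subst sV (\<lambda>i. emb (two p q i))"] in \<open>simp add: subst_prds\<close>)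
    (intro clinear_rules)+

lemma la_br: "\<forall>f g v. LA (p + q) (BR p f g) v = LA p f (LA q g v) - LA q g (LA p f v)"
  by (rule trilinear_eq[OF cmodule_P cmodule_P cmodule_V cmodule_V], use arg_cong[OF lie_module, of "subst sV (\<lambda>i. emb (two p q i))"] in \<open>simp add: subst_prds\<close>)
    (intro clinear_rules)+

lemma lc_br: "\<forall>f g v. LC (p + q) (BR p f g) v = LA p f (LC q g v) - LC q g (LA p f v)"
  by (rule trilinear_eq[OF cmodule_P cmodule_P cmodule_V cmodule_V], use arg_cong[OF leibniz_left, of "subst sV (\<lambda>i. emb (two p q i))"] in \<open>simp add: subst_prds\<close>)
    (intro clinear_rules)+

lemma rc_br: "\<forall>v f g. RC q v (BR p f g) = LA p f (RC q v g) - RC (p + q) (LA p f v) g"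
  by (rule trilinear_eq[OF cmodule_V cmodule_P cmodule_P cmodule_V], use arg_cong[OF leibniz_right, of "subst sV (\<lambda>i. emb (two p q i))"] in \<open>simp add: subst_prds\<close>)
    (intro clinear_rules)+

text \<open>The subscript \<open>- p - \<partial>\<close> may be replaced by \<open>q\<close>, since their difference is \<open>\<partial> + p + q\<close> up to sign.\<close>
lemma br_skew: "BR p f g + BR q g f \<in> zer sP (p + q)"
proof (rule br.prd_eqI[where T = "\<lambda>f g. BR p f g + BR q g f"])
  fix a b
  have *: "BR p (cst a) (cst b) = - brakP P (- emb p - dpar) (cst b) (cst a)"
    using arg_cong[OF skew, of "subst sP (\<lambda>i. emb (two p q i))" a b] by (simp add: subst_prds)
  have "brakP P (emb q) (cst b) (cst a) - brakP P (- emb p - dpar) (cst b) (cst a) \<in> zer sP (p + q)"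
  proof (rule br.prd_cong[OF PM.submod_zer])
    fix f
    have "emb q - (- emb p - dpar) = mass (p + q) * 1" by (simp add: mass_def)
    then show "act sP (emb q - (- emb p - dpar)) f \<in> zer sP (p + q)" by (metis PM.act_mass_zer)
  qed
  then show "BR p (cst a) (cst b) + BR q (cst b) (cst a) \<in> zer sP (p + q)" unfolding * by simp
qed (intro clinear_rules PM.submod_zer)+

lemma la_mu: "\<forall>f g v. LA (p + q) (MU p f g) v - (LC p f (LA q g v) + RC (p + r) (LA p f v) g) \<in> zer sV (p + q + r)"
proof (rule trilinear_mem[OF cmodule_P cmodule_P cmodule_V cmodule_V VM.submod_zer])
  fix a b c
  \<comment> \<open>this subscript agrees with \<open>p + q\<close>, \<open>q\<close> and \<open>p\<close> in the three terms, when \<open>r\<close> is the momentum of the element \<open>c\<close> of the module\<close>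
  let ?m = "- emb r - dpar"
  have *: "lactV V ?m (MU p (cst a) (cst b)) (cst c) = LC p (cst a) (lactV V ?m (cst b) (cst c)) + RC (p + r) (lactV V ?m (cst a) (cst c)) (cst b)"
    using arg_cong[OF leibniz_circ, of "subst sV (\<lambda>i. emb (two p r i))" a b c] by (simp add: subst_prds)
  have m: "act sV (emb k - ?m) f \<in> zer sV (k + r)" for k f
  proof -
    have "emb k - ?m = mass (k + r) * 1" by (simp add: mass_def)
    then show ?thesis by (metis VM.act_mass_zer)
  qed
  have 1: "LA (p + q) (MU p (cst a) (cst b)) (cst c) - lactV V ?m (MU p (cst a) (cst b)) (cst c) \<in> zer sV (p + q + r)"
    by (rule la.prd_cong[OF VM.submod_zer m])
  have 2: "LC p (cst a) (LA q (cst b) (cst c) - lactV V ?m (cst b) (cst c)) \<in> zer sV (p + (q + r))"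
    by (rule lc.prd_zer2, rule la.prd_cong[OF VM.submod_zer m])
  have 3: "RC (p + r) (LA p (cst a) (cst c) - lactV V ?m (cst a) (cst c)) (cst b) = 0"
    by (rule rc.prd_zer1, rule la.prd_cong[OF VM.submod_zer m])
  have "LA (p + q) (MU p (cst a) (cst b)) (cst c) - lactV V ?m (MU p (cst a) (cst b)) (cst c)
     - LC p (cst a) (LA q (cst b) (cst c) - lactV V ?m (cst b) (cst c)) \<in> zer sV (p + q + r)"
    using VM.submod_diff[OF VM.submod_zer 1] 2 by (simp add: add.assoc)
  then show "LA (p + q) (MU p (cst a) (cst b)) (cst c)
     - (LC p (cst a) (LA q (cst b) (cst c)) + RC (p + r) (LA p (cst a) (cst c)) (cst b)) \<in> zer sV (p + q + r)"
    using 3 unfolding * by (simp add: clinear_diff[OF lc.prd_clinear2] clinear_diff[OF rc.prd_clinear1] algebra_simps)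
qed (intro clinear_rules)+

sublocale G: momentum_poisson BR MU LA LC RC "zer sP" "zer sV"
proof (unfold_locales; (rule mu_assoc[rule_format] br_jacobi[rule_format] br_leibniz[rule_format] lc_mu[rule_format]
    rc_mu[rule_format] rc_lc[rule_format] la_br[rule_format] lc_br[rule_format] rc_br[rule_format] la_mu[rule_format])?)
qed (simp_all add: clinear_add[OF br.prd_clinear1] clinear_add[OF br.prd_clinear2] clinear_add[OF mu.prd_clinear1] clinear_add[OF mu.prd_clinear2]
   clinear_add[OF la.prd_clinear1] clinear_add[OF la.prd_clinear2] clinear_add[OF lc.prd_clinear1] clinear_add[OF lc.prd_clinear2]
   clinear_add[OF rc.prd_clinear1] clinear_add[OF rc.prd_clinear2] br_skew
   br.prd_zer1 br.prd_zer2 mu.prd_zer1 mu.prd_zer2 la.prd_zer1 la.prd_zer2 lc.prd_zer1 lc.prd_zer2 rc.prd_zer1 rc.prd_zer2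
   PM.submod_diff[OF PM.submod_zer] VM.submod_diff[OF VM.submod_zer] PM.submodD(1)[OF PM.submod_zer] VM.submodD(1)[OF VM.submod_zer])

end

section \<open>\<open>\<lambda>\<close>-brackets as functions of elements with momenta\<close>

context cmodule
begin

lemma lift_swap: "lift s (\<lambda>a. lift s (\<lambda>b. h a b) g) f = lift s (\<lambda>b. lift s (\<lambda>a. h a b) f) g"
  for f :: "'b::zero mpol" and g :: "'c::zero mpol"
proof -
  have "lift s (\<lambda>a. lift s (\<lambda>b. h a b) g) f
    = (\<Sum>\<beta>\<in>Poly_Mapping.keys f. \<Sum>\<gamma>\<in>Poly_Mapping.keys g. act s (Poly_Mapping.single \<beta> 1)
        (act s (Poly_Mapping.single \<gamma> 1) (h (Poly_Mapping.lookup f \<beta>) (Poly_Mapping.lookup g \<gamma>))))"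
    by (simp add: lift_def act_sum2)
  also have "\<dots> = (\<Sum>\<gamma>\<in>Poly_Mapping.keys g. \<Sum>\<beta>\<in>Poly_Mapping.keys f. act s (Poly_Mapping.single \<gamma> 1)
        (act s (Poly_Mapping.single \<beta> 1) (h (Poly_Mapping.lookup f \<beta>) (Poly_Mapping.lookup g \<gamma>))))"
    by (subst sum.swap) (intro sum.cong refl act_comm)
  finally show ?thesis by (simp add: lift_def act_sum2)
qed

lemma multilift_add_fun: "multilift s fs (\<lambda>as. g as + h as) = multilift s fs g + multilift s fs h"
  by (induction fs arbitrary: g h) (simp_all add: lift_add_fun)
lemma multilift_act_fun: "multilift s fs (\<lambda>as. act s c (g as)) = act s c (multilift s fs g)"
  by (induction fs arbitrary: g) (simp_all add: lift_act_fun)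
lemma multilift_0 [simp]: "multilift s fs (\<lambda>as. 0) = 0"
  using multilift_act_fun[of fs 0 "\<lambda>_. 0"] by simp
lemma multilift_mem:
  "submod Z \<Longrightarrow> (\<And>as. length as = length fs \<Longrightarrow> g as \<in> Z) \<Longrightarrow> multilift s fs g \<in> Z"
proof (induction fs arbitrary: g)
  case (Cons f fs)
  show ?case by (simp, intro lift_mem Cons.IH Cons.prems) simp
qed simp
lemma multilift_minus_fun: "multilift s fs (\<lambda>as. - g as) = - multilift s fs g"
  using multilift_act_fun[of fs "- 1" g] by (simp add: act_minus1)
lemma multilift_diff_fun: "multilift s fs (\<lambda>as. g as - h as) = multilift s fs g - multilift s fs h"
  using multilift_add_fun[of fs g "\<lambda>as. - h as"] by (simp add: multilift_minus_fun)
lemma multilift_cong: "(\<And>as. length as = length fs \<Longrightarrow> g as = h as) \<Longrightarrow> multilift s fs g = multilift s fs h"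
  using multilift_mem[OF submod_0, of fs "\<lambda>as. g as - h as"] by (simp add: multilift_diff_fun)

lemma in_vars_multilift:
  "(\<And>f. f \<in> set fs \<Longrightarrow> in_vars S f) \<Longrightarrow> (\<And>as. length as = length fs \<Longrightarrow> in_vars S (g as)) \<Longrightarrow> in_vars S (multilift s fs g)"
proof (induction fs arbitrary: g)
  case (Cons f fs)
  show ?case by (simp, intro in_vars_lift Cons.IH) (simp_all add: Cons.prems)
qed simp

end

locale two_modules = P: cmodule sP + V: cmodule sV
  for sP :: "('p::ab_group_add) cmod" and sV :: "('v::ab_group_add) cmod"
begin

definition mlin :: "('p list \<Rightarrow> 'v mpol) \<Rightarrow> bool" where
  "mlin g \<longleftrightarrow> (\<forall>us a b vs. g (us @ (a + b) # vs) = g (us @ a # vs) + g (us @ b # vs)) \<and>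
     (\<forall>us c a vs. g (us @ sP [:c:] a # vs) = act sV (cst [:c:]) (g (us @ a # vs)))"

lemma mlin_Cons: "mlin g \<Longrightarrow> mlin (\<lambda>as. g (a # as))"
  unfolding mlin_def by (metis append_Cons)
lemma mlin_head: "mlin g \<Longrightarrow> g ((a + b) # vs) = g (a # vs) + g (b # vs)"
  "mlin g \<Longrightarrow> g (sP [:c:] a # vs) = act sV (cst [:c:]) (g (a # vs))"
  unfolding mlin_def by (metis append_Nil)+

lemma multilift_clinear: "mlin g \<Longrightarrow> clinear sP sV (\<lambda>f. multilift sV (us @ f # vs) g)"
proof (induction us arbitrary: g)
  case Nil
  have "clinear sP sV (lift sV (\<lambda>a. multilift sV vs (\<lambda>as. g (a # as))))"
    by (rule clinear_lift[OF P.cmodule_axioms V.cmodule_axioms])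
      (simp_all add: mlin_head[OF Nil] V.multilift_add_fun V.multilift_act_fun)
  then show ?case by simp
next
  case (Cons u us)
  have "clinear sP sV (\<lambda>f. multilift sV (us @ f # vs) (\<lambda>as. g (a # as)))" for a
    by (rule Cons.IH) (rule mlin_Cons[OF Cons.prems])
  then show ?case
    by (simp add: clinear_def V.lift_add_fun V.lift_act_fun)
qed

lemma multilift_Cons_add: "mlin g \<Longrightarrow> multilift sV vs (\<lambda>as. g ((a + b) # as)) = multilift sV vs (\<lambda>as. g (a # as)) + multilift sV vs (\<lambda>as. g (b # as))"
  by (simp add: mlin_head V.multilift_add_fun)

lemma multilift_cst: "mlin g \<Longrightarrow> multilift sV (map cst as) g = g as"
proof (induction as arbitrary: g)
  case (Cons a as)
  have "multilift sV (map cst (a # as)) g = multilift sV (map cst as) (\<lambda>as. g (a # as))"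
    by (simp add: V.lift_cst multilift_Cons_add[OF Cons.prems])
  then show ?case by (simp add: Cons.IH mlin_Cons Cons.prems)
qed simp

lemma multilift_insert_cst:
  "mlin g \<Longrightarrow> multilift sV (us @ cst x # vs) g = multilift sV (us @ vs) (\<lambda>as. g (take (length us) as @ x # drop (length us) as))"
proof (induction us arbitrary: g)
  case Nil
  then show ?case by (simp add: V.lift_cst multilift_Cons_add)
next
  case (Cons u us)
  then show ?case by (simp add: mlin_Cons)
qed

text \<open>Interchanging two arguments, as needed to transport skew-symmetry from constants to polynomials.\<close>
lemma multilift_swap:
  "multilift sV (us @ f # h # vs) g = multilift sV (us @ h # f # vs)
     (\<lambda>as. g (take (length us) as @ as ! Suc (length us) # as ! length us # drop (Suc (Suc (length us))) as))"
proof (induction us arbitrary: g)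
  case Nil
  show ?case by (simp add: V.lift_swap[of _ h f])
next
  case (Cons u us)
  show ?case by (simp, subst Cons.IH) simp
qed

lemma subst_lift:
  assumes "\<And>i. X i \<in> pure" "\<And>a b. g (a + b) = g a + g b" "\<And>c a. g (sP [:c:] a) = act sV (cst [:c:]) (g a)"
  shows "subst sV X (lift sV g f) = lift sV (\<lambda>a. subst sV X (g a)) (subst sP X f)"
proof (induction f rule: P.mpol_induct)
  have cl: "clinear sP sV (lift sV g)"
    by (rule clinear_lift[OF P.cmodule_axioms V.cmodule_axioms assms(2,3)])
  have cl': "clinear sP sV (lift sV (\<lambda>a. subst sV X (g a)))"
    by (rule clinear_lift[OF P.cmodule_axioms V.cmodule_axioms]) (simp_all add: assms V.subst_add V.subst_act C.subst_cst)
  {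
    case (cst a)
    then show ?case by (simp add: V.lift_cst assms V.subst_add)
  next
    case (add f g)
    then show ?case by (simp add: clinear_add[OF cl] clinear_add[OF cl'] P.subst_add V.subst_add)
  next
    case (var i f)
    then show ?case
      by (simp add: clinear_var[OF cl] clinear_pure[OF P.cmodule_axioms V.cmodule_axioms cl' assms(1)] P.subst_act V.subst_act)
  }
qed

lemma mlin_subst: "mlin g \<Longrightarrow> mlin (\<lambda>as. subst sV X (g as))"
  by (simp add: mlin_def V.subst_add V.subst_act C.subst_cst)

lemma subst_multilift:
  assumes "\<And>i. X i \<in> pure" "mlin g"
  shows "subst sV X (multilift sV fs g) = multilift sV (map (subst sP X) fs) (\<lambda>as. subst sV X (g as))"
  using assms(2)
proof (induction fs arbitrary: g)
  case (Cons f fs)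
  have "subst sV X (multilift sV (f # fs) g) = lift sV (\<lambda>a. subst sV X (multilift sV fs (\<lambda>as. g (a # as)))) (subst sP X f)"
    by (simp, rule subst_lift[OF assms(1)]) (simp_all add: mlin_head[OF Cons.prems] V.multilift_add_fun V.multilift_act_fun)
  then show ?case by (simp add: Cons.IH[OF mlin_Cons[OF Cons.prems]])
qed simp

end

text \<open>The substitution of the momenta of the arguments; indices without an argument get the momentum zero.\<close>
definition sub :: "nat multiset list \<Rightarrow> nat \<Rightarrow> coef" where
  "sub ms i = emb (if i < length ms then ms ! i else {#})"

text \<open>The generic arguments: constants with independent momenta. A bracket is recovered from its values there.\<close>
definition gslots :: "('p::zero) list \<Rightarrow> ('p mpol \<times> nat multiset) list" where
  "gslots as = map (\<lambda>i. (cst (as ! i), {#i#})) [0..<length as]"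

lemma length_gslots [simp]: "length (gslots as) = length as" by (simp add: gslots_def)
lemma nth_gslots [simp]: "i < length as \<Longrightarrow> gslots as ! i = (cst (as ! i), {#i#})" by (simp add: gslots_def)

lemma emb_sum_list: "emb (sum_list ms) = (\<Sum>m\<leftarrow>ms. emb m)"
  by (induction ms) simp_all

context npc_module
begin

sublocale PV: two_modules sP sV by (simp add: two_modules_def cmodule_P cmodule_V)

abbreviation co :: "('p mpol \<times> nat multiset) list \<Rightarrow> ('p mpol \<times> coef) list" where
  "co ss \<equiv> map (map_prod id emb) ss"

text \<open>The function of elements with momenta that belongs to a bracket.\<close>
definition ev :: "('p list \<Rightarrow> 'v mpol) \<Rightarrow> ('p mpol \<times> nat multiset) list \<Rightarrow> 'v mpol" where
  "ev \<gamma> ss = brk V \<gamma> (co ss)"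

definition gen :: "nat \<Rightarrow> nat multiset" where "gen k = mset [0..<k]"

lemma emb_gen: "emb (gen k) = (\<Sum>i<k. var i)"
  by (induction k) (simp_all add: gen_def add.commute)
lemma tot_gslots: "G.tot (gslots as) = gen (length as)"
proof -
  have "sum_list (map (\<lambda>i. {#i#}) xs) = mset xs" for xs :: "nat list" by (induction xs) simp_all
  then show ?thesis by (simp add: G.tot_def gslots_def gen_def o_def)
qed

lemma LB_off: "\<gamma> \<in> lambda_brackets P V k \<Longrightarrow> length as \<noteq> k \<Longrightarrow> \<gamma> as = 0"
  by (simp add: lambda_brackets_def)
lemma LB_vars: "\<gamma> \<in> lambda_brackets P V k \<Longrightarrow> in_vars {..<k - 1} (\<gamma> as)"
  by (cases "length as = k") (simp_all add: lambda_brackets_def in_vars_def)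
lemma LB_D:
  assumes "\<gamma> \<in> lambda_brackets P V k" "length as = k"
  shows "i < k \<Longrightarrow> \<gamma> (as[i := a + b]) = \<gamma> (as[i := a]) + \<gamma> (as[i := b])"
    "i < k \<Longrightarrow> \<gamma> (as[i := sP [:c:] (as ! i)]) = act sV (cst [:c:]) (\<gamma> as)"
    "i < k - 1 \<Longrightarrow> \<gamma> (as[i := del sP (as ! i)]) = act sV (- var i) (\<gamma> as)"
    "\<gamma> (as[k - 1 := del sP (as ! (k - 1))]) = act sV ((\<Sum>i<k - 1. var i) + dpar) (\<gamma> as)"
  using assms unfolding lambda_brackets_def by blast+
lemma LB_mlin: assumes "\<gamma> \<in> lambda_brackets P V k" shows "PV.mlin \<gamma>"
  unfolding PV.mlin_def
proof (intro conjI allI)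
  fix us a b vs
  show "\<gamma> (us @ (a + b) # vs) = \<gamma> (us @ a # vs) + \<gamma> (us @ b # vs)"
  proof (cases "length (us @ a # vs) = k")
    case True
    then have "\<gamma> ((us @ a # vs)[length us := a + b]) = \<gamma> ((us @ a # vs)[length us := a]) + \<gamma> ((us @ a # vs)[length us := b])"
      by (intro LB_D(1)[OF assms]) auto
    then show ?thesis by simp
  qed (use LB_off[OF assms] in auto)
  fix c
  show "\<gamma> (us @ sP [:c:] a # vs) = act sV (cst [:c:]) (\<gamma> (us @ a # vs))"
  proof (cases "length (us @ a # vs) = k")
    case True
    then have "\<gamma> ((us @ a # vs)[length us := sP [:c:] ((us @ a # vs) ! length us)]) = act sV (cst [:c:]) (\<gamma> (us @ a # vs))"
      by (intro LB_D(2)[OF assms]) auto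
    then show ?thesis by simp
  qed (use LB_off[OF assms] in auto)
qed
lemma LB_del:
  assumes "\<gamma> \<in> lambda_brackets P V k" "vs \<noteq> []"
  shows "\<gamma> (us @ del sP a # vs) = act sV (- var (length us)) (\<gamma> (us @ a # vs))"
proof (cases "length (us @ a # vs) = k")
  case True
  then have "\<gamma> ((us @ a # vs)[length us := del sP ((us @ a # vs) ! length us)]) = act sV (- var (length us)) (\<gamma> (us @ a # vs))"
    using assms(2) by (intro LB_D(3)[OF assms(1)]) auto
  then show ?thesis by simp
qed (use LB_off[OF assms(1)] in auto)
lemma LB_del_last:
  assumes "\<gamma> \<in> lambda_brackets P V k"
  shows "\<gamma> (us @ [del sP a]) = act sV ((\<Sum>i<length us. var i) + dpar) (\<gamma> (us @ [a]))"
proof (cases "length (us @ [a]) = k")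
  case True
  then have "\<gamma> ((us @ [a])[k - 1 := del sP ((us @ [a]) ! (k - 1))]) = act sV ((\<Sum>i<k - 1. var i) + dpar) (\<gamma> (us @ [a]))"
    by (intro LB_D(4)[OF assms]) auto
  then show ?thesis using True by auto
qed (use LB_off[OF assms(1)] in auto)

lemma LB_intro:
  assumes "0 < k" "\<And>as. length as \<noteq> k \<Longrightarrow> \<gamma> as = 0" "\<And>as. length as = k \<Longrightarrow> in_vars {..<k - 1} (\<gamma> as)" "PV.mlin \<gamma>"
    "\<And>us a vs. length us + Suc (length vs) = k \<Longrightarrow> vs \<noteq> [] \<Longrightarrow> \<gamma> (us @ del sP a # vs) = act sV (- var (length us)) (\<gamma> (us @ a # vs))"
    "\<And>us a. Suc (length us) = k \<Longrightarrow> \<gamma> (us @ [del sP a]) = act sV ((\<Sum>i<length us. var i) + dpar) (\<gamma> (us @ [a]))"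
  shows "\<gamma> \<in> lambda_brackets P V k"
  unfolding lambda_brackets_def
proof (intro CollectI conjI allI impI)
  fix as :: "'p list" assume len: "length as = k"
  have upd: "as[i := x] = take i as @ x # drop (Suc i) as" if "i < k" for i x
    using that len by (simp add: upd_conv_take_nth_drop)
  have split: "as = take i as @ as ! i # drop (Suc i) as" if "i < k" for i
    using that len by (simp add: id_take_nth_drop)
  show "\<forall>\<alpha>\<in>Poly_Mapping.keys (\<gamma> as). Poly_Mapping.keys \<alpha> \<subseteq> {..<k - 1}"
    using assms(3)[OF len] by (simp add: in_vars_def)
  { fix i a b assume "i < k"
    then show "\<gamma> (as[i := a + b]) = \<gamma> (as[i := a]) + \<gamma> (as[i := b])"
      using assms(4) by (simp add: upd PV.mlin_def) }
  { fix i c assume "i < k"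
    then show "\<gamma> (as[i := sP [:c:] (as ! i)]) = act sV (cst [:c:]) (\<gamma> as)"
      using assms(4) split[of i] unfolding PV.mlin_def by (metis upd) }
  { fix i assume i: "i < k - 1"
    then have "\<gamma> (take i as @ del sP (as ! i) # drop (Suc i) as) = act sV (- var (length (take i as))) (\<gamma> (take i as @ as ! i # drop (Suc i) as))"
      using len by (intro assms(5)) auto
    then show "\<gamma> (as[i := del sP (as ! i)]) = act sV (- var i) (\<gamma> as)"
      using i len split[of i] by (simp add: upd) }
  have "\<gamma> (take (k - 1) as @ [del sP (as ! (k - 1))]) = act sV ((\<Sum>i<length (take (k - 1) as). var i) + dpar) (\<gamma> (take (k - 1) as @ [as ! (k - 1)]))"
    using len assms(1) by (intro assms(6)) auto
  then show "\<gamma> (as[k - 1 := del sP (as ! (k - 1))]) = act sV ((\<Sum>i<k - 1. var i) + dpar) (\<gamma> as)"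
    using len split[of "k - 1"] assms(1) upd[of "k - 1"] by (simp add: min_def)
qed (use assms in auto)

lemma brk_eq:
  assumes "\<gamma> \<in> lambda_brackets P V k" "\<And>i. length ps = k \<Longrightarrow> i < k - 1 \<Longrightarrow> snd (ps ! i) = X i"
  shows "brk V \<gamma> ps = multilift sV (map fst ps) (\<lambda>as. subst sV X (\<gamma> as))"
  unfolding brk_def
proof (rule VM.multilift_cong)
  fix as :: "'p list" assume len: "length as = length (map fst ps)"
  show "subst sV (\<lambda>i. snd (ps ! i)) (\<gamma> as) = subst sV X (\<gamma> as)"
  proof (cases "length ps = k")
    case True
    then show ?thesis by (intro VM.subst_cong_vars[OF LB_vars[OF assms(1)]] assms(2)) auto
  qed (use len LB_off[OF assms(1)] in simp)
qed

lemma ev_eq: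
  assumes "\<gamma> \<in> lambda_brackets P V k"
  shows "ev \<gamma> ss = multilift sV (map fst ss) (\<lambda>as. subst sV (sub (map snd ss)) (\<gamma> as))"
  using brk_eq[OF assms, of "co ss" "sub (map snd ss)"] by (simp add: ev_def sub_def o_def)

lemma ev_off: "\<gamma> \<in> lambda_brackets P V k \<Longrightarrow> length ss \<noteq> k \<Longrightarrow> ev \<gamma> ss = 0"
  by (simp add: ev_eq LB_off cong: VM.multilift_cong)

lemma ev_zip:
  assumes "\<gamma> \<in> lambda_brackets P V k" "length as = length ms"
  shows "ev \<gamma> (zip (map cst as) ms) = subst sV (sub ms) (\<gamma> as)"
  using assms(2) by (simp add: ev_eq[OF assms(1)] PV.multilift_cst PV.mlin_subst LB_mlin[OF assms(1)])

lemma gslots_zip: "gslots as = zip (map cst as) (map (\<lambda>i. {#i#}) [0..<length as])"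
  by (rule nth_equalityI) simp_all

lemma ev_gslots:
  assumes "\<gamma> \<in> lambda_brackets P V k"
  shows "ev \<gamma> (gslots as) = \<gamma> as"
proof (cases "length as = k")
  case True
  then show ?thesis
    unfolding gslots_zip by (subst ev_zip[OF assms]) (auto intro!: VM.subst_id_vars[OF LB_vars[OF assms]] simp: sub_def)
qed (use LB_off[OF assms] ev_off[OF assms] in simp)

lemma scalar_pure: "q \<in> pure \<Longrightarrow> G.scalar (act sP q) (act sV q)"
  by (simp add: G.scalar_def VM.act_add2 br.prd_pure mu.prd_pure la.prd_pure lc.prd_pure rc.prd_pure)

lemma endo_rename: "G.endo (subst sP (\<lambda>i. emb (\<theta> i))) (rename \<theta>) (subst sV (\<lambda>i. emb (\<theta> i)))"
  by (simp add: G.endo_def VM.subst_diff rename_add subst_prd_emb substc_emb)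

lemma ev_Slotlin:
  assumes "\<gamma> \<in> lambda_brackets P V k" "q \<in> pure"
  shows "G.Slotlin (act sP q) (act sV q) (ev \<gamma>)"
  unfolding G.Slotlin_def
proof (intro allI)
  fix us f g p vs
  have cl: "clinear sP sV (\<lambda>f. multilift sV (map fst us @ f # map fst vs) (\<lambda>as. subst sV (sub (map snd us @ p # map snd vs)) (\<gamma> as)))"
    by (intro PV.multilift_clinear PV.mlin_subst LB_mlin[OF assms(1)])
  show "ev \<gamma> (us @ (f + act sP q g, p) # vs) = ev \<gamma> (us @ (f, p) # vs) + act sV q (ev \<gamma> (us @ (g, p) # vs))"
    by (simp add: ev_eq[OF assms(1)] clinear_add[OF cl] clinear_pure[OF cmodule_P cmodule_V cl assms(2)])
qed

lemma ev_Natural: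
  assumes "\<gamma> \<in> lambda_brackets P V k"
  shows "G.Natural (subst sP (\<lambda>i. emb (\<theta> i))) (rename \<theta>) (subst sV (\<lambda>i. emb (\<theta> i))) (ev \<gamma>)"
  unfolding G.Natural_def
proof
  fix ss :: "('p mpol \<times> nat multiset) list"
  have *: "substc (\<lambda>i. emb (\<theta> i)) (sub (map snd ss) i) = sub (map (rename \<theta>) (map snd ss)) i" for i
    by (simp add: sub_def substc_emb)
  show "subst sV (\<lambda>i. emb (\<theta> i)) (ev \<gamma> ss) = ev \<gamma> (map (map_prod (subst sP (\<lambda>i. emb (\<theta> i))) (rename \<theta>)) ss)"
    unfolding ev_eq[OF assms]
    by (subst PV.subst_multilift[OF emb_pure PV.mlin_subst[OF LB_mlin[OF assms]]])
      (simp add: VM.subst_subst * o_def)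
qed

lemma subst_zer: "f \<in> zer sV p \<Longrightarrow> subst sV (\<lambda>i. emb (\<theta> i)) f \<in> zer sV (rename \<theta> p)"
  by (auto simp: zer_def VM.subst_act mass_def substc_add substc_emb)

text \<open>For an argument that is not the last one, sesquilinearity gives \<open>- p\<close> exactly. For the last one it gives
  \<open>\<partial>\<close> plus the other momenta, which is \<open>- p\<close> only modulo \<open>\<partial>\<close> plus the total momentum.\<close>
lemma ev_Null:
  assumes "\<gamma> \<in> lambda_brackets P V k"
  shows "G.Null 0 (ev \<gamma>)"
  unfolding G.Null_def
proof (intro allI impI)
  fix us f p vs
  assume "f \<in> zer sP p"
  then obtain h where h: "f = act sP (mass p) h" by (auto simp: zer_def)
  let ?Z = "zer sV (0 + G.tot us + p + G.tot vs)" and ?X = "sub (map snd us @ p # map snd vs)"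
  let ?M = "\<lambda>f. multilift sV (map fst us @ f # map fst vs) (\<lambda>as. subst sV ?X (\<gamma> as))"
  have ml: "PV.mlin (\<lambda>as. subst sV ?X (\<gamma> as))" by (intro PV.mlin_subst LB_mlin[OF assms])
  have cl: "clinear sP sV ?M" by (rule PV.multilift_clinear[OF ml])
  have "?M (act sP (mass p) h) \<in> ?Z"
  proof (rule PM.clinear_mem[where T = "\<lambda>h. ?M (act sP (mass p) h)", OF cmodule_V VM.submod_zer])
    show "clinear sP sV (\<lambda>h. ?M (act sP (mass p) h))"
      by (rule clinear_comp[OF cl]) (rule la.act_clinear)
    fix a
    have "?M (act sP (mass p) (cst a)) = ?M (cst (del sP a)) + act sV (emb p) (?M (cst a))"
      by (simp add: mass_def PM.act_add1 PM.act_dpar_cst clinear_add[OF cl] clinear_pure[OF cmodule_P cmodule_V cl])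
    also have "\<dots> = multilift sV (map fst us @ map fst vs) (\<lambda>as. subst sV ?X (\<gamma> (take (length us) as @ del sP a # drop (length us) as))
       + act sV (emb p) (subst sV ?X (\<gamma> (take (length us) as @ a # drop (length us) as))))"
      by (simp add: PV.multilift_insert_cst[OF ml] VM.multilift_add_fun VM.multilift_act_fun)
    also have "\<dots> \<in> ?Z"
    proof (rule VM.multilift_mem[OF VM.submod_zer])
      fix as :: "'p list" assume len: "length as = length (map fst us @ map fst vs)"
      define w where "w = subst sV ?X (\<gamma> (take (length us) as @ a # drop (length us) as))"
      show "subst sV ?X (\<gamma> (take (length us) as @ del sP a # drop (length us) as)) + act sV (emb p) w \<in> ?Z"
      proof (cases vs)
        case Nil
        have "?X i = emb (map snd us ! i)" if "i < length us" for i
          using that by (simp add: sub_def nth_append)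
        then have "(\<Sum>i<length us. ?X i) = emb (G.tot us)"
          unfolding G.tot_def emb_sum_list by (subst sum_list_sum_nth) (simp add: atLeast0LessThan)
        then have "substc ?X ((\<Sum>i<length us. var i) + dpar) = emb (G.tot us) + dpar"
          by (simp add: substc_add) (simp add: C.subst_add C.subst_0 sum_comp_morphism[where h = "substc ?X", unfolded o_def, symmetric])
        then have "subst sV ?X (\<gamma> (take (length us) as @ [del sP a])) = act sV (emb (G.tot us) + dpar) w"
          using len Nil LB_del_last[OF assms, of as a] by (simp add: w_def VM.subst_act)
        then have "subst sV ?X (\<gamma> (take (length us) as @ del sP a # drop (length us) as)) + act sV (emb p) w
          = act sV (mass (0 + G.tot us + p + G.tot vs)) w"
          using Nil len by (simp add: mass_def VM.act_add1 add_ac)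
        then show ?thesis by (simp add: zer_def)
      next
        case (Cons y ys)
        have "?X (length us) = emb p" by (simp add: sub_def nth_append)
        moreover have "drop (length us) as \<noteq> []" using len Cons by simp
        ultimately have "subst sV ?X (\<gamma> (take (length us) as @ del sP a # drop (length us) as)) = - act sV (emb p) w"
          using len by (simp add: LB_del[OF assms] w_def VM.subst_act substc_minus VM.act_minus1 VM.subst_minus)
        then show ?thesis using VM.submodD(1)[OF VM.submod_zer] by simp
      qed
    qed
    finally show "?M (act sP (mass p) (cst a)) \<in> ?Z" .
  qed
  then show "ev \<gamma> (us @ (f, p) # vs) \<in> ?Z" by (simp add: ev_eq[OF assms] h)
qed

text \<open>The properties that characterize the functions coming from brackets in \<open>C\<^sup>m\<^sup>,\<^sup>n\<close>, including \<open>n = 0\<close>.\<close>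
definition cochain_fun :: "nat \<Rightarrow> (('p mpol \<times> nat multiset) list \<Rightarrow> 'v mpol) \<Rightarrow> bool" where
  "cochain_fun m F \<longleftrightarrow> (\<forall>q\<in>pure. G.Slotlin (act sP q) (act sV q) F) \<and> G.Null 0 F \<and> G.Alt 0 m F
     \<and> (\<forall>\<theta>. G.Natural (subst sP (\<lambda>i. emb (\<theta> i))) (rename \<theta>) (subst sV (\<lambda>i. emb (\<theta> i))) F)"

lemma one_pure: "1 \<in> pure" using pure_cst[of 1] by (simp add: cst_1 one_pCons[symmetric])

lemma Slotlin_Additive: "G.Slotlin (act sP 1) (act sV 1) F \<Longrightarrow> G.Additive F"
  by (simp add: G.Slotlin_def G.Additive_def)

lemma cochain_fun_Additive: "cochain_fun m F \<Longrightarrow> G.Additive F"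
  using one_pure Slotlin_Additive by (auto simp: cochain_fun_def)

lemma cochain_fun_CE: "cochain_fun m F \<Longrightarrow> cochain_fun (Suc m) (G.CE (Suc m) F)"
  using cochain_fun_Additive[of m F] unfolding cochain_fun_def
  by (auto intro: G.Slotlin_CE scalar_pure G.Null_CE G.Alt_CE G.Natural_CE endo_rename simp del: G.CE.simps)

lemma cochain_fun_Hoch: "cochain_fun m F \<Longrightarrow> cochain_fun m (G.Hoch 0 m F)"
  using cochain_fun_Additive[of m F] unfolding cochain_fun_def
  by (auto intro!: G.Slotlin_Hoch scalar_pure G.Null_Hoch G.Alt_Hoch G.Natural_Hoch endo_rename)

text \<open>A property of multilinear functions may be checked on constants.\<close>
lemma Slotlin_mem:
  assumes "\<And>q. q \<in> pure \<Longrightarrow> G.Slotlin (act sP q) (act sV q) F" "VM.submod Z"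
    "\<And>as. length as = length ss \<Longrightarrow> F (zip (map cst as) (map snd ss)) \<in> Z"
  shows "F ss \<in> Z"
  using assms(1,3)
proof (induction ss arbitrary: F)
  case Nil
  then show ?case using Nil(2)[of "[]"] by simp
next
  case (Cons x ss)
  obtain f p where x: "x = (f, p)" by (cases x)
  note lin = Cons.prems(1)
  have add: "F ((f + g, p) # ss) = F ((f, p) # ss) + F ((g, p) # ss)" for f g
    using G.SlotlinD1[OF lin[OF one_pure]] by simp
  have F0: "F ((0, p) # ss) = 0" using add[of 0 0] by simp
  have q: "F ((act sP q g, p) # ss) = act sV q (F ((g, p) # ss))" if "q \<in> pure" for q g
    using G.SlotlinD1[OF lin[OF that], of 0 g] by (simp add: F0)
  have "clinear sP sV (\<lambda>f. F ((f, p) # ss))"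
    unfolding clinear_def by (simp add: add q pure.intros)
  then have "F ((f, p) # ss) \<in> Z"
  proof (rule PM.clinear_mem[OF cmodule_V assms(2)])
    fix a
    show "F ((cst a, p) # ss) \<in> Z"
    proof (rule Cons.IH)
      show "G.Slotlin (act sP q) (act sV q) (\<lambda>t. F ((cst a, p) # t))" if "q \<in> pure" for q
        using G.Slotlin_Cons[OF lin[OF that]] .
      show "F ((cst a, p) # zip (map cst as) (map snd ss)) \<in> Z" if "length as = length ss" for as
        using Cons.prems(2)[of "a # as"] that by (simp add: x)
    qed
  qed
  then show ?case by (simp add: x)
qed

end

section \<open>Recovering brackets from functions\<close>

lemma nths_omit: "nths xs (- {i}) = omit i xs"
proof (induction xs arbitrary: i)
  case (Cons x xs)
  have "{j. Suc j \<in> - {i}} = (case i of 0 \<Rightarrow> UNIV | Suc i' \<Rightarrow> - {i'})" by (auto split: nat.splits)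
  then show ?case using Cons by (cases i) (simp_all add: nths_Cons nths_all)
qed (simp add: omit_def)

lemma omit2_simps [simp]: "omit2 0 (Suc j) (x # xs) = omit j xs" "omit2 (Suc i) (Suc j) (x # xs) = x # omit2 i j xs"
  by (simp_all add: omit2_def omit_def)

lemma nths_omit2: "i < j \<Longrightarrow> nths xs (- {i, j}) = omit2 i j xs"
proof (induction xs arbitrary: i j)
  case (Cons x xs)
  then obtain j' where j: "j = Suc j'" by (cases j) auto
  have "{l. Suc l \<in> - {i, j}} = (case i of 0 \<Rightarrow> - {j'} | Suc i' \<Rightarrow> - {i', j'})" using j by (auto split: nat.splits)
  then show ?case using Cons j by (cases i) (simp_all add: nths_Cons nths_omit)
qed (simp add: omit2_def)

lemma set_omit: "set (omit i xs) \<subseteq> set xs"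
  by (auto simp: omit_def dest: in_set_takeD in_set_dropD)
lemma set_omit2: "set (omit2 i j xs) \<subseteq> set xs"
  by (auto simp: omit2_def dest: in_set_takeD in_set_dropD)
lemma butlast_omit: "Suc i < length xs \<Longrightarrow> butlast (omit i xs) = omit i (butlast xs)"
  by (simp add: omit_def butlast_append butlast_drop take_butlast)
lemma butlast_omit2: "i < j \<Longrightarrow> Suc j < length xs \<Longrightarrow> butlast (omit2 i j xs) = omit2 i j (butlast xs)"
  by (simp add: omit2_def butlast_append butlast_drop take_butlast)

text \<open>The last subscript is exempt, as in \<^const>\<open>brk\<close>.\<close>
definition slots_in :: "nat set \<Rightarrow> (('p::zero) mpol \<times> coef) list \<Rightarrow> bool" where
  "slots_in S ps \<longleftrightarrow> (\<forall>x\<in>set ps. in_vars S (fst x)) \<and> (\<forall>x\<in>set (butlast ps). in_vars S (snd x))"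

lemma slots_in_omit: "slots_in S ps \<Longrightarrow> Suc i < length ps \<Longrightarrow> slots_in S (omit i ps)"
  using set_omit[of i ps] set_omit[of i "butlast ps"] by (auto simp: slots_in_def butlast_omit)
lemma slots_in_omit2: "slots_in S ps \<Longrightarrow> i < j \<Longrightarrow> Suc j < length ps \<Longrightarrow> slots_in S (omit2 i j ps)"
  using set_omit2[of i j ps] set_omit2[of i j "butlast ps"] by (auto simp: slots_in_def butlast_omit2)
lemma slots_in_update: "slots_in S ps \<Longrightarrow> in_vars S f \<Longrightarrow> (Suc j < length ps \<Longrightarrow> in_vars S X) \<Longrightarrow> slots_in S (ps[j := (f, X)])"
  using set_update_subset_insert[of ps j "(f, X)"] set_update_subset_insert[of "butlast ps" j "(f, X)"]
  unfolding slots_in_def by (cases "Suc j < length ps") (auto simp: butlast_list_update list_update_beyond split: if_splits)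
lemma slots_in_Cons: "slots_in S ps \<Longrightarrow> in_vars S f \<Longrightarrow> in_vars S X \<Longrightarrow> slots_in S ((f, X) # ps)"
  by (auto simp: slots_in_def split: if_splits)
lemma slots_in_snoc: "(\<forall>x\<in>set ps. in_vars S (fst x) \<and> in_vars S (snd x)) \<Longrightarrow> in_vars S f \<Longrightarrow> slots_in S (ps @ [(f, X)])"
  by (auto simp: slots_in_def)
lemma slots_in_take: "(\<forall>x\<in>set ps. in_vars S (fst x) \<and> in_vars S (snd x)) \<Longrightarrow> slots_in S ps"
  by (auto simp: slots_in_def dest: in_set_butlastD)

lemma slots_all_in: "k \<le> length as \<Longrightarrow> x \<in> set (take k (slots as)) \<Longrightarrow> in_vars {..<k} (fst x) \<and> in_vars {..<k} (snd x)"
  by (auto simp: slots_def take_map in_vars_var)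

lemma slots_in_slots: "slots_in {..<length as - 1} (slots as)"
proof -
  have "butlast (slots as) = take (length as - 1) (slots as)"
    by (simp add: butlast_conv_take slots_def)
  then show ?thesis
    using slots_all_in[of "length as - 1" as] by (auto simp: slots_in_def) (auto simp: slots_def)
qed

lemma in_vars_sgn: "in_vars S ((- 1) ^ i :: coef)"
  by (intro in_vars_power) (simp add: in_vars_minus)

lemma in_vars_dagger: "in_vars {..<k} (dagger k)"
  unfolding dagger_def by (intro in_vars_diff in_vars_dpar) (auto simp: in_vars_minus intro!: in_vars_sum in_vars_var)

lemma (in cmodule) act_sgn: "act s ((- 1) ^ i) v = sg i v"
  by (cases "even i") (simp_all add: sg_def act_minus1)

context npc_module
begin

lemma brk_in_vars:
  assumes "\<gamma> \<in> lambda_brackets P V k" "slots_in S ps"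
  shows "in_vars S (brk V \<gamma> ps)"
  unfolding brk_def
proof (rule VM.in_vars_multilift)
  show "in_vars S f" if "f \<in> set (map fst ps)" for f using that assms(2) by (auto simp: slots_in_def)
  fix as :: "'p list" assume len: "length as = length (map fst ps)"
  show "in_vars S (subst sV (\<lambda>i. snd (ps ! i)) (\<gamma> as))"
  proof (cases "length ps = k")
    case True
    have "in_vars S (snd (ps ! i))" if "i < k - 1" for i
    proof -
      have "ps ! i \<in> set (butlast ps)" using that True by (metis length_butlast nth_butlast nth_mem)
      then show ?thesis using assms(2) by (simp add: slots_in_def)
    qed
    then show ?thesis by (intro VM.in_vars_subst[OF LB_vars[OF assms(1)]]) auto
  qed (use len LB_off[OF assms(1)] in simp)
qed

lemma brk_cong:
  assumes "\<gamma> \<in> lambda_brackets P V k" "map fst ps = map fst qs" "VM.submod Z"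
    "\<And>i f. length ps = k \<Longrightarrow> i < k - 1 \<Longrightarrow> act sV (snd (ps ! i) - snd (qs ! i)) f \<in> Z"
  shows "brk V \<gamma> ps - brk V \<gamma> qs \<in> Z"
proof (cases "length ps = k")
  case True
  let ?X = "\<lambda>ps i. if i < k - 1 then snd (ps ! i) else 0 :: coef"
  have "brk V \<gamma> ps - brk V \<gamma> qs = multilift sV (map fst ps) (\<lambda>as. subst sV (?X ps) (\<gamma> as) - subst sV (?X qs) (\<gamma> as))"
    using brk_eq[OF assms(1), of ps "?X ps"] brk_eq[OF assms(1), of qs "?X qs"] by (simp add: VM.multilift_diff_fun assms(2))
  also have "\<dots> \<in> Z"
    using assms(4) True by (intro VM.multilift_mem VM.subst_cong assms(3)) (auto simp: VM.submodD[OF assms(3)])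
  finally show ?thesis .
next
  case False
  have "length qs = length ps" using assms(2) by (metis length_map)
  then have "brk V \<gamma> ps = 0" "brk V \<gamma> qs = 0"
    using False by (simp_all add: brk_def LB_off[OF assms(1)] cong: VM.multilift_cong)
  then show ?thesis by (simp add: VM.submodD[OF assms(3)])
qed

lemma slots_co: "slots as = co (gslots as)"
  by (simp add: slots_def gslots_def emb_def)

lemma mass_gen: "mass (gen (Suc k)) = var k - dagger k"
  by (simp add: mass_def emb_gen dagger_def)

text \<open>Substituting \<open>\<lambda>\<^sub>k\<^sup>\<dagger>\<close> for the last indeterminate annihilates \<open>\<partial>\<close> plus the total momentum and fixes polynomials
  without this indeterminate. So equality at the total momentum implies equality.\<close>
lemma eq_of_zer:
  assumes "0 < k" "in_vars {..<k - 1} f" "in_vars {..<k - 1} g" "f - g \<in> zer sV (gen k)"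
  shows "f = g"
proof -
  let ?X = "\<lambda>i. if i < k - 1 then var i else dagger (k - 1)"
  obtain h where h: "f - g = act sV (mass (gen k)) h" using assms(4) by (auto simp: zer_def)
  have k: "k = Suc (k - 1)" using assms(1) by simp
  have "substc ?X (dagger (k - 1)) = dagger (k - 1)"
    by (rule C.subst_id_vars[OF in_vars_dagger]) simp
  then have "substc ?X (mass (gen k)) = 0"
    by (subst k) (simp add: mass_gen substc_diff)
  then have "subst sV ?X (f - g) = 0" by (simp add: h VM.subst_act)
  moreover have "subst sV ?X (f - g) = f - g"
    by (rule VM.subst_id_vars[OF in_vars_diff[OF assms(2,3)]]) simp
  ultimately show ?thesis by simp
qed

lemma brk_perm:
  assumes "\<gamma> \<in> lambda_brackets P V k" "length xs = k"
  shows "brk V \<gamma> (map (\<lambda>i. (cst (xs ! \<sigma> i), h (\<sigma> i))) [0..<k]) = subst sV (\<lambda>i. h (\<sigma> i)) (\<gamma> (permute_list \<sigma> xs))"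
proof -
  have "brk V \<gamma> (map (\<lambda>i. (cst (xs ! \<sigma> i), h (\<sigma> i))) [0..<k])
    = multilift sV (map cst (permute_list \<sigma> xs)) (\<lambda>as. subst sV (\<lambda>i. h (\<sigma> i)) (\<gamma> as))"
    by (subst brk_eq[OF assms(1), where X = "\<lambda>i. h (\<sigma> i)"]) (auto simp: permute_list_def assms(2) o_def)
  then show ?thesis by (simp only: PV.multilift_cst[OF PV.mlin_subst[OF LB_mlin[OF assms(1)]]])
qed

lemma subst_dagger:
  assumes "0 < m"
  shows "subst sV (\<lambda>i. if \<sigma> i = m - 1 then dagger (m - 1) else var (\<sigma> i)) f - subst sV (\<lambda>i. var (\<sigma> i)) f \<in> zer sV (gen m)"
proof (rule VM.subst_cong[OF VM.submod_zer])
  fix i f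
  have "dagger (m - 1) - var (m - 1) = mass (gen m) * (- 1)" using mass_gen[of "m - 1"] assms by simp
  then have "act sV (dagger (m - 1) - var (m - 1)) f \<in> zer sV (gen m)" by (metis VM.act_mass_zer)
  then show "act sV ((if \<sigma> i = m - 1 then dagger (m - 1) else var (\<sigma> i)) - var (\<sigma> i)) f \<in> zer sV (gen m)"
    by (auto simp: VM.submodD[OF VM.submod_zer])
qed

lemma act_sign: "act sV (of_int (sign \<sigma>)) v = G.sgs (sign \<sigma>) v"
  by (cases \<sigma> rule: sign_cases) (simp_all add: G.sgs_def VM.act_minus1)

text \<open>The two definitions of skew-symmetry, with \<open>\<lambda>\<^sub>m\<^sup>\<dagger>\<close> for \<open>n = 0\<close> and without it for \<open>n \<ge> 1\<close>, agree when read at the total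
  momentum.\<close>
lemma Cmn_perm:
  assumes "\<gamma> \<in> Cmn P V m n" "0 < m + n" "length xs = m + n" "\<sigma> permutes {..<m}"
  shows "G.eqv (gen (m + n)) (subst sV (\<lambda>i. var (\<sigma> i)) (\<gamma> (permute_list \<sigma> xs))) (G.sgs (sign \<sigma>) (\<gamma> xs))"
proof (cases "n = 0")
  case True
  have LB: "\<gamma> \<in> lambda_brackets P V m" using assms(1) True by (simp add: Cmn_def)
  let ?D = "subst sV (\<lambda>i. if \<sigma> i = m - 1 then dagger (m - 1) else var (\<sigma> i)) (\<gamma> (permute_list \<sigma> xs))"
  have "\<gamma> xs = act sV (of_int (sign \<sigma>)) (brk V \<gamma>
         (map (\<lambda>i. (cst (xs ! \<sigma> i), if \<sigma> i = m - 1 then dagger (m - 1) else var (\<sigma> i))) [0..<m]))"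
    using assms True by (simp add: Cmn_def)
  also have "\<dots> = G.sgs (sign \<sigma>) ?D"
    using brk_perm[OF LB, of xs \<sigma> "\<lambda>i. if i = m - 1 then dagger (m - 1) else var i"] assms True by (simp add: act_sign)
  finally have "G.sgs (sign \<sigma>) (\<gamma> xs) = ?D" by (simp add: G.sgs_def split: if_splits)
  moreover have "G.eqv (gen m) ?D (subst sV (\<lambda>i. var (\<sigma> i)) (\<gamma> (permute_list \<sigma> xs)))"
    unfolding G.eqv_def using assms True by (intro subst_dagger) auto
  ultimately show ?thesis using True G.eqv_sym by simp
next
  case False
  have LB: "\<gamma> \<in> lambda_brackets P V (m + n)" using assms(1) by (simp add: Cmn_def)
  have "brk V \<gamma> (map (\<lambda>i. (cst (xs ! \<sigma> i), var (\<sigma> i))) [0..<m + n]) = act sV (of_int (sign \<sigma>)) (\<gamma> xs)"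
    using assms False by (simp add: Cmn_def)
  then have "subst sV (\<lambda>i. var (\<sigma> i)) (\<gamma> (permute_list \<sigma> xs)) = G.sgs (sign \<sigma>) (\<gamma> xs)"
    by (simp add: brk_perm[OF LB assms(3)] act_sign)
  then show ?thesis by simp
qed

lemma Cmn_intro:
  assumes LB: "\<gamma> \<in> lambda_brackets P V (m + n)" and pos: "0 < m + n"
    and perm: "\<And>xs \<sigma>. length xs = m + n \<Longrightarrow> \<sigma> permutes {..<m} \<Longrightarrow>
      G.eqv (gen (m + n)) (subst sV (\<lambda>i. var (\<sigma> i)) (\<gamma> (permute_list \<sigma> xs))) (G.sgs (sign \<sigma>) (\<gamma> xs))"
  shows "\<gamma> \<in> Cmn P V m n"
proof (cases "n = 0")
  case True
  have "\<gamma> xs = act sV (of_int (sign \<sigma>)) (brk V \<gamma>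
      (map (\<lambda>i. (cst (xs ! \<sigma> i), if \<sigma> i = m - 1 then dagger (m - 1) else var (\<sigma> i))) [0..<m]))"
    if xs: "length xs = m" and \<sigma>: "\<sigma> permutes {..<m}" for xs \<sigma>
  proof -
    let ?D = "subst sV (\<lambda>i. if \<sigma> i = m - 1 then dagger (m - 1) else var (\<sigma> i)) (\<gamma> (permute_list \<sigma> xs))"
    have D: "brk V \<gamma> (map (\<lambda>i. (cst (xs ! \<sigma> i), if \<sigma> i = m - 1 then dagger (m - 1) else var (\<sigma> i))) [0..<m]) = ?D"
      using brk_perm[of \<gamma> m xs \<sigma> "\<lambda>i. if i = m - 1 then dagger (m - 1) else var i"] LB True xs by simp
    have "G.eqv (gen m) ?D (subst sV (\<lambda>i. var (\<sigma> i)) (\<gamma> (permute_list \<sigma> xs)))"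
      unfolding G.eqv_def using pos True by (intro subst_dagger) auto
    also have "G.eqv (gen m) \<dots> (G.sgs (sign \<sigma>) (\<gamma> xs))"
      using perm[of xs \<sigma>] xs \<sigma> True by simp
    finally have "?D - G.sgs (sign \<sigma>) (\<gamma> xs) \<in> zer sV (gen m)" by (simp add: G.eqv_def)
    moreover have "in_vars {..<m - 1} ?D"
    proof (rule VM.in_vars_subst)
      show "in_vars {..<m} (\<gamma> (permute_list \<sigma> xs))"
        using LB_vars[OF LB, of "permute_list \<sigma> xs"] True by (auto elim!: in_vars_mono)
      fix i assume "i \<in> {..<m}"
      then have "\<sigma> i < m" using permutes_in_image[OF \<sigma>, of i] by simp
      then show "in_vars {..<m - 1} (if \<sigma> i = m - 1 then dagger (m - 1) else var (\<sigma> i))"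
        by (auto intro: in_vars_dagger in_vars_var)
    qed
    moreover have "in_vars {..<m - 1} (G.sgs (sign \<sigma>) (\<gamma> xs))"
      using LB_vars[OF LB, of xs] True by (simp add: G.sgs_def in_vars_minus)
    ultimately have "?D = G.sgs (sign \<sigma>) (\<gamma> xs)" using eq_of_zer pos True by auto
    then show ?thesis unfolding D by (simp add: act_sign G.sgs_def)
  qed
  then show ?thesis using LB True by (simp add: Cmn_def)
next
  case False
  have "brk V \<gamma> (map (\<lambda>i. (cst (xs ! \<sigma> i), var (\<sigma> i))) [0..<m + n]) = act sV (of_int (sign \<sigma>)) (\<gamma> xs)"
    if xs: "length xs = m + n" and \<sigma>: "\<sigma> permutes {..<m}" for xs \<sigma>
  proof -
    let ?D = "subst sV (\<lambda>i. var (\<sigma> i)) (\<gamma> (permute_list \<sigma> xs))"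
    have "in_vars {..<m + n - 1} ?D"
    proof (rule VM.in_vars_subst[OF LB_vars[OF LB]])
      fix i assume i: "i \<in> {..<m + n - 1}"
      have "\<sigma> i < m + n - 1"
      proof (cases "i < m")
        case True
        then have "\<sigma> i < m" using permutes_in_image[OF \<sigma>, of i] by simp
        then show ?thesis using False by simp
      next
        case False
        then show ?thesis using i permutes_not_in[OF \<sigma>, of i] by simp
      qed
      then show "in_vars {..<m + n - 1} (var (\<sigma> i))" by (auto intro: in_vars_var)
    qed
    moreover have "in_vars {..<m + n - 1} (G.sgs (sign \<sigma>) (\<gamma> xs))"
      using LB_vars[OF LB, of xs] by (simp add: G.sgs_def in_vars_minus)
    ultimately have "?D = G.sgs (sign \<sigma>) (\<gamma> xs)"
      using perm[OF xs \<sigma>] by (intro eq_of_zer[OF pos]) (auto simp: G.eqv_def)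
    then show ?thesis using brk_perm[OF LB xs, of \<sigma> var] by (simp add: act_sign)
  qed
  then show ?thesis using LB False by (simp add: Cmn_def)
qed

lemma Cmn_LB: "\<gamma> \<in> Cmn P V m n \<Longrightarrow> \<gamma> \<in> lambda_brackets P V (m + n)"
  by (simp add: Cmn_def)

lemma rename_sub_gen: "rename (\<lambda>i. if i < length ms then ms ! i else {#}) (gen (length ms)) = sum_list ms"
proof (induction ms rule: rev_induct)
  case (snoc m ms)
  have "rename (\<lambda>i. if i < length (ms @ [m]) then (ms @ [m]) ! i else {#}) (gen (length ms)) = rename (\<lambda>i. if i < length ms then ms ! i else {#}) (gen (length ms))"
    unfolding rename_def by (intro arg_cong[where f = sum_mset] image_mset_cong) (auto simp: gen_def nth_append)
  moreover have "gen (length (ms @ [m])) = gen (length ms) + {#length ms#}" by (simp add: gen_def)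
  ultimately show ?case using snoc by (simp add: rename_def add.commute)
qed (simp add: gen_def)

lemma subst_sub_zer:
  assumes "f \<in> zer sV (gen (length ms))"
  shows "subst sV (sub ms) f \<in> zer sV (sum_list ms)"
  using subst_zer[OF assms, of "\<lambda>i. if i < length ms then ms ! i else {#}"]
  unfolding rename_sub_gen sub_def[abs_def] .

lemma cochain_fun_ev:
  assumes "\<gamma> \<in> Cmn P V m n" "0 < m + n"
  shows "cochain_fun m (ev \<gamma>)"
proof -
  note LB = Cmn_LB[OF assms(1)]
  have "G.Alt 0 m (ev \<gamma>)"
    unfolding G.Alt_def
  proof (intro allI impI)
    fix us vs :: "('p mpol \<times> nat multiset) list" and x y
    assume us: "length us + 2 \<le> m"
    define i where "i = length us"
    define ms where "ms = map snd (us @ x # y # vs)"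
    let ?\<sigma> = "Transposition.transpose i (Suc i)"
    let ?sw = "\<lambda>as. take i as @ as ! Suc i # as ! i # drop (Suc (Suc i)) as"
    have ms': "sub (map snd (us @ y # x # vs)) j = sub ms (?\<sigma> j)" for j
    proof -
      consider "j < i" | "j = i" | "j = Suc i" | l where "j = Suc (Suc i) + l"
        by (metis less_Suc_eq not_less less_eqE Suc_leI)
      then show ?thesis by cases (simp_all add: sub_def ms_def i_def nth_append Transposition.transpose_def)
    qed
    have tot: "sum_list ms = 0 + G.tot us + snd x + snd y + G.tot vs"
      by (simp add: ms_def G.tot_def add_ac)
    have "ev \<gamma> (us @ x # y # vs) + ev \<gamma> (us @ y # x # vs)
      = multilift sV (map fst (us @ x # y # vs)) (\<lambda>as. subst sV (sub ms) (\<gamma> as) + subst sV (\<lambda>j. sub ms (?\<sigma> j)) (\<gamma> (?sw as)))"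
      unfolding VM.multilift_add_fun ev_eq[OF LB] ms'[abs_def]
      by (simp add: ms_def i_def PV.multilift_swap[of "map fst us" "fst y" "fst x"])
    also have "\<dots> \<in> zer sV (sum_list ms)"
    proof (rule VM.multilift_mem[OF VM.submod_zer])
      fix as :: "'p list" assume "length as = length (map fst (us @ x # y # vs))"
      then have len: "length as = length ms" "Suc i < length as" by (simp_all add: ms_def i_def)
      show "subst sV (sub ms) (\<gamma> as) + subst sV (\<lambda>j. sub ms (?\<sigma> j)) (\<gamma> (?sw as)) \<in> zer sV (sum_list ms)"
      proof (cases "length as = m + n")
        case True
        have "as = take i as @ as ! i # as ! Suc i # drop (Suc (Suc i)) as"
          using len by (metis Cons_nth_drop_Suc Suc_lessD id_take_nth_drop)
        then have sw: "permute_list ?\<sigma> as = ?sw as"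
          using G.permute_list_adjacent[of "take i as" "as ! i" "as ! Suc i"] len by (metis length_take min.absorb2 less_imp_le_nat Suc_lessD)
        have "?\<sigma> permutes {..<m}" using us by (intro permutes_swap_id) (auto simp: i_def)
        from Cmn_perm[OF assms(1,2) True this]
        have "G.eqv (gen (length ms)) (subst sV (\<lambda>j. var (?\<sigma> j)) (\<gamma> (?sw as))) (- \<gamma> as)"
          using True len by (simp add: sw sign_swap_id G.sgs_def)
        then have "\<gamma> as + subst sV (\<lambda>j. var (?\<sigma> j)) (\<gamma> (?sw as)) \<in> zer sV (gen (length ms))"
          by (simp add: G.eqv_def add.commute)
        from subst_sub_zer[OF this] show ?thesis
          by (simp add: VM.subst_add VM.subst_subst)
      qed (use LB_off[OF LB] len VM.submodD(1)[OF VM.submod_zer] in simp)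
    qed
    finally show "ev \<gamma> (us @ x # y # vs) + ev \<gamma> (us @ y # x # vs) \<in> zer sV (0 + G.tot us + snd x + snd y + G.tot vs)"
      by (simp add: tot)
  qed
  then show ?thesis
    unfolding cochain_fun_def using ev_Slotlin[OF LB] ev_Null[OF LB] ev_Natural[OF LB] by auto
qed

text \<open>\<open>\<gamma>\<close> and \<open>F\<close> are the same cochain.\<close>
definition represents :: "nat \<Rightarrow> nat \<Rightarrow> ('p list \<Rightarrow> 'v mpol) \<Rightarrow> (('p mpol \<times> nat multiset) list \<Rightarrow> 'v mpol) \<Rightarrow> bool" where
  "represents m n \<gamma> F \<longleftrightarrow> \<gamma> \<in> Cmn P V m n \<and> cochain_fun m F \<and> (\<forall>ss. length ss = m + n \<longrightarrow> G.eqv (G.tot ss) (ev \<gamma> ss) (F ss))"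

lemma represents_ev: "\<gamma> \<in> Cmn P V m n \<Longrightarrow> 0 < m + n \<Longrightarrow> represents m n \<gamma> (ev \<gamma>)"
  by (simp add: represents_def cochain_fun_ev)

text \<open>Both brackets agree with the same function at the generic arguments, up to equality at the total momentum.\<close>
lemma represents_unique:
  assumes "represents m n \<gamma> F" "represents m n \<delta> F'" "0 < m + n" "\<And>ss. length ss = m + n \<Longrightarrow> G.eqv (G.tot ss) (F ss) (F' ss)"
  shows "\<gamma> = \<delta>"
proof
  fix as
  have LB: "\<gamma> \<in> lambda_brackets P V (m + n)" "\<delta> \<in> lambda_brackets P V (m + n)"
    using assms by (auto simp: represents_def Cmn_def)
  show "\<gamma> as = \<delta> as"
  proof (cases "length as = m + n")
    case True
    have "G.eqv (gen (m + n)) (ev \<gamma> (gslots as)) (F (gslots as))"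
      using assms(1) True tot_gslots[of as] unfolding represents_def by (metis length_gslots)
    also have "G.eqv (gen (m + n)) \<dots> (F' (gslots as))"
      using assms(4)[of "gslots as"] True by (simp add: tot_gslots)
    also have "G.eqv (gen (m + n)) \<dots> (ev \<delta> (gslots as))"
      using assms(2) True tot_gslots[of as] unfolding represents_def by (metis length_gslots G.eqv_sym)
    finally have "\<gamma> as - \<delta> as \<in> zer sV (gen (m + n))"
      by (simp add: G.eqv_def ev_gslots[OF LB(1)] ev_gslots[OF LB(2)])
    then show ?thesis by (intro eq_of_zer[OF assms(3)] LB_vars LB)
  qed (simp add: LB_off[OF LB(1)] LB_off[OF LB(2)])
qed

lemma eqv_act: "G.eqv p v w \<Longrightarrow> G.eqv p (act sV c v) (act sV c w)"
  unfolding G.eqv_def by (simp add: VM.submodD(3)[OF VM.submod_zer] flip: VM.act_diff2)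

lemma gslots_insert:
  "\<exists>A B. \<forall>x. gslots (us @ x # vs) = A @ (cst x, {#length us#}) # B"
proof (intro exI allI)
  fix x
  show "gslots (us @ x # vs) = gslots us @ (cst x, {#length us#}) # map (\<lambda>i. (cst (vs ! i), {#Suc (length us + i)#})) [0..<length vs]"
    by (rule nth_equalityI) (auto simp: nth_append nth_Cons' gslots_def simp del: upt_Suc)
qed

lemma Slotlin_act:
  assumes "G.Additive F" "G.Slotlin (act sP q) (act sV q) F"
  shows "F (us @ (act sP q g, p) # vs) = act sV q (F (us @ (g, p) # vs))"
  using G.SlotlinD[OF assms(2), of us 0 g p vs] G.AdditiveD[OF assms(1), of us 0 0 p vs] by simp

text \<open>Each identity required of \<open>\<gamma>\<close> holds for \<open>F\<close> at the total momentum, and both sides of the identity do not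
  involve the last indeterminate, so \<open>eq_of_zer\<close> applies. Naturality extends the relation between \<open>\<gamma>\<close> and \<open>F\<close> from
  generic to arbitrary momenta, multilinearity from constants to polynomials.\<close>
lemma represents_intro:
  assumes cochain_fun: "cochain_fun m F" and pos: "0 < m + n" and off: "\<And>as. length as \<noteq> m + n \<Longrightarrow> \<gamma> as = 0"
    and vars: "\<And>as. length as = m + n \<Longrightarrow> in_vars {..<m + n - 1} (\<gamma> as)"
    and eqv: "\<And>as. length as = m + n \<Longrightarrow> G.eqv (gen (m + n)) (\<gamma> as) (F (gslots as))"
  shows "represents m n \<gamma> F"
proof -
  let ?k = "m + n"
  have add: "G.Additive F" by (rule cochain_fun_Additive[OF cochain_fun])
  have slot: "q \<in> pure \<Longrightarrow> G.Slotlin (act sP q) (act sV q) F" for q using cochain_fun by (simp add: cochain_fun_def)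
  note F_act = Slotlin_act[OF add slot]
  have null: "G.Null 0 F" and nat: "G.Natural (subst sP (\<lambda>i. emb (\<theta> i))) (rename \<theta>) (subst sV (\<lambda>i. emb (\<theta> i))) F" for \<theta>
    using cochain_fun by (auto simp: cochain_fun_def)
  have vars': "in_vars {..<?k - 1} (\<gamma> as)" for as using vars off by (cases "length as = ?k") auto
  have mlin: "PV.mlin \<gamma>"
    unfolding PV.mlin_def
  proof (intro conjI allI)
    fix us vs :: "'p list" and a b :: 'p
    obtain A B where AB: "\<And>x. gslots (us @ x # vs) = A @ (cst x, {#length us#}) # B" using gslots_insert by blast
    show "\<gamma> (us @ (a + b) # vs) = \<gamma> (us @ a # vs) + \<gamma> (us @ b # vs)"
    proof (cases "Suc (length us + length vs) = ?k")
      case True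
      then have "G.eqv (gen ?k) (\<gamma> (us @ (a + b) # vs)) (F (gslots (us @ (a + b) # vs)))" by (intro eqv) simp
      also have "F (gslots (us @ (a + b) # vs)) = F (gslots (us @ a # vs)) + F (gslots (us @ b # vs))"
        by (simp add: AB cst_add G.AdditiveD[OF add])
      also have "G.eqv (gen ?k) \<dots> (\<gamma> (us @ a # vs) + \<gamma> (us @ b # vs))"
        using True by (intro G.eqv_add G.eqv_sym[OF eqv]) simp_all
      finally show ?thesis by (intro eq_of_zer[OF pos] in_vars_add vars') (simp add: G.eqv_def)
    qed (simp add: off)
    fix c
    show "\<gamma> (us @ sP [:c:] a # vs) = act sV (cst [:c:]) (\<gamma> (us @ a # vs))"
    proof (cases "Suc (length us + length vs) = ?k")
      case True
      then have "G.eqv (gen ?k) (\<gamma> (us @ sP [:c:] a # vs)) (F (gslots (us @ sP [:c:] a # vs)))" by (intro eqv) simp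
      also have "F (gslots (us @ sP [:c:] a # vs)) = act sV (cst [:c:]) (F (gslots (us @ a # vs)))"
        by (simp add: AB F_act pure_cst flip: PM.act_cst)
      also have "G.eqv (gen ?k) \<dots> (act sV (cst [:c:]) (\<gamma> (us @ a # vs)))"
        using True by (intro eqv_act G.eqv_sym[OF eqv]) simp_all
      finally show ?thesis by (intro eq_of_zer[OF pos] VM.in_vars_act in_vars_cst vars') (simp add: G.eqv_def)
    qed (simp add: off)
  qed
  have del: "G.eqv (gen ?k) (\<gamma> (us @ del sP a # vs)) (act sV (- var (length us)) (\<gamma> (us @ a # vs)))"
    if "Suc (length us + length vs) = ?k" for us a vs
  proof -
    obtain A B where AB: "\<And>x. gslots (us @ x # vs) = A @ (cst x, {#length us#}) # B" using gslots_insert by blast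
    have tot: "0 + G.tot A + {#length us#} + G.tot B = gen ?k"
      using tot_gslots[of "us @ a # vs"] that by (simp add: AB)
    have "F (A @ (act sP (mass {#length us#}) (cst a), {#length us#}) # B) \<in> zer sV (0 + G.tot A + {#length us#} + G.tot B)"
      by (rule G.NullD[OF null]) (simp add: zer_def)
    then have "F (gslots (us @ del sP a # vs)) + act sV (var (length us)) (F (gslots (us @ a # vs))) \<in> zer sV (gen ?k)"
      unfolding tot by (simp add: mass_def PM.act_add1 PM.act_dpar_cst G.AdditiveD[OF add] F_act pure_var AB)
    then have "G.eqv (gen ?k) (F (gslots (us @ del sP a # vs))) (act sV (- var (length us)) (F (gslots (us @ a # vs))))"
      by (simp add: G.eqv_def VM.act_minus1)
    moreover have "G.eqv (gen ?k) (\<gamma> (us @ del sP a # vs)) (F (gslots (us @ del sP a # vs)))"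
      "G.eqv (gen ?k) (act sV (- var (length us)) (F (gslots (us @ a # vs)))) (act sV (- var (length us)) (\<gamma> (us @ a # vs)))"
      using that by (auto intro!: eqv eqv_act G.eqv_sym[OF eqv])
    ultimately show ?thesis by (metis G.eqv_trans)
  qed
  have LB: "\<gamma> \<in> lambda_brackets P V ?k"
  proof (rule LB_intro[OF pos off vars mlin])
    fix us vs :: "'p list" and a
    assume len: "length us + Suc (length vs) = ?k" and "vs \<noteq> []"
    then have "length us < ?k - 1" by (cases vs) auto
    then have "in_vars {..<?k - 1} (act sV (- var (length us)) (\<gamma> (us @ a # vs)))"
      by (intro VM.in_vars_act vars') (simp add: in_vars_minus in_vars_var)
    then show "\<gamma> (us @ del sP a # vs) = act sV (- var (length us)) (\<gamma> (us @ a # vs))"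
      using del[of us vs a] len by (intro eq_of_zer[OF pos] vars') (simp_all add: G.eqv_def)
  next
    fix us :: "'p list" and a
    assume len: "Suc (length us) = ?k"
    have "(- var (length us)) - ((\<Sum>i<length us. var i) + dpar) = mass (gen ?k) * (- 1)"
      using mass_gen[of "length us"] len by (simp add: dagger_def)
    then have "act sV ((- var (length us)) - ((\<Sum>i<length us. var i) + dpar)) (\<gamma> (us @ [a])) \<in> zer sV (gen ?k)"
      by (metis VM.act_mass_zer)
    then have "G.eqv (gen ?k) (act sV (- var (length us)) (\<gamma> (us @ [a]))) (act sV ((\<Sum>i<length us. var i) + dpar) (\<gamma> (us @ [a])))"
      by (simp add: G.eqv_def VM.act_diff1)
    then have "G.eqv (gen ?k) (\<gamma> (us @ [del sP a])) (act sV ((\<Sum>i<length us. var i) + dpar) (\<gamma> (us @ [a])))"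
      using del[of us "[]" a] len by (metis G.eqv_trans add.right_neutral list.size(3))
    moreover have "in_vars {..<?k - 1} (act sV ((\<Sum>i<length us. var i) + dpar) (\<gamma> (us @ [a])))"
      using len by (intro VM.in_vars_act vars' in_vars_add in_vars_sum in_vars_var in_vars_dpar) auto
    ultimately show "\<gamma> (us @ [del sP a]) = act sV ((\<Sum>i<length us. var i) + dpar) (\<gamma> (us @ [a]))"
      by (intro eq_of_zer[OF pos] vars') (simp_all add: G.eqv_def)
  qed
  have ev: "G.eqv (G.tot ss) (ev \<gamma> ss) (F ss)" if len: "length ss = ?k" for ss
    unfolding G.eqv_def
  proof (rule Slotlin_mem[OF _ VM.submod_zer])
    fix q assume q: "q \<in> pure"
    show "G.Slotlin (act sP q) (act sV q) (\<lambda>ss. ev \<gamma> ss - F ss)"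
      using ev_Slotlin[OF LB q] slot[OF q] unfolding G.Slotlin_def by (simp add: VM.act_diff2)
  next
    fix as :: "'p list" assume las: "length as = length ss"
    let ?ms = "map snd ss"
    let ?\<theta> = "\<lambda>i. if i < length ?ms then ?ms ! i else {#}"
    have "\<gamma> as - F (gslots as) \<in> zer sV (gen (length ?ms))" using eqv[of as] las len by (simp add: G.eqv_def)
    from subst_sub_zer[OF this]
    have "subst sV (sub ?ms) (\<gamma> as) - subst sV (sub ?ms) (F (gslots as)) \<in> zer sV (G.tot ss)"
      by (simp add: VM.subst_diff G.tot_def)
    moreover have "subst sV (sub ?ms) (F (gslots as)) = F (zip (map cst as) ?ms)"
    proof -
      have "subst sV (sub ?ms) (F (gslots as)) = F (map (map_prod (subst sP (\<lambda>i. emb (?\<theta> i))) (rename ?\<theta>)) (gslots as))"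
        using nat[of ?\<theta>] unfolding G.Natural_def sub_def[abs_def] by blast
      also have "map (map_prod (subst sP (\<lambda>i. emb (?\<theta> i))) (rename ?\<theta>)) (gslots as) = zip (map cst as) ?ms"
        by (rule nth_equalityI) (simp_all add: las)
      finally show ?thesis .
    qed
    ultimately show "ev \<gamma> (zip (map cst as) ?ms) - F (zip (map cst as) ?ms) \<in> zer sV (G.tot ss)"
      using las by (simp add: ev_zip[OF LB])
  qed
  have "\<gamma> \<in> Cmn P V m n"
  proof (rule Cmn_intro[OF LB pos])
    fix xs :: "'p list" and \<sigma>
    assume xs: "length xs = ?k" and \<sigma>: "\<sigma> permutes {..<m}"
    have \<sigma>k: "\<sigma> permutes {..<?k}" using \<sigma> by (rule permutes_subset) auto
    let ?\<theta> = "\<lambda>i. {#\<sigma> i#}"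
    let ?ys = "permute_list \<sigma> xs"
    have "\<gamma> ?ys - F (gslots ?ys) \<in> zer sV (gen ?k)" using eqv[of ?ys] xs by (simp add: G.eqv_def)
    from subst_zer[OF this, of ?\<theta>]
    have 1: "subst sV (\<lambda>i. var (\<sigma> i)) (\<gamma> ?ys) - subst sV (\<lambda>i. var (\<sigma> i)) (F (gslots ?ys)) \<in> zer sV (rename ?\<theta> (gen ?k))"
      by (simp add: VM.subst_diff)
    have "rename ?\<theta> (gen ?k) = image_mset \<sigma> (gen ?k)" unfolding rename_def by (induction "gen ?k") auto
    also have "\<dots> = gen ?k"
      using permutes_inj_on[OF \<sigma>k, of "{..<?k}"] permutes_image[OF \<sigma>k]
      by (simp add: gen_def mset_upt atLeast0LessThan image_mset_mset_set)
    finally have 2: "rename ?\<theta> (gen ?k) = gen ?k" .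
    have "subst sV (\<lambda>i. var (\<sigma> i)) (F (gslots ?ys)) = F (map (map_prod (subst sP (\<lambda>i. emb (?\<theta> i))) (rename ?\<theta>)) (gslots ?ys))"
      using nat[of ?\<theta>] unfolding G.Natural_def by simp
    also have "map (map_prod (subst sP (\<lambda>i. emb (?\<theta> i))) (rename ?\<theta>)) (gslots ?ys) = permute_list \<sigma> (gslots xs)"
    proof (rule nth_equalityI)
      fix i assume i: "i < length (map (map_prod (subst sP (\<lambda>i. emb (?\<theta> i))) (rename ?\<theta>)) (gslots ?ys))"
      then have "\<sigma> i < length xs" using permutes_in_image[OF \<sigma>k, of i] xs by simp
      then show "map (map_prod (subst sP (\<lambda>i. emb (?\<theta> i))) (rename ?\<theta>)) (gslots ?ys) ! i = permute_list \<sigma> (gslots xs) ! i"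
        using i \<sigma>k xs by (simp add: permute_list_nth)
    qed simp
    finally have 3: "subst sV (\<lambda>i. var (\<sigma> i)) (F (gslots ?ys)) = F (permute_list \<sigma> (gslots xs))" .
    have "G.eqv (gen ?k) (subst sV (\<lambda>i. var (\<sigma> i)) (\<gamma> ?ys)) (F (permute_list \<sigma> (gslots xs)))"
      using 1 2 3 by (simp add: G.eqv_def)
    also have "G.eqv (gen ?k) \<dots> (G.sgs (sign \<sigma>) (F (gslots xs)))"
      using G.Alt_permute[of m F \<sigma> "gslots xs"] cochain_fun \<sigma> xs by (simp add: cochain_fun_def tot_gslots)
    also have "G.eqv (gen ?k) \<dots> (G.sgs (sign \<sigma>) (\<gamma> xs))"
      by (intro G.eqv_sgs G.eqv_sym[OF eqv] xs)
    finally show "G.eqv (gen ?k) (subst sV (\<lambda>i. var (\<sigma> i)) (\<gamma> ?ys)) (G.sgs (sign \<sigma>) (\<gamma> xs))" .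
  qed
  then show ?thesis using cochain_fun ev by (simp add: represents_def)
qed

end

section \<open>The differentials of brackets\<close>

lemma (in momentum_poisson) CE_cong: "(\<And>t. Suc (length t) = length ss \<Longrightarrow> G t = G' t) \<Longrightarrow> CE m G ss = CE m G' ss"
proof (induction m G ss arbitrary: G' rule: CE.induct)
  case (3 m G x ss)
  have "CE m (\<lambda>t. G (x # t)) ss = CE m (\<lambda>t. G' (x # t)) ss"
    by (rule "3.IH") (simp add: "3.prems")
  moreover have "Lie x G ss = Lie x G' ss" by (rule Lie_cong) (simp add: "3.prems")
  ultimately show ?case by simp
qed simp_all

lemma (in momentum_poisson) CE_eqv:
  assumes "\<And>t. Suc (length t) = length ss \<Longrightarrow> eqv (tot t) (G t) (G' t)"
  shows "eqv (tot ss) (CE m G ss) (CE m G' ss)"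
proof -
  \<comment> \<open>the differential evaluates only lists that are shorter by one, so that all other values may be changed to \<open>0\<close>\<close>
  let ?T = "\<lambda>t. if Suc (length t) = length ss then G t - G' t else 0"
  have "CE m ?T ss \<in> ZW (0 + tot ss)" by (rule CE_Z) (use assms in \<open>simp add: eqv_def ZW_0\<close>)
  moreover have "CE m ?T ss = CE m (\<lambda>t. G t - G' t) ss" by (rule CE_cong) simp
  ultimately show ?thesis by (simp add: eqv_def CE_diff)
qed

lemma (in momentum_poisson) Hoch_eqv:
  assumes "\<And>t. Suc (length t) = length ss \<Longrightarrow> eqv (tot t) (G t) (G' t)"
  shows "eqv (tot ss) (Hoch 0 m G ss) (Hoch 0 m G' ss)"
proof -
  \<comment> \<open>the differential evaluates only lists that are shorter by one, so that all other values may be changed to \<open>0\<close>\<close>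
  let ?T = "\<lambda>t. if Suc (length t) = length ss then G t - G' t else 0"
  have "Hoch 0 m ?T ss \<in> ZW (0 + tot ss)" by (rule Hoch_Z) (use assms in \<open>simp add: eqv_def ZW_0\<close>)
  moreover have "Hoch 0 m ?T ss = Hoch 0 m (\<lambda>t. G t - G' t) ss" by (rule Hoch_cong) simp
  ultimately show ?thesis by (simp add: eqv_def Hoch_diff)
qed

lemma omit_map: "omit i (map f xs) = map f (omit i xs)"
  by (simp add: omit_def take_map drop_map)
lemma omit2_map: "omit2 i j (map f xs) = map f (omit2 i j xs)"
  by (simp add: omit2_def take_map drop_map)

context npc_module
begin

lemma bra_gslots: "i < length as \<Longrightarrow> j < length as \<Longrightarrow>
   G.bra (gslots as ! i) (gslots as ! j) = (brakP P (var i) (cst (as ! i)) (cst (as ! j)), {#i#} + {#j#})"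
  by (simp add: G.bra_def)
lemma mul_gslots: "i < length as \<Longrightarrow> j < length as \<Longrightarrow>
   G.mul (gslots as ! i) (gslots as ! j) = (circP P (var i) (cst (as ! i)) (cst (as ! j)), {#i#} + {#j#})"
  by (simp add: G.mul_def)

lemma d_CE_skew:
  assumes "length as = m + 1 + n" "1 \<le> n"
  shows "d_CE P V m n \<gamma> as = G.CE_skew (Suc m) (ev \<gamma>) (gslots as)"
proof -
  have 1: "brk V \<gamma> (nths (slots as) (- {i})) = ev \<gamma> (omit i (gslots as))" for i
    by (simp add: ev_def nths_omit slots_co omit_map)
  have 2: "brk V \<gamma> (nths ((slots as)[j := (brakP P (var i) (cst (as ! i)) (cst (as ! j)), var i + var j)]) (- {i}))
    = ev \<gamma> (omit i ((gslots as)[j := G.bra (gslots as ! i) (gslots as ! j)]))" if "i < length as" "j < length as" for i j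
    unfolding bra_gslots[OF that] by (simp add: ev_def nths_omit slots_co map_update add.commute flip: omit_map)
  have 3: "brk V \<gamma> ((brakP P (var i) (cst (as ! i)) (cst (as ! j)), var i + var j) # nths (slots as) (- {i, j}))
    = ev \<gamma> (G.bra (gslots as ! i) (gslots as ! j) # omit2 i j (gslots as))" if "i < j" "j < length as" for i j
  proof -
    have "i < length as" using that by simp
    show ?thesis
      unfolding bra_gslots[OF \<open>i < length as\<close> that(2)] by (simp add: ev_def nths_omit2[OF that(1)] slots_co omit2_map add.commute)
  qed
  have 4: "lactV V (var i) (cst (as ! i)) v = LA (snd (gslots as ! i)) (fst (gslots as ! i)) v" if "i < length as" for i v
    using that by simp
  have 5: "{Suc m..m + n} = {Suc m..<length (gslots as)}" and 6: "length as = Suc m + n" using assms by auto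
  have in_A: "i < length as" if "i < Suc m" for i using that assms by simp
  have in_B: "j < length as" if "j \<in> {Suc m..<length (gslots as)}" for j using that by simp
  have in_C: "j < length as" if "j < Suc m" for j using that assms by simp
  show ?thesis
    unfolding d_CE_def G.CE_skew_def Suc_eq_plus1[symmetric] 5 if_P[OF 6] VM.act_sgn
    by (intro arg_cong2[where f = "(+)"] arg_cong2[where f = "(-)"] sum.cong refl arg_cong2[where f = sg])
      (simp_all only: lessThan_iff 1 2 3 4 in_A in_B)
qed

lemma in_vars_d_CE:
  assumes "\<gamma> \<in> lambda_brackets P V k" "length as = m + 1 + n" "1 \<le> n"
  shows "in_vars {..<m + n} (d_CE P V m n \<gamma> as)"
proof -
  have ls: "length (slots as) = m + 1 + n" using assms by (simp add: slots_def)
  have S: "slots_in {..<m + n} (slots as)" using slots_in_slots[of as] assms by simp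
  show ?thesis
    unfolding d_CE_def if_P[OF assms(2)]
    by (intro in_vars_add in_vars_sum in_vars_diff VM.in_vars_act PM.in_vars_prd VM.in_vars_prd in_vars_sgn
          brk_in_vars[OF assms(1)] slots_in_Cons)
      (use assms ls in \<open>auto simp: nths_omit nths_omit2 intro!: in_vars_var in_vars_add slots_in_omit slots_in_omit2 slots_in_update S PM.in_vars_prd\<close>)
qed

lemma tot_take_gslots: "k \<le> length as \<Longrightarrow> emb (G.tot (take k (gslots as))) = (\<Sum>i<k. var i)"
proof -
  assume k: "k \<le> length as"
  have "take k (gslots as) = gslots (take k as)" by (rule nth_equalityI) (use k in auto)
  then show ?thesis using k by (simp add: tot_gslots emb_gen min_def)
qed

lemma d_H_Hoch:
  assumes "length as = m + n + 1" "1 \<le> n"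
  shows "d_H P V m n \<gamma> as = G.Hoch 0 m (ev \<gamma>) (gslots as)"
proof -
  have 1: "brk V \<gamma> (nths (slots as) (- {m})) = ev \<gamma> (omit m (gslots as))"
    by (simp add: ev_def nths_omit slots_co omit_map)
  have 2: "brk V \<gamma> (take (m + i - 1) (slots as)
            @ [(circP P (var (m + i - 1)) (cst (as ! (m + i - 1))) (cst (as ! (m + i))), var (m + i - 1) + var (m + i))]
            @ drop (m + i + 1) (slots as))
     = ev \<gamma> (take (m + i - 1) (gslots as) @ G.mul (gslots as ! (m + i - 1)) (gslots as ! (m + i)) # drop (m + i + 1) (gslots as))"
     if "i \<in> {1..n}" for i
  proof -
    have "m + i - 1 < length as" "m + i < length as" using that assms by auto
    then show ?thesis
      unfolding mul_gslots[OF \<open>m + i - 1 < length as\<close> \<open>m + i < length as\<close>] by (simp add: ev_def slots_co take_map drop_map add.commute)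
  qed
  have 3: "brk V \<gamma> (take (m + n) (slots as)) = ev \<gamma> (take (m + n) (gslots as))"
    by (simp add: ev_def slots_co take_map)
  have 4: "(\<Sum>i<m + n. var i) = emb (0 + G.tot (take (m + n) (gslots as)))"
    using tot_take_gslots[of "m + n" as] assms by simp
  have len: "length (gslots as) = m + n + 1" using assms by simp
  have 5: "gslots as ! m = (cst (as ! m), {#m#})" "gslots as ! (m + n) = (cst (as ! (m + n)), {#m + n#})"
    using assms by simp_all
  have 6: "emb {#m#} = var m" by simp
  show ?thesis
    unfolding d_H_def G.Hoch_explicit[OF len] if_P[OF assms(1)] VM.act_sgn 1 3 4 5 fst_conv snd_conv 6
    by (intro arg_cong2[where f = "(+)"] sum.cong refl arg_cong2[where f = sg] 2)
qed

lemma in_vars_d_H: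
  assumes "\<gamma> \<in> lambda_brackets P V (m + n)" "length as = m + n + 1" "1 \<le> n"
  shows "in_vars {..<m + n} (d_H P V m n \<gamma> as)"
proof -
  have ls: "length (slots as) = m + n + 1" using assms by (simp add: slots_def)
  have S: "slots_in {..<m + n} (slots as)" using slots_in_slots[of as] assms by simp
  have T: "slots_in {..<m + n} (take (m + n) (slots as))"
    by (rule slots_in_take) (use slots_all_in[of "m + n" as] assms in auto)
  have M: "slots_in {..<m + n} (take (m + i - 1) (slots as)
            @ [(circP P (var (m + i - 1)) (cst (as ! (m + i - 1))) (cst (as ! (m + i))), var (m + i - 1) + var (m + i))]
            @ drop (m + i + 1) (slots as))" if i: "i \<in> {1..n}" for i
  proof -
    let ?b = "(circP P (var (m + i - 1)) (cst (as ! (m + i - 1))) (cst (as ! (m + i))), var (m + i - 1) + var (m + i))"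
    have f: "in_vars {..<m + n} (fst ?b)" unfolding fst_conv
      by (intro PM.in_vars_prd in_vars_cst in_vars_var) (use i in auto)
    show ?thesis
    proof (cases "i = n")
      case True
      have "slots_in {..<m + n} (take (m + i - 1) (slots as) @ [(fst ?b, snd ?b)])"
      proof (rule slots_in_snoc[OF _ f], rule ballI)
        fix x assume "x \<in> set (take (m + i - 1) (slots as))"
        then have "in_vars {..<m + i - 1} (fst x) \<and> in_vars {..<m + i - 1} (snd x)"
          using assms i by (intro slots_all_in) auto
        then show "in_vars {..<m + n} (fst x) \<and> in_vars {..<m + n} (snd x)"
          using i by (auto elim!: in_vars_mono)
      qed
      then show ?thesis using True ls by simp
    next
      case False
      then have i': "m + i < m + n" using i by simp
      have "slots_in {..<m + n} (omit (m + i) ((slots as)[m + i - 1 := (fst ?b, snd ?b)]))"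
        using i' ls f by (intro slots_in_omit slots_in_update S) (auto intro!: in_vars_add in_vars_var)
      moreover have "omit (m + i) ((slots as)[m + i - 1 := ?b]) = take (m + i - 1) (slots as) @ [?b] @ drop (m + i + 1) (slots as)"
        using i i' ls by (simp add: omit_def upd_conv_take_nth_drop min_def) (cases "m + i", auto simp: take_Suc_conv_app_nth)
      ultimately show ?thesis by simp
    qed
  qed
  show ?thesis
    unfolding d_H_def if_P[OF assms(2)]
    by (intro in_vars_add in_vars_sum VM.in_vars_act VM.in_vars_prd in_vars_sgn
          brk_in_vars[OF assms(1)] in_vars_cst T M)
      (use assms ls in \<open>auto simp: nths_omit intro!: in_vars_var slots_in_omit S\<close>)
qed

lemma dagger_cong: "act sV (dagger k - var k) f \<in> zer sV (gen (Suc k))"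
proof -
  have "dagger k - var k = mass (gen (Suc k)) * (- 1)" by (simp add: mass_gen)
  then show ?thesis by (metis VM.act_mass_zer)
qed

text \<open>\<open>\<lambda>\<^sub>k\<^sup>\<dagger>\<close> and \<open>\<lambda>\<^sub>k\<close> are congruent at the total momentum, so the subscripts with a dagger can be replaced.\<close>
lemma d_CE0_full:
  assumes "\<gamma> \<in> lambda_brackets P V k" "length as = k + 1"
  shows "G.eqv (gen (k + 1)) (d_CE0 P V k \<gamma> as) (G.CE_full k (ev \<gamma>) (gslots as))"
proof -
  let ?gs = "gslots as" and ?q = "gen (Suc k)"
  have t1: "brk V \<gamma> (nths (slots as) (- {i})) = ev \<gamma> (omit i ?gs)" for i
    by (simp add: ev_def nths_omit slots_co omit_map)
  have t2: "G.eqv ?q (brk V \<gamma> (nths (take k (slots as)) (- {i, j})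
            @ [(cst (as ! k), dagger k), (brakP P (var i) (cst (as ! i)) (cst (as ! j)), 0)]))
     (ev \<gamma> (omit2 i j (take k ?gs) @ [?gs ! k, G.bra (?gs ! i) (?gs ! j)]))" if "i < j" "j < k" for i j
    unfolding G.eqv_def ev_def
  proof (rule brk_cong[OF assms(1) _ VM.submod_zer])
    have ij: "i < length as" "j < length as" using that assms by auto
    let ?us = "omit2 i j (take k (slots as))"
    have us: "nths (take k (slots as)) (- {i, j}) = ?us" "co (omit2 i j (take k ?gs)) = ?us"
      by (simp_all add: nths_omit2[OF that(1)] slots_co omit2_map take_map)
    show "map fst (nths (take k (slots as)) (- {i, j}) @ [(cst (as ! k), dagger k), (brakP P (var i) (cst (as ! i)) (cst (as ! j)), 0)])
      = map fst (co (omit2 i j (take k ?gs) @ [?gs ! k, G.bra (?gs ! i) (?gs ! j)]))"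
      using assms(2) unfolding map_append us bra_gslots[OF ij] by simp
    fix l f
    assume len: "length (nths (take k (slots as)) (- {i, j}) @ [(cst (as ! k), dagger k), (brakP P (var i) (cst (as ! i)) (cst (as ! j)), 0)]) = k"
      and l: "l < k - 1"
    consider "l < length ?us" | "l = length ?us" using len l unfolding us by fastforce
    then show "act sV (snd ((nths (take k (slots as)) (- {i, j}) @ [(cst (as ! k), dagger k), (brakP P (var i) (cst (as ! i)) (cst (as ! j)), 0)]) ! l)
       - snd (co (omit2 i j (take k ?gs) @ [?gs ! k, G.bra (?gs ! i) (?gs ! j)]) ! l)) f \<in> zer sV ?q"
      unfolding map_append us by cases (use assms(2) in \<open>simp_all add: nth_append VM.submodD(1)[OF VM.submod_zer] dagger_cong\<close>)
  qed
  have t3: "G.eqv ?q (lactV V (dagger k) (cst (as ! k)) (brk V \<gamma> (take k (slots as))))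
      (LA (snd (?gs ! k)) (fst (?gs ! k)) (ev \<gamma> (take k ?gs)))"
    using la.prd_cong[OF VM.submod_zer dagger_cong, of k "cst (as ! k)" "brk V \<gamma> (take k (slots as))"] assms(2)
    by (simp add: G.eqv_def ev_def slots_co take_map)
  have t4: "G.eqv ?q (brk V \<gamma> (nths (take k (slots as)) (- {i}) @ [(brakP P (var i) (cst (as ! i)) (cst (as ! k)), 0)]))
     (ev \<gamma> (omit i (take k ?gs) @ [G.bra (?gs ! i) (?gs ! k)]))" if "i < k" for i
    unfolding G.eqv_def ev_def
  proof (rule brk_cong[OF assms(1) _ VM.submod_zer])
    have ij: "i < length as" "k < length as" using that assms by auto
    let ?us = "omit i (take k (slots as))"
    have us: "nths (take k (slots as)) (- {i}) = ?us" "co (omit i (take k ?gs)) = ?us"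
      by (simp_all add: nths_omit slots_co omit_map take_map)
    show "map fst (nths (take k (slots as)) (- {i}) @ [(brakP P (var i) (cst (as ! i)) (cst (as ! k)), 0)])
      = map fst (co (omit i (take k ?gs) @ [G.bra (?gs ! i) (?gs ! k)]))"
      unfolding map_append us bra_gslots[OF ij] by simp
    fix l f
    assume len: "length (nths (take k (slots as)) (- {i}) @ [(brakP P (var i) (cst (as ! i)) (cst (as ! k)), 0)]) = k"
      and l: "l < k - 1"
    have "l < length ?us" using len l unfolding us by simp
    then show "act sV (snd ((nths (take k (slots as)) (- {i}) @ [(brakP P (var i) (cst (as ! i)) (cst (as ! k)), 0)]) ! l)
       - snd (co (omit i (take k ?gs) @ [G.bra (?gs ! i) (?gs ! k)]) ! l)) f \<in> zer sV ?q"
      unfolding map_append us by (simp add: nth_append VM.submodD(1)[OF VM.submod_zer])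
  qed
  have t0: "lactV V (var i) (cst (as ! i)) v = LA (snd (?gs ! i)) (fst (?gs ! i)) v" if "i < k" for i v
    using that assms by simp
  have "G.eqv ?q (d_CE0 P V k \<gamma> as) (G.CE_full k (ev \<gamma>) ?gs)"
    unfolding d_CE0_def G.CE_full_def if_P[OF assms(2)] VM.act_sgn t1
    by (intro G.eqv_add G.eqv_sum G.eqv_sg t2 t3 t4) (auto simp: t0)
  then show ?thesis by simp
qed

lemma in_vars_d_CE0:
  assumes "\<gamma> \<in> lambda_brackets P V k" "length as = k + 1"
  shows "in_vars {..<k} (d_CE0 P V k \<gamma> as)"
proof -
  have ls: "length (slots as) = k + 1" using assms by (simp add: slots_def)
  have S: "slots_in {..<k} (slots as)" using slots_in_slots[of as] assms by simp
  have all: "x \<in> set (take k (slots as)) \<Longrightarrow> in_vars {..<k} (fst x) \<and> in_vars {..<k} (snd x)" for x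
    using slots_all_in[of k as] assms by simp
  have T: "slots_in {..<k} (take k (slots as))" by (rule slots_in_take) (use all in blast)
  have T2: "slots_in {..<k} (nths (take k (slots as)) (- {i, j}) @ [(cst (as ! k), dagger k), (brakP P (var i) (cst (as ! i)) (cst (as ! j)), 0)])"
    if "i < k" "j < k" for i j
  proof -
    have "\<forall>x\<in>set (nths (take k (slots as)) (- {i, j}) @ [(cst (as ! k), dagger k)]). in_vars {..<k} (fst x) \<and> in_vars {..<k} (snd x)"
      using all by (auto dest!: in_set_nthsD simp: in_vars_dagger)
    from slots_in_snoc[OF this, of "brakP P (var i) (cst (as ! i)) (cst (as ! j))" 0]
    show ?thesis using that by (simp add: PM.in_vars_prd in_vars_var)
  qed
  have T1: "slots_in {..<k} (nths (take k (slots as)) (- {i}) @ [(brakP P (var i) (cst (as ! i)) (cst (as ! k)), 0)])"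
    if "i < k" for i
  proof -
    have "\<forall>x\<in>set (nths (take k (slots as)) (- {i})). in_vars {..<k} (fst x) \<and> in_vars {..<k} (snd x)"
      using all by (auto dest!: in_set_nthsD)
    from slots_in_snoc[OF this, of "brakP P (var i) (cst (as ! i)) (cst (as ! k))" 0]
    show ?thesis using that by (simp add: PM.in_vars_prd in_vars_var)
  qed
  show ?thesis
    unfolding d_CE0_def if_P[OF assms(2)]
    by (intro in_vars_add in_vars_sum VM.in_vars_act VM.in_vars_prd in_vars_sgn
          brk_in_vars[OF assms(1)] in_vars_cst T T1 T2 in_vars_dagger)
      (use assms ls in \<open>auto simp: nths_omit intro!: in_vars_var slots_in_omit S\<close>)
qed

lemma representsD:
  assumes "represents m n \<gamma> F"
  shows "\<gamma> \<in> lambda_brackets P V (m + n)" "\<gamma> \<in> Cmn P V m n" "cochain_fun m F"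
    "length ss = m + n \<Longrightarrow> G.eqv (G.tot ss) (ev \<gamma> ss) (F ss)"
  using assms by (auto simp: represents_def Cmn_def)

lemma represents_CE:
  assumes "represents m n \<gamma> F" "1 \<le> n"
  shows "represents (Suc m) n (d_CE P V m n \<gamma>) (G.CE (Suc m) F)"
proof (rule represents_intro[OF cochain_fun_CE[OF representsD(3)[OF assms(1)]]])
  fix as :: "'p list" assume "length as = Suc m + n"
  then have len: "length as = m + 1 + n" by simp
  show "in_vars {..<Suc m + n - 1} (d_CE P V m n \<gamma> as)"
    using in_vars_d_CE[OF representsD(1)[OF assms(1)] len assms(2)] by simp
  have "G.Alt 0 m (ev \<gamma>)" using cochain_fun_ev[OF representsD(2)[OF assms(1)]] assms(2) by (simp add: cochain_fun_def)
  then have "G.eqv (gen (Suc m + n)) (d_CE P V m n \<gamma> as) (G.CE (Suc m) (ev \<gamma>) (gslots as))"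
    using G.CE_skew_eqv[of m "ev \<gamma>" "gslots as"] d_CE_skew[OF len assms(2)] len by (simp add: tot_gslots)
  also have "G.eqv (gen (Suc m + n)) \<dots> (G.CE (Suc m) F (gslots as))"
    using G.CE_eqv[of "gslots as" "ev \<gamma>" F "Suc m"] representsD(4)[OF assms(1)] len by (simp add: tot_gslots del: G.CE.simps)
  finally show "G.eqv (gen (Suc m + n)) (d_CE P V m n \<gamma> as) (G.CE (Suc m) F (gslots as))" .
qed (simp_all add: d_CE_def)

lemma represents_CE0:
  assumes "represents k 0 \<gamma> F" "1 \<le> k"
  shows "represents (Suc k) 0 (d_CE0 P V k \<gamma>) (G.CE (Suc k) F)"
proof (rule represents_intro[OF cochain_fun_CE[OF representsD(3)[OF assms(1)]]])
  have LB: "\<gamma> \<in> lambda_brackets P V k" using representsD(1)[OF assms(1)] by simp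
  fix as :: "'p list" assume "length as = Suc k + 0"
  then have len: "length as = k + 1" by simp
  show "in_vars {..<Suc k + 0 - 1} (d_CE0 P V k \<gamma> as)"
    using in_vars_d_CE0[OF LB len] by simp
  have "G.Alt 0 k (ev \<gamma>)" using cochain_fun_ev[OF representsD(2)[OF assms(1)]] assms(2) by (simp add: cochain_fun_def)
  then have 1: "G.eqv (gen (Suc k)) (G.CE_full k (ev \<gamma>) (gslots as)) (G.CE (Suc k) (ev \<gamma>) (gslots as))"
    using G.CE_full_eqv[of k "ev \<gamma>" "gslots as"] len by (simp add: tot_gslots del: G.CE.simps)
  have 2: "G.eqv (gen (Suc k)) (G.CE (Suc k) (ev \<gamma>) (gslots as)) (G.CE (Suc k) F (gslots as))"
    using G.CE_eqv[of "gslots as" "ev \<gamma>" F "Suc k"] representsD(4)[OF assms(1)] len by (simp add: tot_gslots del: G.CE.simps)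
  have "G.eqv (gen (Suc k)) (d_CE0 P V k \<gamma> as) (G.CE_full k (ev \<gamma>) (gslots as))"
    using d_CE0_full[OF LB len] by simp
  from G.eqv_trans[OF this G.eqv_trans[OF 1 2]]
  show "G.eqv (gen (Suc k + 0)) (d_CE0 P V k \<gamma> as) (G.CE (Suc k) F (gslots as))"
    by (simp del: G.CE.simps)
qed (simp_all add: d_CE0_def)

lemma represents_H:
  assumes "represents m n \<gamma> F" "1 \<le> n"
  shows "represents m (Suc n) (d_H P V m n \<gamma>) (G.Hoch 0 m F)"
proof (rule represents_intro[OF cochain_fun_Hoch[OF representsD(3)[OF assms(1)]]])
  fix as :: "'p list" assume "length as = m + Suc n"
  then have len: "length as = m + n + 1" by simp
  show "in_vars {..<m + Suc n - 1} (d_H P V m n \<gamma> as)"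
    using in_vars_d_H[OF representsD(1)[OF assms(1)] len assms(2)] by simp
  show "G.eqv (gen (m + Suc n)) (d_H P V m n \<gamma> as) (G.Hoch 0 m F (gslots as))"
    unfolding d_H_Hoch[OF len assms(2)]
    using G.Hoch_eqv[of "gslots as" "ev \<gamma>" F m] representsD(4)[OF assms(1)] len by (simp add: tot_gslots)
qed (simp_all add: d_H_def)

text \<open>Alternation in \<open>m + 1\<close> arguments at the total momentum contains alternation in the first \<open>m\<close> of them.\<close>
lemma represents_iota:
  assumes "represents (Suc m) 0 \<gamma> F"
  shows "represents m 1 (iota \<gamma>) F"
proof (rule represents_intro)
  have LB: "\<gamma> \<in> lambda_brackets P V (Suc m)" using representsD(1)[OF assms(1)] by simp
  show "cochain_fun m F" using representsD(3)[OF assms] G.Alt_mono[of 0 "Suc m" F m] by (auto simp: cochain_fun_def)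
  fix as :: "'p list"
  show "length as \<noteq> m + 1 \<Longrightarrow> iota \<gamma> as = 0" using LB_off[OF LB, of as] by (simp add: iota_def)
  assume len: "length as = m + 1"
  show "in_vars {..<m + 1 - 1} (iota \<gamma> as)" using LB_vars[OF LB, of as] by (simp add: iota_def)
  show "G.eqv (gen (m + 1)) (iota \<gamma> as) (F (gslots as))"
    using representsD(4)[OF assms, of "gslots as"] len by (simp add: tot_gslots iota_def ev_gslots[OF LB])
qed simp

lemma cochain_fun_0: "cochain_fun m (\<lambda>_. 0)"
  by (simp add: cochain_fun_def G.Slotlin_def G.Null_def G.Alt_def G.Natural_def VM.submodD(1)[OF VM.submod_zer])

lemma represents_zero:
  assumes "represents m n \<gamma> F" "0 < m + n" "\<And>ss. length ss = m + n \<Longrightarrow> G.eqv (G.tot ss) (F ss) 0"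
  shows "\<gamma> = (\<lambda>_. 0)"
  by (rule represents_unique[OF assms(1) represents_intro[OF cochain_fun_0, of m n "\<lambda>_. 0"]]) (use assms in auto)

text \<open>An element of the module as a cochain without arguments. It treats \<open>C\<^sup>0\<^sup>,\<^sup>0\<close> like the other columns.\<close>
definition point :: "'v \<Rightarrow> ('p mpol \<times> nat multiset) list \<Rightarrow> 'v mpol" where
  "point v ss = (if ss = [] then cst v else 0)"

lemma cochain_fun_point: "cochain_fun 0 (point v)"
  by (simp add: cochain_fun_def point_def G.Slotlin_def G.Null_def G.Alt_def G.Natural_def VM.submodD(1)[OF VM.submod_zer])

lemma d_CE00_coset:
  assumes "v \<in> X" "X \<in> C00 V" "length as = 1"
  shows "d_CE00 V X as = lactV V (- dpar) (cst (as ! 0)) (cst v)"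
proof -
  let ?f = "\<lambda>v. lactV V (- dpar) (cst (as ! 0)) (cst v)"
  have const: "?f w = ?f v" if wX: "w \<in> X" for w
  proof -
    obtain u where X: "X = {w. w - u \<in> range (del sV)}"
      using assms(2) by (auto simp: C00_def quotient_def)
    then obtain y z where yz: "w - u = del sV y" "v - u = del sV z"
      using wX assms(1) by blast
    have "w = v + ((w - u) - (v - u))" by simp
    also have "\<dots> = v + del sV (y - z)"
      unfolding yz by (simp add: del_def VM.scale_right_diff_distrib)
    finally have "cst w = cst v + act sV dpar (cst (y - z))"
      by (simp add: VM.act_dpar_cst cst_add)
    then show ?thesis by (simp add: clinear_add[OF la.prd_clinear2] la.prd_dpar2)
  qed
  have "?f ` X = {?f v}"
  proof (intro equalityI subsetI)
    fix y assume "y \<in> ?f ` X"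
    then obtain w where "w \<in> X" "y = ?f w" by blast
    then show "y \<in> {?f v}" using const[OF \<open>w \<in> X\<close>] by simp
  qed (use assms(1) in blast)
  then show ?thesis by (simp add: d_CE00_def assms(3))
qed

text \<open>The subscript \<open>- \<partial>\<close> is the dagger of the only argument.\<close>
lemma represents_CE00:
  assumes "v \<in> X" "X \<in> C00 V"
  shows "represents 1 0 (d_CE00 V X) (G.CE (Suc 0) (point v))"
proof (rule represents_intro)
  show "cochain_fun 1 (G.CE (Suc 0) (point v))" using cochain_fun_CE[OF cochain_fun_point] by simp
  show "d_CE00 V X as = 0" if "length as \<noteq> 1 + 0" for as :: "'p list" using that by (simp add: d_CE00_def)
  fix as :: "'p list" assume "length as = 1 + 0"
  then have len: "length as = 1" by simp
  note eq = d_CE00_coset[OF assms len]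
  show "in_vars {..<1 + 0 - 1} (d_CE00 V X as)"
    unfolding eq by (intro VM.in_vars_prd in_vars_cst) (simp add: in_vars_minus in_vars_dpar)
  obtain a where a: "as = [a]" using len by (auto simp: length_Suc_conv)
  have "lactV V (dagger 0) (cst a) (cst v) - lactV V (var 0) (cst a) (cst v) \<in> zer sV (gen (Suc 0))"
    by (rule la.prd_cong[OF VM.submod_zer dagger_cong])
  then show "G.eqv (gen (1 + 0)) (d_CE00 V X as) (G.CE (Suc 0) (point v) (gslots as))"
    unfolding eq by (simp add: a gslots_def G.Lie_def point_def G.eqv_def dagger_def)
qed simp

lemma d_CE_d_CE:
  assumes "\<gamma> \<in> Cmn P V m n" "1 \<le> n"
  shows "d_CE P V (Suc m) n (d_CE P V m n \<gamma>) = (\<lambda>_. 0)"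
proof -
  have r: "represents m n \<gamma> (ev \<gamma>)" by (rule represents_ev) (use assms in auto)
  show ?thesis
    by (rule represents_zero[OF represents_CE[OF represents_CE[OF r assms(2)] assms(2)]])
      (use assms G.CE_CE[OF cochain_fun_Additive[OF representsD(3)[OF r]]] in \<open>simp_all del: G.CE.simps\<close>)
qed

lemma d_CE0_d_CE0:
  assumes "\<gamma> \<in> Cmn P V k 0" "1 \<le> k"
  shows "d_CE0 P V (Suc k) (d_CE0 P V k \<gamma>) = (\<lambda>_. 0)"
proof -
  have r: "represents k 0 \<gamma> (ev \<gamma>)" by (rule represents_ev) (use assms in auto)
  show ?thesis
    by (rule represents_zero[OF represents_CE0[OF represents_CE0[OF r assms(2)]]])
      (use assms G.CE_CE[OF cochain_fun_Additive[OF representsD(3)[OF r]]] in \<open>simp_all del: G.CE.simps\<close>)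
qed

lemma d_H_d_H:
  assumes "\<gamma> \<in> Cmn P V m n" "1 \<le> n"
  shows "d_H P V m (Suc n) (d_H P V m n \<gamma>) = (\<lambda>_. 0)"
proof -
  have r: "represents m n \<gamma> (ev \<gamma>)" by (rule represents_ev) (use assms in auto)
  show ?thesis
    by (rule represents_zero[OF represents_H[OF represents_H[OF r assms(2)]]]) (simp_all add: G.Hoch_Hoch)
qed

lemma d_CE_d_H:
  assumes "\<gamma> \<in> Cmn P V m n" "1 \<le> n"
  shows "d_CE P V m (Suc n) (d_H P V m n \<gamma>) = d_H P V (Suc m) n (d_CE P V m n \<gamma>)"
proof -
  have r: "represents m n \<gamma> (ev \<gamma>)" by (rule represents_ev) (use assms in auto)
  show ?thesis
    by (rule represents_unique[OF represents_CE[OF represents_H[OF r assms(2)]] represents_H[OF represents_CE[OF r assms(2)] assms(2)]])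
      (use assms G.CE_Hoch[OF cochain_fun_Additive[OF representsD(3)[OF r]]] in \<open>simp_all del: G.CE.simps\<close>)
qed

text \<open>The relation between the columns \<open>n = 0\<close> and \<open>n = 2\<close>, from \<open>Hoch_CE_last\<close> and the commutation of the two differentials.\<close>
lemma d_H_d_CE0:
  assumes "\<gamma> \<in> Cmn P V (Suc k) 0"
  shows "d_H P V (Suc k) 1 (iota (d_CE0 P V (Suc k) \<gamma>)) = d_CE P V k 2 (d_H P V k 1 (iota \<gamma>))"
proof -
  have r: "represents (Suc k) 0 \<gamma> (ev \<gamma>)" by (rule represents_ev) (use assms in auto)
  have 1: "represents (Suc k) 2 (d_H P V (Suc k) 1 (iota (d_CE0 P V (Suc k) \<gamma>))) (G.Hoch 0 (Suc k) (G.CE (Suc (Suc k)) (ev \<gamma>)))"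
    using represents_H[OF represents_iota[OF represents_CE0[OF r]]] by (simp add: numeral_2_eq_2 del: G.CE.simps)
  have 2: "represents (Suc k) 2 (d_CE P V k 2 (d_H P V k 1 (iota \<gamma>))) (G.CE (Suc k) (G.Hoch 0 k (ev \<gamma>)))"
    using represents_CE[OF represents_H[OF represents_iota[OF r]]] by (simp add: numeral_2_eq_2 del: G.CE.simps)
  show ?thesis
  proof (rule represents_unique[OF 1 2])
    fix ss :: "('p mpol \<times> nat multiset) list" assume "length ss = Suc k + 2"
    from G.Hoch_CE_last[OF this, of 0 "ev \<gamma>"]
    show "G.eqv (G.tot ss) (G.Hoch 0 (Suc k) (G.CE (Suc (Suc k)) (ev \<gamma>)) ss) (G.CE (Suc k) (G.Hoch 0 k (ev \<gamma>)) ss)"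
      by (simp add: G.CE_Hoch[OF cochain_fun_Additive[OF representsD(3)[OF r]]] del: G.CE.simps)
  qed simp
qed

lemma d_CE0_d_CE00:
  assumes "X \<in> C00 V"
  shows "d_CE0 P V 1 (d_CE00 V X) = (\<lambda>_. 0)" "d_H P V 0 1 (iota (d_CE00 V X)) = (\<lambda>_. 0)"
proof -
  obtain v where v: "v \<in> X" using assms by (auto simp: C00_def quotient_def) (metis diff_self VM.scale_zero_right del_def rangeI)
  note r = represents_CE00[OF v assms]
  show "d_CE0 P V 1 (d_CE00 V X) = (\<lambda>_. 0)"
    by (rule represents_zero[OF represents_CE0[OF r]])
      (use G.CE_CE[OF cochain_fun_Additive[OF cochain_fun_point], of "Suc 0"] in \<open>simp_all del: G.CE.simps\<close>)
  have "represents 0 2 (d_H P V 0 1 (iota (d_CE00 V X))) (G.Hoch 0 0 (G.CE (Suc 0) (point v)))"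
    using represents_H[OF represents_iota[of 0 "d_CE00 V X"]] r by (simp add: numeral_2_eq_2 del: G.CE.simps)
  then show "d_H P V 0 1 (iota (d_CE00 V X)) = (\<lambda>_. 0)"
  proof (rule represents_zero)
    fix ss :: "('p mpol \<times> nat multiset) list" assume "length ss = 0 + 2"
    from G.Hoch_CE_last[OF this, of 0 "point v"]
    show "G.eqv (G.tot ss) (G.Hoch 0 0 (G.CE (Suc 0) (point v)) ss) 0"
      by (simp add: G.CE.simps(1)[abs_def] del: G.CE.simps(2-3))
  qed simp
qed

end

context npc_module
begin

section \<open>The total complex\<close>

lemma brk_add: "brk V (\<lambda>as. \<gamma> as + \<delta> as) ps = brk V \<gamma> ps + brk V \<delta> ps"
  by (simp add: brk_def VM.subst_add VM.multilift_add_fun)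
lemma brk_scale: "brk V (\<lambda>as. act sV (cst [:c:]) (\<gamma> as)) ps = act sV (cst [:c:]) (brk V \<gamma> ps)"
  by (simp add: brk_def VM.subst_act C.subst_cst VM.multilift_act_fun)

definition linear_op :: "(('p list \<Rightarrow> 'v mpol) \<Rightarrow> 'p list \<Rightarrow> 'v mpol) \<Rightarrow> bool" where
  "linear_op D \<longleftrightarrow> (\<forall>\<gamma> \<delta>. D (\<lambda>as. \<gamma> as + \<delta> as) = (\<lambda>as. D \<gamma> as + D \<delta> as)) \<and>
     (\<forall>c \<gamma>. D (\<lambda>as. act sV (cst [:c:]) (\<gamma> as)) = (\<lambda>as. act sV (cst [:c:]) (D \<gamma> as)))"

lemma linear_op_add: "linear_op D \<Longrightarrow> D (\<lambda>as. \<gamma> as + \<delta> as) = (\<lambda>as. D \<gamma> as + D \<delta> as)"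
  and linear_op_scale: "linear_op D \<Longrightarrow> D (\<lambda>as. act sV (cst [:c:]) (\<gamma> as)) = (\<lambda>as. act sV (cst [:c:]) (D \<gamma> as))"
  by (auto simp: linear_op_def)

lemma linear_op_zero: "linear_op D \<Longrightarrow> D (\<lambda>_. 0) = (\<lambda>_. 0)"
  using linear_op_scale[of D 0 "\<lambda>_. 0"] by simp

lemma cst_minus_1: "cst [:- 1:] = (- 1 :: coef)"
proof -
  have "[:- 1:] = (- 1 :: complex poly)" by (simp add: one_pCons)
  then show ?thesis using cst_uminus[of "1 :: complex poly"] by (simp only: cst_1)
qed

lemma linear_op_sg: "linear_op D \<Longrightarrow> D (\<lambda>as. sg i (\<gamma> as)) = (\<lambda>as. sg i (D \<gamma> as))"
  using linear_op_scale[of D "- 1" \<gamma>] by (cases "even i") (simp_all add: sg_def cst_minus_1 VM.act_minus1)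

lemmas clinear_V2 = clinear_add[OF la.prd_clinear2] clinear_add[OF lc.prd_clinear2] clinear_add[OF rc.prd_clinear1]
  clinear_cst[OF la.prd_clinear2] clinear_cst[OF lc.prd_clinear2] clinear_cst[OF rc.prd_clinear1]

lemma act_cst_comm: "act sV q (act sV (cst [:c:]) v) = act sV (cst [:c:]) (act sV q v)"
  by (rule VM.act_comm)

lemmas linear_simps = brk_add brk_scale clinear_V2 act_cst_comm VM.act_add2 VM.act_diff2 VM.act_sum2 sum.distrib sum_subtractf

lemma linear_op_d_CE0: "linear_op (d_CE0 P V k)"
  unfolding linear_op_def d_CE0_def by (auto simp: fun_eq_iff linear_simps)

lemma linear_op_d_CE: "linear_op (d_CE P V m n)"
  unfolding linear_op_def d_CE_def by (auto simp: fun_eq_iff linear_simps)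

lemma linear_op_d_H: "linear_op (d_H P V m n)"
  unfolding linear_op_def d_H_def by (auto simp: fun_eq_iff linear_simps)

lemma Cmn_add:
  assumes "\<gamma> \<in> Cmn P V m n" "\<delta> \<in> Cmn P V m n" "0 < m + n"
  shows "(\<lambda>as. \<gamma> as + \<delta> as) \<in> Cmn P V m n"
proof (rule Cmn_intro[OF _ assms(3)])
  note LB = Cmn_LB[OF assms(1)] Cmn_LB[OF assms(2)]
  show "(\<lambda>as. \<gamma> as + \<delta> as) \<in> lambda_brackets P V (m + n)"
    using LB_mlin[OF LB(1)] LB_mlin[OF LB(2)]
    by (intro LB_intro[OF assms(3)])
      (simp_all add: LB_off[OF LB(1)] LB_off[OF LB(2)] in_vars_add LB_vars[OF LB(1)] LB_vars[OF LB(2)] LB_vars[OF LB(1), simplified]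
        LB_vars[OF LB(2), simplified] LB_del[OF LB(1)] LB_del[OF LB(2)]
        LB_del_last[OF LB(1)] LB_del_last[OF LB(2)] VM.act_add2 PV.mlin_def algebra_simps)
  fix xs :: "'p list" and \<sigma>
  assume "length xs = m + n" "\<sigma> permutes {..<m}"
  then have "G.eqv (gen (m + n)) (subst sV (\<lambda>i. var (\<sigma> i)) (\<gamma> (permute_list \<sigma> xs)) + subst sV (\<lambda>i. var (\<sigma> i)) (\<delta> (permute_list \<sigma> xs)))
     (G.sgs (sign \<sigma>) (\<gamma> xs) + G.sgs (sign \<sigma>) (\<delta> xs))"
    by (intro G.eqv_add Cmn_perm assms)
  then show "G.eqv (gen (m + n)) (subst sV (\<lambda>i. var (\<sigma> i)) (\<gamma> (permute_list \<sigma> xs) + \<delta> (permute_list \<sigma> xs)))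
     (G.sgs (sign \<sigma>) (\<gamma> xs + \<delta> xs))"
    by (simp add: VM.subst_add G.sgs_def split: if_splits)
qed

lemma Cmn_scale:
  assumes "\<gamma> \<in> Cmn P V m n" "0 < m + n"
  shows "(\<lambda>as. act sV (cst [:c:]) (\<gamma> as)) \<in> Cmn P V m n"
proof (rule Cmn_intro[OF _ assms(2)])
  note LB = Cmn_LB[OF assms(1)]
  show "(\<lambda>as. act sV (cst [:c:]) (\<gamma> as)) \<in> lambda_brackets P V (m + n)"
    using LB_mlin[OF LB] VM.act_comm[of "cst [:c:]"]
    by (intro LB_intro[OF assms(2)])
      (simp_all add: LB_off[OF LB] LB_vars[OF LB] VM.in_vars_act LB_vars[OF LB, simplified] LB_del[OF LB] LB_del_last[OF LB] VM.act_add2 PV.mlin_def)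
  fix xs :: "'p list" and \<sigma>
  assume "length xs = m + n" "\<sigma> permutes {..<m}"
  then have "G.eqv (gen (m + n)) (act sV (cst [:c:]) (subst sV (\<lambda>i. var (\<sigma> i)) (\<gamma> (permute_list \<sigma> xs)))) (act sV (cst [:c:]) (G.sgs (sign \<sigma>) (\<gamma> xs)))"
    by (intro eqv_act Cmn_perm assms)
  then show "G.eqv (gen (m + n)) (subst sV (\<lambda>i. var (\<sigma> i)) (act sV (cst [:c:]) (\<gamma> (permute_list \<sigma> xs)))) (G.sgs (sign \<sigma>) (act sV (cst [:c:]) (\<gamma> xs)))"
    by (simp add: VM.subst_act C.subst_cst G.sgs_def VM.act_minus2 split: if_splits)
qed

lemma Cmn_sg: "\<gamma> \<in> Cmn P V m n \<Longrightarrow> 0 < m + n \<Longrightarrow> (\<lambda>as. sg i (\<gamma> as)) \<in> Cmn P V m n"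
  using Cmn_scale[of \<gamma> m n "- 1"] by (cases "even i") (simp_all add: sg_def cst_minus_1 VM.act_minus1)

lemma d_CE_Cmn: "\<gamma> \<in> Cmn P V m n \<Longrightarrow> 1 \<le> n \<Longrightarrow> d_CE P V m n \<gamma> \<in> Cmn P V (Suc m) n"
  using representsD(2)[OF represents_CE[OF represents_ev]] by simp
lemma d_H_Cmn: "\<gamma> \<in> Cmn P V m n \<Longrightarrow> 1 \<le> n \<Longrightarrow> d_H P V m n \<gamma> \<in> Cmn P V m (Suc n)"
  using representsD(2)[OF represents_H[OF represents_ev]] by simp
lemma d_CE0_Cmn: "\<gamma> \<in> Cmn P V k 0 \<Longrightarrow> 1 \<le> k \<Longrightarrow> d_CE0 P V k \<gamma> \<in> Cmn P V (Suc k) 0"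
  using representsD(2)[OF represents_CE0[OF represents_ev]] by simp
lemma iota_Cmn: "\<gamma> \<in> Cmn P V (Suc m) 0 \<Longrightarrow> iota \<gamma> \<in> Cmn P V m 1"
  using representsD(2)[OF represents_iota[OF represents_ev]] by simp

text \<open>The column \<open>n = 0\<close> is used as a column \<open>n = 1\<close>, which makes the formula for the total differential uniform.\<close>
definition shifted :: "(nat \<Rightarrow> 'p list \<Rightarrow> 'v mpol) \<Rightarrow> nat \<Rightarrow> 'p list \<Rightarrow> 'v mpol" where
  "shifted F n = (if n = 1 then iota (F 0) else F n)"

definition total_d :: "nat \<Rightarrow> (nat \<Rightarrow> 'p list \<Rightarrow> 'v mpol) \<Rightarrow> nat \<Rightarrow> 'p list \<Rightarrow> 'v mpol" where
  "total_d k F l as = (if l = 0 then d_CE0 P V k (F 0) as else if l = 1 then 0 else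
     (if l \<le> k then d_CE P V (k - l) l (F l) as else 0) +
     (if l \<le> k + 1 then sg (k + 1 - l) (d_H P V (k + 1 - l) (l - 1) (shifted F (l - 1)) as) else 0))"

lemma d_FGV_total:
  assumes "1 \<le> k"
  shows "d_FGV P V k (Family F) = Family (total_d k F)"
proof -
  have "(\<Sum>n\<in>{0..k} - {1}. d_comp P V (k - n) n (F n) l as) = total_d k F l as" for l as
  proof -
    \<comment> \<open>besides column \<open>l\<close> only this column contributes to column \<open>l\<close>; column \<open>0\<close> takes the place of column \<open>1\<close>\<close>
    define pr where "pr = (if l = 2 then 0 else l - 1)"
    define a where "a n = (if n = 0 then d_CE0 P V k (F 0) as else d_CE P V (k - n) n (F n) as)" for n
    define b where "b = sg (k + 1 - l) (d_H P V (k + 1 - l) (l - 1) (shifted F (l - 1)) as)"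
    have "d_comp P V (k - n) n (F n) l as = (if n = l then a n else 0) + (if n = pr then (if 2 \<le> l then b else 0) else 0)"
      if "n \<in> {0..k} - {1}" for n
    proof (cases "n = 0")
      case True
      then show ?thesis
        using that assms by (auto simp: d_comp_def a_def b_def pr_def shifted_def VM.act_sgn)
    next
      case False
      then have n: "2 \<le> n" "n \<le> k" using that by auto
      show ?thesis
      proof (cases "l = n + 1")
        case True
        then show ?thesis
          using n by (simp add: d_comp_def b_def pr_def shifted_def VM.act_sgn)
      next
        case False
        then have "n \<noteq> pr" using n by (auto simp: pr_def)
        then show ?thesis using n False by (auto simp: d_comp_def a_def)
      qed
    qed
    then have "(\<Sum>n\<in>{0..k} - {1}. d_comp P V (k - n) n (F n) l as)
      = (\<Sum>n\<in>{0..k} - {1}. (if n = l then a n else 0) + (if n = pr then (if 2 \<le> l then b else 0) else 0))"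
      by (rule sum.cong[OF refl])
    also have "\<dots> = (if l \<in> {0..k} - {1} then a l else 0) + (if pr \<in> {0..k} - {1} then (if 2 \<le> l then b else 0) else 0)"
      by (simp only: sum.distrib sum.delta finite_Diff finite_atLeastAtMost)
    also have "\<dots> = total_d k F l as"
    proof (cases "2 \<le> l")
      case True
      then have "pr \<in> {0..k} - {1} \<longleftrightarrow> l \<le> k + 1" using assms by (auto simp: pr_def)
      then show ?thesis using True by (auto simp: total_d_def a_def b_def)
    next
      case False
      then have "l = 0 \<or> l = 1" by auto
      then show ?thesis by (auto simp: total_d_def a_def)
    qed
    finally show ?thesis .
  qed
  then show ?thesis by simp
qed

lemma shifted_Cmn:
  assumes "\<And>n. n \<le> k \<Longrightarrow> n \<noteq> 1 \<Longrightarrow> F n \<in> Cmn P V (k - n) n" "1 \<le> n" "n \<le> k"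
  shows "shifted F n \<in> Cmn P V (k - n) n"
proof (cases "n = 1")
  case True
  obtain k' where k: "k = Suc k'" using assms by (cases k) auto
  show ?thesis using iota_Cmn[of "F 0" k'] assms(1)[of 0] True by (simp add: shifted_def k)
qed (use assms in \<open>auto simp: shifted_def\<close>)

lemma total_d_eq:
  assumes "2 \<le> l" "l \<le> k + 1"
  shows "total_d k F l = (\<lambda>as. (if l \<le> k then d_CE P V (k - l) l (F l) as else 0) +
     sg (k + 1 - l) (d_H P V (k + 1 - l) (l - 1) (shifted F (l - 1)) as))"
  using assms by (auto simp: total_d_def fun_eq_iff)

lemma total_d_Cmn:
  assumes F: "\<And>n. n \<le> k \<Longrightarrow> n \<noteq> 1 \<Longrightarrow> F n \<in> Cmn P V (k - n) n" and k: "1 \<le> k" and l: "l \<le> k + 1" "l \<noteq> 1"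
  shows "total_d k F l \<in> Cmn P V (k + 1 - l) l"
proof (cases "l = 0")
  case True
  have "total_d k F 0 = d_CE0 P V k (F 0)" by (simp add: total_d_def fun_eq_iff)
  then show ?thesis using d_CE0_Cmn[of "F 0" k] F[of 0] k True by simp
next
  case False
  then have l2: "2 \<le> l" using l by simp
  have 1: "(\<lambda>as. sg (k + 1 - l) (d_H P V (k + 1 - l) (l - 1) (shifted F (l - 1)) as)) \<in> Cmn P V (k + 1 - l) l"
  proof (rule Cmn_sg)
    have "shifted F (l - 1) \<in> Cmn P V (k - (l - 1)) (l - 1)" using l l2 by (intro shifted_Cmn F) auto
    moreover have "k - (l - 1) = k + 1 - l" "Suc (l - 1) = l" using l2 by auto
    ultimately show "d_H P V (k + 1 - l) (l - 1) (shifted F (l - 1)) \<in> Cmn P V (k + 1 - l) l"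
      using d_H_Cmn[of "shifted F (l - 1)" "k + 1 - l" "l - 1"] l2 by simp
  qed (use l in simp)
  show ?thesis
  proof (cases "l \<le> k")
    case True
    then have "d_CE P V (k - l) l (F l) \<in> Cmn P V (k + 1 - l) l"
      using d_CE_Cmn[OF F[of l]] l l2 by (simp add: Suc_diff_le)
    then show ?thesis unfolding total_d_eq[OF l2 l(1)] using True 1 by (simp add: Cmn_add)
  qed (use 1 total_d_eq[OF l2 l(1)] in simp)
qed

text \<open>In each component \<open>d\<^sub>C\<^sub>E\<^sup>2\<close> and \<open>d\<^sub>H\<^sup>2\<close> vanish and the two mixed terms cancel because of the sign \<open>(-1)\<^sup>m\<close> in front of \<open>d\<^sub>H\<close>.\<close>
lemma total_d_total_d:
  assumes F: "\<And>n. n \<le> k \<Longrightarrow> n \<noteq> 1 \<Longrightarrow> F n \<in> Cmn P V (k - n) n" and k: "1 \<le> k"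
  shows "total_d (k + 1) (total_d k F) l as = 0"
proof -
  let ?G = "total_d k F"
  have G0: "?G 0 = d_CE0 P V k (F 0)" by (simp add: total_d_def fun_eq_iff)
  consider "l = 0" | "l = 1" | "l = 2" | "3 \<le> l" "l \<le> k + 2" | "k + 2 < l" by linarith
  then show ?thesis
  proof cases
    case 1
    then show ?thesis using d_CE0_d_CE0[OF F[of 0], simplified] k by (simp add: 1 total_d_def[of "Suc k"] G0)
  next
    case 2
    then show ?thesis by (simp add: total_d_def)
  next
    case 3
    obtain k' where k': "k = Suc k'" using k by (cases k) auto
    have F0: "F 0 \<in> Cmn P V (Suc k') 0" using F[of 0] by (simp add: k')
    let ?h = "d_H P V k' 1 (iota (F 0))"
    have "d_CE P V k' 2 (?G 2) = (\<lambda>as. sg k' (d_CE P V k' 2 ?h as))"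
    proof (cases "2 \<le> k")
      case True
      obtain k'' where k'': "k' = Suc k''" using True k' by (cases k') auto
      have "F 2 \<in> Cmn P V k'' 2" using F[of 2] True by (simp add: k' k'' numeral_2_eq_2)
      then have "d_CE P V k' 2 (d_CE P V k'' 2 (F 2)) = (\<lambda>_. 0)" unfolding k'' by (intro d_CE_d_CE) auto
      moreover have "?G 2 = (\<lambda>as. d_CE P V k'' 2 (F 2) as + sg k' (?h as))"
        using total_d_eq[of 2 k F] True by (simp add: k' k'' shifted_def numeral_2_eq_2)
      ultimately show ?thesis
        by (simp add: linear_op_add[OF linear_op_d_CE] linear_op_sg[OF linear_op_d_CE])
    next
      case False
      then have "?G 2 = (\<lambda>as. sg k' (?h as))"
        using total_d_eq[of 2 k F] k by (simp add: k' shifted_def numeral_2_eq_2)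
      then show ?thesis by (simp add: linear_op_sg[OF linear_op_d_CE])
    qed
    then have "total_d (k + 1) ?G 2 as = sg k' (d_CE P V k' 2 ?h as) + sg (Suc k') (d_H P V (Suc k') 1 (iota (d_CE0 P V (Suc k') (F 0))) as)"
      using total_d_eq[of 2 "k + 1" ?G] k G0 by (simp add: k' shifted_def numeral_2_eq_2)
    then show ?thesis using 3 d_H_d_CE0[OF F0] by (simp add: sg_Suc)
  next
    case 4
    \<comment> \<open>\<open>j\<close> is the column before \<open>l\<close>, and \<open>m\<close> its number of alternating arguments in degree \<open>k + 1\<close>\<close>
    define j where "j = l - 1"
    define m where "m = k + 2 - l"
    have l: "l = Suc j" "2 \<le> j" "j \<le> k + 1" "m = k + 1 - j" "Suc j - 1 = j" using 4 by (auto simp: j_def m_def)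
    have sh: "shifted F (j - 1) \<in> Cmn P V m (j - 1)"
      using shifted_Cmn[of k F "j - 1", OF F] l by (simp add: Suc_diff_le)
    have HH: "d_H P V m j (d_H P V m (j - 1) (shifted F (j - 1))) = (\<lambda>_. 0)"
      using d_H_d_H[OF sh] l by simp
    have G_j: "?G j = (\<lambda>as. (if j \<le> k then d_CE P V (k - j) j (F j) as else 0) + sg m (d_H P V m (j - 1) (shifted F (j - 1)) as))"
      using total_d_eq[of j k F] l by simp
    have B: "d_H P V m j (?G j) = (if j \<le> k then d_H P V m j (d_CE P V (k - j) j (F j)) else (\<lambda>_. 0))"
      unfolding G_j linear_op_add[OF linear_op_d_H] linear_op_sg[OF linear_op_d_H] HH
      by (simp add: linear_op_zero[OF linear_op_d_H])
    have eq: "total_d (k + 1) ?G l as = (if l \<le> k + 1 then d_CE P V (k + 1 - l) l (?G l) as else 0) + sg m (d_H P V m j (?G j) as)"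
      using total_d_eq[of l "k + 1" ?G] l 4 by (simp add: shifted_def)
    show ?thesis
    proof (cases "j \<le> k")
      case False
      then show ?thesis unfolding eq B using l by simp
    next
      case True
      define m' where "m' = k - j"
      have m': "m = Suc m'" "k - j = m'" "k + 1 - l = m'" using l True by (auto simp: m'_def)
      have Fj: "F j \<in> Cmn P V m' j" using F[of j] True l m' by simp
      have "d_CE P V m' l (?G l) = (\<lambda>as. sg m' (d_CE P V m' l (d_H P V m' j (F j)) as))"
      proof (cases "l \<le> k")
        case lk: True
        define m'' where "m'' = k - l"
        have m'': "m' = Suc m''" "k - l = m''" using l lk m'(2) by (auto simp: m''_def)
        have "F l \<in> Cmn P V m'' l" using F[of l] lk l m'' by simp
        then have "d_CE P V m' l (d_CE P V m'' l (F l)) = (\<lambda>_. 0)" unfolding m'' using l by (intro d_CE_d_CE) auto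
        moreover have "?G l = (\<lambda>as. d_CE P V m'' l (F l) as + sg m' (d_H P V m' j (F j) as))"
          using total_d_eq[of l k F] lk l m' m'' by (simp add: shifted_def)
        ultimately show ?thesis
          by (simp add: linear_op_add[OF linear_op_d_CE] linear_op_sg[OF linear_op_d_CE])
      next
        case False
        then have "?G l = (\<lambda>as. sg m' (d_H P V m' j (F j) as))"
          using total_d_eq[of l k F] True l m' by (simp add: shifted_def)
        then show ?thesis by (simp add: linear_op_sg[OF linear_op_d_CE])
      qed
      moreover have "d_CE P V m' l (d_H P V m' j (F j)) = d_H P V m j (d_CE P V m' j (F j))"
        using d_CE_d_H[OF Fj] l(1,2) m'(1) by simp
      moreover have "sg m v = - sg m' v" for v :: "'v mpol" unfolding m'(1) by (rule sg_Suc)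
      ultimately show ?thesis unfolding eq B m'(2,3) using True l(1) by simp
    qed
  next
    case 5
    then show ?thesis by (simp add: total_d_def)
  qed
qed

lemma C00_coset:
  assumes "X \<in> C00 V"
  obtains v where "X = {w. w - v \<in> range (del sV)}" "v \<in> X"
proof -
  obtain v where X: "X = {w. w - v \<in> range (del sV)}"
    using assms by (auto simp: C00_def quotient_def)
  moreover have "v \<in> X" unfolding X by simp (metis VM.scale_zero_right del_def rangeI)
  ultimately show ?thesis by (rule that)
qed

lemma del_add: "del sV (x + y) = del sV x + del sV y"
  by (simp add: del_def VM.scale_right_distrib)

lemma coset_add:
  assumes "X \<in> C00 V" "Y \<in> C00 V"
  shows "{x + y | x y. x \<in> X \<and> y \<in> Y} \<in> C00 V"
proof -
  obtain v where X: "X = {w. w - v \<in> range (del sV)}" by (rule C00_coset[OF assms(1)])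
  obtain u where Y: "Y = {w. w - u \<in> range (del sV)}" by (rule C00_coset[OF assms(2)])
  have "{x + y | x y. x \<in> X \<and> y \<in> Y} = {w. w - (v + u) \<in> range (del sV)}"
  proof (intro equalityI subsetI)
    fix w assume "w \<in> {x + y | x y. x \<in> X \<and> y \<in> Y}"
    then obtain x y a b where "w = x + y" "x - v = del sV a" "y - u = del sV b" by (auto simp: X Y)
    then have "w - (v + u) = del sV (a + b)" by (simp add: del_add algebra_simps)
    then show "w \<in> {w. w - (v + u) \<in> range (del sV)}" by simp
  next
    fix w assume "w \<in> {w. w - (v + u) \<in> range (del sV)}"
    then have "w - u \<in> X" by (simp add: X algebra_simps)
    moreover have "u \<in> Y" unfolding Y by simp (metis VM.scale_zero_right del_def rangeI)
    ultimately show "w \<in> {x + y | x y. x \<in> X \<and> y \<in> Y}" by (metis (mono_tags, lifting) diff_add_cancel mem_Collect_eq)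
  qed
  then show ?thesis unfolding C00_def quotient_def by auto
qed

lemma coset_scale:
  assumes "X \<in> C00 V"
  shows "{sV [:c:] x + del sV w | x w. x \<in> X} \<in> C00 V"
proof -
  obtain v where X: "X = {w. w - v \<in> range (del sV)}" and v: "v \<in> X" by (rule C00_coset[OF assms(1)])
  have "{sV [:c:] x + del sV w | x w. x \<in> X} = {w. w - sV [:c:] v \<in> range (del sV)}"
  proof (intro equalityI subsetI)
    fix z assume "z \<in> {sV [:c:] x + del sV w | x w. x \<in> X}"
    then obtain x w a where z: "z = sV [:c:] x + del sV w" "x - v = del sV a" by (auto simp: X)
    have "z - sV [:c:] v = sV [:c:] (x - v) + del sV w" by (simp add: z(1) VM.scale_right_diff_distrib)
    also have "\<dots> = del sV (sV [:c:] a + w)"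
      unfolding z(2) by (simp add: del_def VM.scale_right_distrib mult.commute)
    finally show "z \<in> {w. w - sV [:c:] v \<in> range (del sV)}" by simp
  next
    fix z assume "z \<in> {w. w - sV [:c:] v \<in> range (del sV)}"
    then obtain w where "z - sV [:c:] v = del sV w" by auto
    then have "z = sV [:c:] v + del sV w" by (simp add: algebra_simps)
    then show "z \<in> {sV [:c:] x + del sV w | x w. x \<in> X}" using v by blast
  qed
  then show ?thesis unfolding C00_def quotient_def by auto
qed

lemma d_CE00_add:
  assumes "X \<in> C00 V" "Y \<in> C00 V"
  shows "d_CE00 V {x + y | x y. x \<in> X \<and> y \<in> Y} as = d_CE00 V X as + d_CE00 V Y as"
proof (cases "length as = 1")
  case True
  obtain v where v: "v \<in> X" by (rule C00_coset[OF assms(1)])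
  obtain u where u: "u \<in> Y" by (rule C00_coset[OF assms(2)])
  have "v + u \<in> {x + y | x y. x \<in> X \<and> y \<in> Y}" using u v by blast
  from d_CE00_coset[OF this coset_add[OF assms] True] show ?thesis
    by (simp add: d_CE00_coset[OF v assms(1) True] d_CE00_coset[OF u assms(2) True] cst_add clinear_V2)
qed (simp add: d_CE00_def)

lemma d_CE00_scale:
  assumes "X \<in> C00 V"
  shows "d_CE00 V {sV [:c:] x + del sV w | x w. x \<in> X} as = act sV (cst [:c:]) (d_CE00 V X as)"
proof (cases "length as = 1")
  case True
  obtain v where v: "v \<in> X" by (rule C00_coset[OF assms(1)])
  have "sV [:c:] v + del sV 0 \<in> {sV [:c:] x + del sV w | x w. x \<in> X}" using v by blast
  from d_CE00_coset[OF this coset_scale[OF assms] True] show ?thesis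
    by (simp add: d_CE00_coset[OF v assms(1) True] clinear_V2 del_def flip: VM.act_cst)
qed (simp add: d_CE00_def)

lemma total_d_add: "total_d k (\<lambda>n as. F n as + G n as) l as = total_d k F l as + total_d k G l as"
proof -
  have "shifted (\<lambda>n as. F n as + G n as) n = (\<lambda>as. shifted F n as + shifted G n as)" for n
    by (simp add: shifted_def iota_def)
  then show ?thesis
    by (simp add: total_d_def linear_op_add[OF linear_op_d_CE] linear_op_add[OF linear_op_d_CE0] linear_op_add[OF linear_op_d_H] sg_add)
qed

lemma total_d_scale: "total_d k (\<lambda>n as. act sV (cst [:c:]) (F n as)) l as = act sV (cst [:c:]) (total_d k F l as)"
proof -
  have "shifted (\<lambda>n as. act sV (cst [:c:]) (F n as)) n = (\<lambda>as. act sV (cst [:c:]) (shifted F n as))" for n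
    by (simp add: shifted_def iota_def)
  moreover have "sg i (act sV q v) = act sV q (sg i v)" for i q v by (simp add: sg_def VM.act_minus2)
  ultimately show ?thesis
    by (simp add: total_d_def linear_op_scale[OF linear_op_d_CE] linear_op_scale[OF linear_op_d_CE0] linear_op_scale[OF linear_op_d_H] VM.act_add2)
qed

lemma C_FGV_cases:
  assumes "x \<in> C_FGV P V k"
  obtains (coset) X where "k = 0" "x = Coset X" "X \<in> C00 V"
  | (family) F where "1 \<le> k" "x = Family F" "\<And>n. n \<le> k \<Longrightarrow> n \<noteq> 1 \<Longrightarrow> F n \<in> Cmn P V (k - n) n"
proof (cases "k = 0")
  case True
  then show ?thesis using assms that(1) by (auto simp: C_FGV_def)
next
  case False
  then obtain F where "x = Family F" "\<forall>n. if n \<le> k \<and> n \<noteq> 1 then F n \<in> Cmn P V (k - n) n else F n = (\<lambda>_. 0)"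
    using assms by (auto simp: C_FGV_def)
  then show ?thesis using that(2)[of F] False by auto
qed

lemma d_FGV_closed:
  assumes "x \<in> C_FGV P V k"
  shows "d_FGV P V k x \<in> C_FGV P V (Suc k)"
  using assms
proof (cases rule: C_FGV_cases)
  case (coset X)
  obtain v where v: "v \<in> X" by (rule C00_coset[OF coset(3)])
  show ?thesis using coset representsD(2)[OF represents_CE00[OF v coset(3)]] by (auto simp: C_FGV_def le_Suc_eq intro!: imageI)
next
  case (family F)
  have "total_d k F n \<in> Cmn P V (Suc k - n) n" if "n \<le> Suc k" "n \<noteq> 1" for n
    using total_d_Cmn[of k F n] family that by simp
  moreover have "total_d k F n = (\<lambda>_. 0)" if "\<not> (n \<le> Suc k \<and> n \<noteq> 1)" for n
  proof
    fix as
    have "n = 1 \<or> Suc k < n" using that by linarith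
    then show "total_d k F n as = 0" by (elim disjE) (simp_all add: total_d_def)
  qed
  ultimately have "\<forall>n. if n \<le> Suc k \<and> n \<noteq> 1 then total_d k F n \<in> Cmn P V (Suc k - n) n else total_d k F n = (\<lambda>_. 0)"
    by presburger
  then show ?thesis
    unfolding family(2) d_FGV_total[OF family(1)] C_FGV_def by (simp only: if_False nat.distinct) (rule imageI, rule CollectI)
qed

lemma d_FGV_add:
  assumes "x \<in> C_FGV P V k" "y \<in> C_FGV P V k"
  shows "d_FGV P V k (add_FGV x y) = add_FGV (d_FGV P V k x) (d_FGV P V k y)"
  using assms(1)
proof (cases rule: C_FGV_cases)
  case (coset X)
  from assms(2) show ?thesis
    by (cases rule: C_FGV_cases) (use coset in \<open>auto simp: d_CE00_add fun_eq_iff\<close>)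
next
  case (family F)
  from assms(2) show ?thesis
  proof (cases rule: C_FGV_cases)
    case (family G)
    show ?thesis
      unfolding \<open>x = Family F\<close> \<open>y = Family G\<close> add_FGV.simps d_FGV_total[OF family(1)] total_d_add ..
  qed (use family in simp)
qed

lemma d_FGV_scale:
  assumes "x \<in> C_FGV P V k"
  shows "d_FGV P V k (scale_FGV V c x) = scale_FGV V c (d_FGV P V k x)"
  using assms
proof (cases rule: C_FGV_cases)
  case (coset X)
  have "d_CE00 V {sV [:c:] x + del sV w | x w. x \<in> X} = (\<lambda>as. act sV (cst [:c:]) (d_CE00 V X as))"
    by (rule ext) (rule d_CE00_scale[OF coset(3)])
  then show ?thesis
    unfolding coset(1,2) scale_FGV.simps d_FGV.simps by (simp only:) (simp add: fun_eq_iff)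
next
  case (family F)
  show ?thesis unfolding family(2) scale_FGV.simps d_FGV_total[OF family(1)] total_d_scale ..
qed

lemma d_FGV_d_FGV:
  assumes "x \<in> C_FGV P V k"
  shows "d_FGV P V (Suc k) (d_FGV P V k x) = Family (\<lambda>_ _. 0)"
  using assms
proof (cases rule: C_FGV_cases)
  case (coset X)
  have "total_d 1 (\<lambda>l. if l = 0 then d_CE00 V X else (\<lambda>_. 0)) l as = 0" for l as
  proof -
    consider "l = 0" | "l = 1" | "l = 2" | "2 < l" by linarith
    then show ?thesis
    proof cases
      case 1
      then show ?thesis using d_CE0_d_CE00(1)[OF coset(3)] by (simp add: total_d_def)
    next
      case 3
      then show ?thesis using d_CE0_d_CE00(2)[OF coset(3)] by (simp add: total_d_def shifted_def)
    qed (simp_all add: total_d_def)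
  qed
  then show ?thesis
    unfolding coset(1,2) d_FGV.simps(1) One_nat_def[symmetric] d_FGV_total[OF order_refl] by (simp add: fun_eq_iff)
next
  case (family F)
  have "total_d (Suc k) (total_d k F) l as = 0" for l as
    using total_d_total_d[of k F l as] family by simp
  then show ?thesis
    unfolding family(2) d_FGV_total[OF family(1)] by (subst d_FGV_total) auto
qed

end

theorem theorem5p9:
  fixes P :: "('p::ab_group_add) npca"
    and V :: "('p, 'v::ab_group_add) npca_mod"
  assumes "npc_algebra P"
    and "npc_module P V"
  shows "(\<forall>k. \<forall>x\<in>C_FGV P V k. d_FGV P V k x \<in> C_FGV P V (Suc k)) \<and>
    (\<forall>k. \<forall>x\<in>C_FGV P V k. \<forall>y\<in>C_FGV P V k.
        d_FGV P V k (add_FGV x y) = add_FGV (d_FGV P V k x) (d_FGV P V k y)) \<and>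
    (\<forall>k. \<forall>x\<in>C_FGV P V k. \<forall>c.
        d_FGV P V k (scale_FGV V c x) = scale_FGV V c (d_FGV P V k x)) \<and>
    (\<forall>k. \<forall>x\<in>C_FGV P V k. d_FGV P V (Suc k) (d_FGV P V k x) = Family (\<lambda>_ _. 0))"
proof -
  interpret npc_module P V by (rule assms(2))
  show ?thesis using d_FGV_closed d_FGV_add d_FGV_scale d_FGV_d_FGV by blast
qed

end
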